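(* Let $f\in\Sigma_6$ be a strictly positive form with coefficients in $\mathbb{Q}$. If $f$ fails to be a sum of squares of polynomials in $\mathbb{Q}[x_1,x_2,x_3]$, then $f$ lies in the boundary $\partial\Sigma_6$ of $\Sigma_6$, and $f$ is a singular point of the hypersurface $V$.
   Context: Let $A=\mathbb{R}[x_1,x_2,x_3]=\bigoplus_{d\ge0}A_d$ with the standard grading. $\Sigma_6\subset A_6$ is the closed convex cone of all sums of squares of forms in $A_3$; its boundary $\partial\Sigma_6$ is taken in the finite-dimensional real vector space $A_6$ (of dimension $28$). A form $f\in A$ is strictly positive if $f(a)>0$ for all $0\ne a\in\mathbb{R}^3$. $V\subset A_6$ is the Zariski closure of the set of all sums of three squares $q_1^2+q_2^2+q_3^2$ with $q_i\in A_3$. It is known that $V$ is an irreducible hypersurface in $A_6$ (one of the two irreducible components of the Zariski closure of $\partial\Sigma_6$), i.e. the zero set of an irreducible homogeneous polynomial $F$ in the $28$ coefficients of a ternary sextic, generating the vanishing ideal of $V$. A point $f\in V$ is singular if all first partial derivatives of $F$ vanish at $f$. *)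

theory Defs
  imports
    "HOL-Analysis.Analysis"
    "HOL-Library.Poly_Mapping"
    "HOL-Computational_Algebra.Factorial_Ring"
begin

text \<open>
  Polynomials in finitely many variables indexed by the type \<open>'x\<close>: finitely supported
  maps from exponent vectors to coefficients, with the convolution product provided by
  \<open>Poly_Mapping\<close>.
\<close>

type_synonym 'x exponent = "'x \<Rightarrow>\<^sub>0 nat"
type_synonym ('x, 'a) mpoly = "'x exponent \<Rightarrow>\<^sub>0 'a"

definition total_degree :: "'x::finite exponent \<Rightarrow> nat" where
  "total_degree m = (\<Sum>i\<in>UNIV. Poly_Mapping.lookup m i)"

definition forms :: "nat \<Rightarrow> ('x::finite, 'a::zero) mpoly set" where
  "forms d = {p. \<forall>m\<in>Poly_Mapping.keys p. total_degree m = d}"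

definition mpoly_eval :: "('x::finite, 'a::comm_semiring_1) mpoly \<Rightarrow> 'a ^ 'x \<Rightarrow> 'a" where
  "mpoly_eval p a =
     (\<Sum>m\<in>Poly_Mapping.keys p. Poly_Mapping.lookup p m * (\<Prod>i\<in>UNIV. a $ i ^ Poly_Mapping.lookup m i))"

text \<open>
  The formal partial derivative. For exponents \<open>m\<close> not involving the variable \<open>i\<close> the
  (truncating) subtraction is harmless, since the new coefficient is \<open>0\<close>.
\<close>

definition mpoly_pderiv :: "'x::finite \<Rightarrow> ('x, 'a::comm_semiring_1) mpoly \<Rightarrow> ('x, 'a) mpoly" where
  "mpoly_pderiv i p =
     (\<Sum>m\<in>Poly_Mapping.keys p.
        Poly_Mapping.single (m - Poly_Mapping.single i 1)
          (of_nat (Poly_Mapping.lookup m i) * Poly_Mapping.lookup p m))"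

definition sums_of_squares :: "'a::comm_semiring_1 set \<Rightarrow> 'a set" where
  "sums_of_squares B = {f. \<exists>qs. set qs \<subseteq> B \<and> f = (\<Sum>q\<leftarrow>qs. q ^ 2)}"

definition rational_mpolys :: "('x, real) mpoly set" where
  "rational_mpolys = {p. \<forall>m. Poly_Mapping.lookup p m \<in> \<rat>}"

definition strictly_positive :: "('x::finite, real) mpoly \<Rightarrow> bool" where
  "strictly_positive f \<longleftrightarrow> (\<forall>a. a \<noteq> 0 \<longrightarrow> mpoly_eval f a > 0)"

text \<open>
  The 28 exponent vectors of degree 6 in three variables. They index both the coordinates
  of the space of ternary sextics and the variables of polynomials on that space.
\<close>

typedef sextic_exponent = "{m :: 3 exponent. total_degree m = 6}"
proof -
  have "total_degree (Poly_Mapping.single 0 6 :: 3 exponent) = 6"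
    by (simp add: total_degree_def lookup_single when_def del: single_numeral)
  then show ?thesis by blast
qed

lemma finite_total_degree: "finite {m :: 'x::finite exponent. total_degree m = d}"
proof (rule inj_on_finite)
  show "inj_on Poly_Mapping.lookup {m :: 'x exponent. total_degree m = d}"
    by (rule inj_onI) (simp only: poly_mapping_eq_iff)
  have "Poly_Mapping.lookup m i \<le> total_degree m" for m :: "'x exponent" and i
    unfolding total_degree_def by (rule member_le_sum) simp_all
  then show "Poly_Mapping.lookup ` {m :: 'x exponent. total_degree m = d} \<subseteq> (\<Pi>\<^sub>E i\<in>UNIV. {..d})"
    by (fastforce simp: PiE_def)
  show "finite (\<Pi>\<^sub>E i\<in>(UNIV :: 'x set). {..d})"
    by (rule finite_PiE) simp_all
qed

instance sextic_exponent :: finite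
proof
  have "range Rep_sextic_exponent = {m. total_degree m = 6}"
    by (rule type_definition.Rep_range[OF type_definition_sextic_exponent])
  then have "finite (range Rep_sextic_exponent)"
    by (simp add: finite_total_degree)
  then show "finite (UNIV :: sextic_exponent set)"
    by (rule finite_imageD) (simp add: inj_on_def Rep_sextic_exponent_inject)
qed

text \<open>
  The coefficient vector identifies the space \<open>A\<^sub>6\<close> of ternary sextics, i.e. the set
  \<open>forms 6\<close>, with a 28-dimensional Euclidean space; see \<open>bij_betw_sextic_coeffs\<close> below.
\<close>

definition sextic_coeffs :: "(3, real) mpoly \<Rightarrow> real ^ sextic_exponent" where
  "sextic_coeffs f = (\<chi> m. Poly_Mapping.lookup f (Rep_sextic_exponent m))"

lemma bij_betw_sextic_coeffs: "bij_betw sextic_coeffs (forms 6) UNIV"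
proof (rule bij_betw_imageI)
  show "inj_on sextic_coeffs (forms 6)"
  proof (rule inj_onI)
    fix f g :: "(3, real) mpoly"
    assume fg: "f \<in> forms 6" "g \<in> forms 6" "sextic_coeffs f = sextic_coeffs g"
    show "f = g"
    proof (rule poly_mapping_eqI)
      fix m
      show "Poly_Mapping.lookup f m = Poly_Mapping.lookup g m"
      proof (cases "total_degree m = 6")
        case True
        then have "Rep_sextic_exponent (Abs_sextic_exponent m) = m"
          by (simp add: Abs_sextic_exponent_inverse)
        moreover have "sextic_coeffs f $ Abs_sextic_exponent m = sextic_coeffs g $ Abs_sextic_exponent m"
          using fg by simp
        ultimately show ?thesis by (simp add: sextic_coeffs_def)
      next
        case False
        then have "m \<notin> Poly_Mapping.keys f" "m \<notin> Poly_Mapping.keys g"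
          using fg by (auto simp: forms_def)
        then show ?thesis by (simp add: in_keys_iff)
      qed
    qed
  qed
  have "v \<in> sextic_coeffs ` forms 6" for v
  proof -
    define h where "h m = (if total_degree m = 6 then v $ Abs_sextic_exponent m else 0)" for m
    have "finite {m. h m \<noteq> 0}"
      by (rule finite_subset[OF _ finite_total_degree[of 6]]) (auto simp: h_def)
    then have lk: "Poly_Mapping.lookup (Abs_poly_mapping h) = h"
      by simp
    have "Abs_poly_mapping h \<in> forms 6"
      by (auto simp: forms_def in_keys_iff lk h_def split: if_splits)
    moreover have "sextic_coeffs (Abs_poly_mapping h) = v"
      using Rep_sextic_exponent
      by (auto simp: sextic_coeffs_def lk h_def vec_eq_iff Rep_sextic_exponent_inverse)
    ultimately show ?thesis by blast
  qed
  then show "sextic_coeffs ` forms 6 = UNIV" by blast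
qed

definition Sigma6 :: "(3, real) mpoly set" where
  "Sigma6 = sums_of_squares (forms 3)"

definition sextic_boundary :: "(3, real) mpoly set \<Rightarrow> (3, real) mpoly set" where
  "sextic_boundary S = {f \<in> forms 6. sextic_coeffs f \<in> frontier (sextic_coeffs ` S)}"

text \<open>
  Algebraic geometry on the affine space of real points \<open>A\<^sub>6\<close>: polynomial functions are
  given by real polynomials in the 28 coefficients of a sextic.
\<close>

definition vanishing_ideal :: "(3, real) mpoly set \<Rightarrow> (sextic_exponent, real) mpoly set" where
  "vanishing_ideal X = {P. \<forall>g\<in>X. mpoly_eval P (sextic_coeffs g) = 0}"

definition zero_set :: "(sextic_exponent, real) mpoly set \<Rightarrow> (3, real) mpoly set" where
  "zero_set I = {g \<in> forms 6. \<forall>P\<in>I. mpoly_eval P (sextic_coeffs g) = 0}"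

definition zariski_closure :: "(3, real) mpoly set \<Rightarrow> (3, real) mpoly set" where
  "zariski_closure X = zero_set (vanishing_ideal X)"

definition hypersurface_V :: "(3, real) mpoly set" where
  "hypersurface_V = zariski_closure {q1 ^ 2 + q2 ^ 2 + q3 ^ 2 | q1 q2 q3.
         q1 \<in> forms 3 \<and> q2 \<in> forms 3 \<and> q3 \<in> forms 3}"

definition defining_equation ::
  "(sextic_exponent, real) mpoly \<Rightarrow> (3, real) mpoly set \<Rightarrow> bool" where
  "defining_equation F X \<longleftrightarrow>
     irreducible F \<and> (\<exists>d. F \<in> forms d) \<and> X = zero_set {F} \<and> vanishing_ideal X = {P. F dvd P}"

definition singular_points ::
  "(sextic_exponent, real) mpoly \<Rightarrow> (3, real) mpoly set \<Rightarrow> (3, real) mpoly set" where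
  "singular_points F X = {g \<in> X. \<forall>i. mpoly_eval (mpoly_pderiv i F) (sextic_coeffs g) = 0}"

end

theory Submission
  imports Defs "HOL-Computational_Algebra.Polynomial"
begin

text \<open>
  Perturbing a positive definite Gram matrix to a rational one shows that a rational form in the
  interior of \<open>\<Sigma>\<^sub>6\<close> is a rational sum of squares. Otherwise \<open>f\<close> is killed by a nonzero linear
  functional \<open>l\<close> that is nonnegative on squares. Every cubic occurring in a sum of squares
  representation of \<open>f\<close> lies in the radical \<open>W\<close> of the form \<open>(p, q) \<mapsto> l (p q)\<close>, so \<open>W\<close> has no real
  zero because \<open>f\<close> is strictly positive.

  The key point is that then \<open>dim W \<le> 3\<close>. If \<open>W\<close> had dimension at least four, two of its members would
  have no common zero on a real line. After dehomogenising along that line, \<open>l\<close> extends to a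
  functional on \<open>\<real>[x, y]\<close> that kills the ideal of these two cubics. A third element of \<open>W\<close> makes the
  extension flat, hence positive, and multiplication by \<open>x\<close> and \<open>y\<close> has a joint real eigenvalue, which
  is a real zero of \<open>W\<close>.

  Hence \<open>f\<close> is a sum of three squares of a basis of \<open>W\<close>, so \<open>f \<in> V\<close>. The gradient of \<open>F\<close> at \<open>f\<close>
  annihilates \<open>W\<close> times all cubics, hence is a multiple of \<open>l\<close>. If it did not vanish, then \<open>W\<close> would
  be defined over \<open>\<rat>\<close>, and \<open>f\<close> would be a rational sum of squares by perturbation inside \<open>W\<close>.
\<close>

section \<open>Bivariate polynomials\<close>

text \<open>The functional is known only on sextics, and is nonnegative only on squares of cubics,
  whereas a real zero of \<open>W\<close> comes from a positive functional on all of R[x, y]. Two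
  affine cubics without common zero at infinity have a quotient of dimension nine, spanned by
  polynomials of degree at most 3 and a single class of degree 4, the socle. Only this class escapes
  the positivity on cubics. A further member of \<open>W\<close> that is nonzero in the quotient,
  and still null after the extension, makes the socle congruent to something of degree at most 3.
  Such a member has to satisfy three linear conditions: two corner coefficients vanish, so that it
  is independent of the two cubics, and its product with the socle monomial is killed. This is where
  four dimensions enter. The line at infinity is chosen so that one leading form is a cube, which
  makes division by the leading forms explicit.\<close>

definition bicoeff :: "real poly poly \<Rightarrow> nat \<Rightarrow> nat \<Rightarrow> real" where
  "bicoeff p i j = coeff (coeff p j) i"

definition bideg_le :: "nat \<Rightarrow> real poly poly set" where
  "bideg_le d = {p. \<forall>i j. d < i + j \<longrightarrow> bicoeff p i j = 0}"

definition biC :: "real \<Rightarrow> real poly poly" where "biC r = [:[:r:]:]"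
definition biX :: "real poly poly" where "biX = [:[:0, 1:]:]"
definition biY :: "real poly poly" where "biY = [:0, 1:]"

lemma biC_simps [simp]: "biC 0 = 0" "biC 1 = 1"
  by (simp_all add: biC_def one_pCons)

lemma biC_arith:
  "biC (r + s) = biC r + biC s" "biC (r - s) = biC r - biC s" "biC (- r) = - biC r" "biC (r * s) = biC r * biC s"
  by (simp_all add: biC_def)

definition bieval :: "real poly poly \<Rightarrow> real \<Rightarrow> real \<Rightarrow> real" where
  "bieval p x y = poly (poly p [:y:]) x"

text \<open>Truncates a coefficient function to total degree at most \<open>d\<close>; it serves as
  the normal form in which polynomials are expanded, and to build a cofactor from prescribed
  coefficients.\<close>

definition bisum :: "nat \<Rightarrow> (nat \<Rightarrow> nat \<Rightarrow> real) \<Rightarrow> real poly poly" where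
  "bisum d h = (\<Sum>i\<le>d. \<Sum>j\<le>d - i. biC (h i j) * (biX ^ i * biY ^ j))"

lemma bicoeff_eqI: "(\<And>i j. bicoeff p i j = bicoeff q i j) \<Longrightarrow> p = q"
  by (intro poly_eqI) (simp add: bicoeff_def)

lemma bicoeff_simps [simp]:
  "bicoeff 0 i j = 0"
  "bicoeff (p + q) i j = bicoeff p i j + bicoeff q i j"
  "bicoeff (p - q) i j = bicoeff p i j - bicoeff q i j"
  "bicoeff (- p) i j = - bicoeff p i j"
  "bicoeff (biC r * p) i j = r * bicoeff p i j"
  "bicoeff (biX * p) i j = (if i = 0 then 0 else bicoeff p (i - 1) j)"
  "bicoeff (biY * p) i j = (if j = 0 then 0 else bicoeff p i (j - 1))"
  "bicoeff 1 i j = (if i = 0 \<and> j = 0 then 1 else 0)"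
  by (auto simp: bicoeff_def biC_def biX_def biY_def coeff_pCons split: nat.splits)

lemma bicoeff_sum: "bicoeff (\<Sum>a\<in>A. g a) i j = (\<Sum>a\<in>A. bicoeff (g a) i j)"
  by (simp add: bicoeff_def coeff_sum)

lemma bicoeff_X_power: "bicoeff (biX ^ k * p) i j = (if i < k then 0 else bicoeff p (i - k) j)"
proof (induction k arbitrary: i)
  case (Suc k)
  have "biX ^ Suc k * p = biX * (biX ^ k * p)" by (simp only: power_Suc mult.assoc)
  then show ?case using Suc by (simp only: bicoeff_simps) auto
qed simp

lemma bicoeff_Y_power: "bicoeff (biY ^ k * p) i j = (if j < k then 0 else bicoeff p i (j - k))"
proof (induction k arbitrary: j)
  case (Suc k)
  have "biY ^ Suc k * p = biY * (biY ^ k * p)" by (simp only: power_Suc mult.assoc)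
  then show ?case using Suc by (simp only: bicoeff_simps) auto
qed simp

lemma bicoeff_monomial: "bicoeff (biX ^ a * biY ^ b) i j = (if i = a \<and> j = b then 1 else 0)"
proof -
  have "bicoeff (biX ^ a * biY ^ b) i j = bicoeff (biX ^ a * (biY ^ b * 1)) i j" by simp
  also have "\<dots> = (if i = a \<and> j = b then 1 else 0)"
    unfolding bicoeff_X_power bicoeff_Y_power bicoeff_simps by auto
  finally show ?thesis .
qed

lemma bicoeff_mult:
  "bicoeff (p * q) i j = (\<Sum>b\<le>j. \<Sum>a\<le>i. bicoeff p a b * bicoeff q (i - a) (j - b))"
  by (simp add: bicoeff_def coeff_mult coeff_sum)

lemma bicoeff_bisum: "bicoeff (bisum d h) i j = (if i + j \<le> d then h i j else 0)"
proof -
  have *: "bicoeff (bisum d h) i j =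
      (\<Sum>a\<le>d. \<Sum>b\<le>d - a. if a = i then (if b = j then h a b else 0) else 0)"
    unfolding bisum_def bicoeff_sum bicoeff_simps bicoeff_monomial by (intro sum.cong) auto
  have "\<dots> = (\<Sum>a\<le>d. if a = i then (\<Sum>b\<le>d - a. if b = j then h a b else 0) else 0)"
    by (intro sum.cong) auto
  with * show ?thesis by (auto simp: sum.delta)
qed

lemma bideg_le_eq_bisum: "p \<in> bideg_le d \<Longrightarrow> p = bisum d (bicoeff p)"
  by (intro bicoeff_eqI) (auto simp: bicoeff_bisum bideg_le_def)

lemma bisum_bideg_le: "bisum d h \<in> bideg_le d"
  by (auto simp: bideg_le_def bicoeff_bisum)

lemma bideg_le_mono: "d \<le> e \<Longrightarrow> bideg_le d \<subseteq> bideg_le e"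
  by (force simp: bideg_le_def)

lemma bideg_le_closed:
  "0 \<in> bideg_le d" 
  "p \<in> bideg_le d \<Longrightarrow> q \<in> bideg_le d \<Longrightarrow> p + q \<in> bideg_le d"
  "p \<in> bideg_le d \<Longrightarrow> q \<in> bideg_le d \<Longrightarrow> p - q \<in> bideg_le d"
  "p \<in> bideg_le d \<Longrightarrow> biC r * p \<in> bideg_le d"
  unfolding bideg_le_def mem_Collect_eq bicoeff_simps by auto

lemma bideg_le_mult: "p \<in> bideg_le d \<Longrightarrow> q \<in> bideg_le e \<Longrightarrow> p * q \<in> bideg_le (d + e)"
proof -
  assume p: "p \<in> bideg_le d" and q: "q \<in> bideg_le e"
  have "bicoeff (p * q) i j = 0" if "d + e < i + j" for i j
    unfolding bicoeff_mult
  proof (intro sum.neutral ballI)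
    fix a b assume "b \<in> {..j}" "a \<in> {..i}"
    then have "d < a + b \<or> e < (i - a) + (j - b)" using that by auto
    then show "bicoeff p a b * bicoeff q (i - a) (j - b) = 0"
      using p q by (auto simp: bideg_le_def)
  qed
  then show ?thesis by (simp add: bideg_le_def)
qed

lemma bideg_le_mult': "p \<in> bideg_le d \<Longrightarrow> q \<in> bideg_le e \<Longrightarrow> d + e \<le> n \<Longrightarrow> p * q \<in> bideg_le n"
  using bideg_le_mult bideg_le_mono by blast

lemma bideg_le_gens: "biX \<in> bideg_le 1" "biY \<in> bideg_le 1" "1 \<in> bideg_le d"
proof -
  have "biX * 1 \<in> bideg_le 1" "biY * 1 \<in> bideg_le 1" "1 \<in> bideg_le d"
    unfolding bideg_le_def mem_Collect_eq bicoeff_simps by auto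
  then show "biX \<in> bideg_le 1" "biY \<in> bideg_le 1" "1 \<in> bideg_le d" by simp_all
qed

lemma bideg_le_monomial: "i + j \<le> d \<Longrightarrow> biX ^ i * biY ^ j \<in> bideg_le d"
  by (auto simp: bideg_le_def bicoeff_monomial)

lemma ex_bideg_le: "\<exists>d. p \<in> bideg_le d"
proof -
  define D where "D = (\<Sum>j\<le>degree p. degree (coeff p j))"
  have "bicoeff p i j = 0" if "degree p + D < i + j" for i j
  proof (cases "j \<le> degree p")
    case True
    then have "degree (coeff p j) \<le> D" unfolding D_def by (intro member_le_sum) auto
    then show ?thesis using that True by (auto simp: bicoeff_def coeff_eq_0)
  qed (simp add: bicoeff_def coeff_eq_0)
  then show ?thesis by (auto simp: bideg_le_def)
qed

lemma bieval_simps [simp]: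
  "bieval (p + q) x y = bieval p x y + bieval q x y"
  "bieval (p - q) x y = bieval p x y - bieval q x y"
  "bieval (p * q) x y = bieval p x y * bieval q x y"
  "bieval (biC r) x y = r" "bieval biX x y = x" "bieval biY x y = y"
  by (simp_all add: bieval_def biC_def biX_def biY_def)

text \<open>Dividing by y - \<open>y\<close> leaves a polynomial in x alone, and dividing that by x
  - \<open>x\<close> leaves the value. The kernel of evaluation is thus generated by the two linear
  polynomials.\<close>

lemma bieval_decompose:
  "\<exists>s t. p = biC (bieval p x y) + (biX - biC x) * s + (biY - biC y) * t"
proof -
  define g where "g = poly p [:y:]"
  have 1: "p = [:g:] + (biY - biC y) * synthetic_div p [:y:]"
    using synthetic_div_correct'[of "[:y:]" p] by (simp add: g_def biC_def biY_def algebra_simps)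
  have "g = [:poly g x:] + [:-x, 1:] * synthetic_div g x"
    using synthetic_div_correct'[of x g] by (simp add: algebra_simps)
  then have "[:g:] = [:[:poly g x:] + [:-x, 1:] * synthetic_div g x:]" by simp
  also have "\<dots> = biC (poly g x) + (biX - biC x) * [:synthetic_div g x:]" by (simp add: biC_def biX_def)
  finally have "p = biC (bieval p x y) + (biX - biC x) * [:synthetic_div g x:] + (biY - biC y) * synthetic_div p [:y:]"
    using 1 by (simp add: bieval_def g_def)
  then show ?thesis by blast
qed

lemma bieval_eq_0D: "(\<And>x y. bieval p x y = 0) \<Longrightarrow> p = 0"
proof (rule ccontr)
  assume z: "\<And>x y. bieval p x y = 0" and "p \<noteq> 0"
  have "poly p [:y:] = 0" for y
    using z poly_all_0_iff_0[of "poly p [:y:]"] by (simp add: bieval_def)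
  then have "(\<lambda>y. [:y:]) ` UNIV \<subseteq> {u. poly p u = 0}" by auto
  moreover have "finite {u. poly p u = 0}" using \<open>p \<noteq> 0\<close> by (rule poly_roots_finite)
  ultimately have "finite ((\<lambda>y::real. [:y:]) ` UNIV)" by (rule finite_subset)
  then have "finite (UNIV :: real set)" by (rule finite_imageD) (simp add: inj_on_def)
  then show False by (simp add: infinite_UNIV_char_0)
qed

section \<open>Positive semidefinite functionals\<close>

text \<open>For small t of sign opposite to \<open>b\<close> the linear term dominates; t = -b / k
  with k > 0 and k \<ge> c already gives a negative value.\<close>

lemma linear_coeff_zero_of_nonneg:
  fixes b c :: real
  assumes "\<And>t. 0 \<le> 2 * t * b + t\<^sup>2 * c"
  shows "b = 0"
proof (rule ccontr)
  assume b: "b \<noteq> 0"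
  define k where "k = \<bar>c\<bar> + 1"
  have k: "k > 0" "c \<le> k" by (auto simp: k_def)
  have "0 \<le> 2 * (- b / k) * b + (- b / k)\<^sup>2 * c" by (rule assms)
  also have "\<dots> = (b\<^sup>2 * c - 2 * b\<^sup>2 * k) / k\<^sup>2"
    using k by (simp add: field_simps power2_eq_square)
  also have "\<dots> < 0"
  proof -
    have "b\<^sup>2 * c \<le> b\<^sup>2 * k" using k by (intro mult_left_mono) auto
    moreover have "b\<^sup>2 * k > 0" using b k by simp
    ultimately have "b\<^sup>2 * c - 2 * b\<^sup>2 * k < 0" by linarith
    then show ?thesis using k by (simp add: divide_less_0_iff)
  qed
  finally show False by simp
qed

text \<open>A null vector minimises the nonnegative quadratic form, so the first variation at
  \<open>v\<close> vanishes in every direction.\<close>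

lemma semidefinite_null:
  fixes C :: "'a::euclidean_space \<Rightarrow> 'a \<Rightarrow> real"
  assumes C: "bilinear C" "\<And>u v. C u v = C v u" "\<And>u. 0 \<le> C u u" "C v v = 0"
  shows "C v u = 0"
proof (rule linear_coeff_zero_of_nonneg)
  fix t
  have "0 \<le> C (v + t *\<^sub>R u) (v + t *\<^sub>R u)" by (rule C)
  also have "\<dots> = 2 * t * C v u + t\<^sup>2 * C u u"
    using C(4) C(2)[of u v] by (simp add: bilinear_ladd[OF C(1)] bilinear_radd[OF C(1)] bilinear_lmul[OF C(1)]
        bilinear_rmul[OF C(1)] power2_eq_square algebra_simps)
  finally show "0 \<le> 2 * t * C v u + t\<^sup>2 * C u u" .
qed

text \<open>Since \<open>B\<close> may have a kernel \<open>K\<close>, the Rayleigh quotient is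
  minimised on the unit sphere of the orthogonal complement of \<open>K\<close>, which is compact
  and where \<open>B\<close> is positive. As \<open>B'\<close> vanishes against \<open>K\<close>
  too, the minimum is a bound everywhere. The minimiser is then a null vector of the semidefinite
  form \<open>B' - r B\<close>, which is the eigenvector equation.\<close>

lemma rayleigh_minimiser:
  fixes B B' :: "'a::euclidean_space \<Rightarrow> 'a \<Rightarrow> real"
  assumes B: "bilinear B" "\<And>u v. B u v = B v u" "\<And>u. 0 \<le> B u u" "B w w \<noteq> 0"
    and B': "bilinear B'" "\<And>u v. B' u v = B' v u" "\<And>u v. B u u = 0 \<Longrightarrow> B' u v = 0"
  obtains r v where "0 < B v v" "\<And>u. r * B u u \<le> B' u u" "\<And>u. B' v u = r * B v u"
proof -
  define K where "K = {u. B u u = 0}"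
  have null: "B u v = 0" if "u \<in> K" for u v
    using that semidefinite_null[of B u v] B by (auto simp: K_def)
  have null': "B v u = 0" "B' v u = 0" if "u \<in> K" for u v
    using null[OF that, of v] B'(3)[of u v] that B(2)[of v u] B'(2)[of v u] by (auto simp: K_def)
  have "subspace K"
    unfolding subspace_def
  proof (intro conjI ballI allI)
    fix x y c assume "x \<in> K" "y \<in> K"
    then show "x + y \<in> K" "c *\<^sub>R x \<in> K"
      using null[of x] null[of y] B(2)
      by (simp_all add: K_def bilinear_ladd[OF B(1)] bilinear_radd[OF B(1)] bilinear_lmul[OF B(1)] bilinear_rmul[OF B(1)])
  qed (simp add: K_def bilinear_lzero[OF B(1)])
  then have spanK: "span K = K" by (simp add: span_eq_iff)
  define S where "S = {z. (\<forall>x\<in>K. orthogonal x z)} \<inter> sphere 0 1"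
  have split: "\<exists>k z. k \<in> K \<and> (\<forall>x\<in>K. orthogonal x z) \<and> u = k + z" for u
    using orthogonal_subspace_decomp_exists[of K u] unfolding spanK by (metis orthogonal_commute)
  have pos: "0 < B z z" if "z \<in> S" for z
  proof -
    have "z \<notin> K" using that by (auto simp: S_def orthogonal_def)
    then show ?thesis using B(3)[of z] by (auto simp: K_def less_le)
  qed
  have reduce: "B (k + z) (k + z) = B z z" "B' (k + z) (k + z) = B' z z" if "k \<in> K" for k z
    using null[OF that] null'[OF that] B'(3)[of k] that
    by (simp_all add: K_def bilinear_ladd[OF B(1)] bilinear_radd[OF B(1)] bilinear_ladd[OF B'(1)] bilinear_radd[OF B'(1)])
  have "closed {z. \<forall>x\<in>K. orthogonal x z}"
    unfolding orthogonal_def Collect_ball_eq by (intro closed_INT ballI closed_Collect_eq continuous_intros)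
  then have "compact S" unfolding S_def by (intro closed_Int_compact) auto
  have unit: "z /\<^sub>R norm z \<in> S" if "\<forall>x\<in>K. orthogonal x z" "z \<noteq> 0" for z
    using that by (auto simp: S_def orthogonal_def)
  obtain k z where kz: "k \<in> K" "\<forall>x\<in>K. orthogonal x z" "w = k + z" using split by blast
  have "z \<noteq> 0" using kz B(4) by (auto simp: K_def)
  then have "S \<noteq> {}" using unit kz by blast
  have "continuous_on S (\<lambda>z. B' z z / B z z)"
    using B(1) B'(1) pos
    by (intro continuous_intros bounded_bilinear.continuous_on[of B] bounded_bilinear.continuous_on[of B'])
      (auto simp: bilinear_conv_bounded_bilinear dest: pos)
  then obtain v where v: "v \<in> S" "\<And>z. z \<in> S \<Longrightarrow> B' v v / B v v \<le> B' z z / B z z"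
    using continuous_attains_inf[OF \<open>compact S\<close> \<open>S \<noteq> {}\<close>] by blast
  define r where "r = B' v v / B v v"
  have ge: "r * B u u \<le> B' u u" for u
  proof -
    obtain k z where kz: "k \<in> K" "\<forall>x\<in>K. orthogonal x z" "u = k + z" using split by blast
    have "r * B z z \<le> B' z z"
    proof (cases "z = 0")
      case False
      define e where "e = z /\<^sub>R norm z"
      have "e \<in> S" using unit kz False by (simp add: e_def)
      then have "r * B e e \<le> B' e e" using v(2)[of e] pos[of e] by (simp add: r_def pos_le_divide_eq)
      moreover have "B (n *\<^sub>R e) (n *\<^sub>R e) = n\<^sup>2 * B e e" "B' (n *\<^sub>R e) (n *\<^sub>R e) = n\<^sup>2 * B' e e" for n
        by (simp_all add: bilinear_lmul[OF B(1)] bilinear_rmul[OF B(1)] bilinear_lmul[OF B'(1)] bilinear_rmul[OF B'(1)] power2_eq_square)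
      from this[of "norm z"] have "B z z = (norm z)\<^sup>2 * B e e" "B' z z = (norm z)\<^sup>2 * B' e e"
        using False by (simp_all add: e_def)
      ultimately show ?thesis
        using mult_left_mono[of "r * B e e" "B' e e" "(norm z)\<^sup>2"] by (simp add: mult.left_commute)
    qed (simp add: bilinear_lzero B(1) B'(1))
    then show ?thesis using kz reduce by simp
  qed
  define C where "C = (\<lambda>x y. B' x y - r * B x y)"
  have 1: "bilinear C"
    unfolding C_def bilinear_def
    by (intro conjI allI linearI)
      (simp_all add: bilinear_ladd[OF B(1)] bilinear_radd[OF B(1)] bilinear_lmul[OF B(1)] bilinear_rmul[OF B(1)]
        bilinear_ladd[OF B'(1)] bilinear_radd[OF B'(1)] bilinear_lmul[OF B'(1)] bilinear_rmul[OF B'(1)]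
        distrib_left right_diff_distrib mult.left_commute)
  have 2: "C v v = 0" using pos[OF v(1)] by (simp add: C_def r_def)
  have 3: "C x y = C y x" for x y using B(2)[of x y] B'(2)[of x y] by (simp add: C_def)
  have 4: "0 \<le> C x x" for x using ge[of x] by (simp add: C_def)
  have "C v u = 0" for u by (rule semidefinite_null[OF 1 3 4 2])
  then show thesis using that[of v r] pos[OF v(1)] ge by (auto simp: C_def)
qed

section \<open>Functionals on R[x, y] and their null ideals\<close>

locale bivariate_functional =
  fixes L :: "real poly poly \<Rightarrow> real"
  assumes add: "L (p + q) = L p + L q"
    and scale: "L (biC r * p) = r * L p"
begin

text \<open>The largest ideal inside the kernel of \<open>L\<close>; on the quotient by it the form
  L (p q) is nondegenerate.\<close>

definition null :: "real poly poly set" where "null = {a. \<forall>b. L (a * b) = 0}"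

lemma zero [simp]: "L 0 = 0" using add[of 0 0] by simp
lemma minus: "L (- p) = - L p" using add[of p "- p"] by simp
lemma diff: "L (p - q) = L p - L q" using add[of p "- q"] minus[of q] by simp
lemma sum: "L (\<Sum>i\<in>A. g i) = (\<Sum>i\<in>A. L (g i))"
  by (induction A rule: infinite_finite_induct) (auto simp: add)

lemma null_closed:
  "0 \<in> null"
  "a \<in> null \<Longrightarrow> b \<in> null \<Longrightarrow> a + b \<in> null" 
  "a \<in> null \<Longrightarrow> b \<in> null \<Longrightarrow> a - b \<in> null" 
  "a \<in> null \<Longrightarrow> c * a \<in> null" "a \<in> null \<Longrightarrow> a * c \<in> null"
  by (simp_all add: null_def distrib_right left_diff_distrib add diff)
     (metis mult.assoc mult.commute)+

end

locale psd_functional = bivariate_functional +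
  assumes psd: "0 \<le> L (a * a)"
begin

text \<open>L ((a + t b)^2) is nonnegative and vanishes at t = 0, so its linear term in t is zero.
  Membership in the ideal can therefore be tested on a single square.\<close>

lemma nullI: "L (a * a) = 0 \<Longrightarrow> a \<in> null"
proof -
  assume a: "L (a * a) = 0"
  have "L (a * b) = 0" for b
  proof (rule linear_coeff_zero_of_nonneg)
    fix t
    have "(a + biC t * b) * (a + biC t * b) = a * a + (biC (2 * t) * (a * b) + biC (t\<^sup>2) * (b * b))"
    proof -
      have "biC (2 * t) = 2 * biC t" "biC (t\<^sup>2) = biC t * biC t"
        by (simp_all add: power2_eq_square biC_def numeral_poly)
      moreover have "(a + s * b) * (a + s * b) = a * a + (2 * s * (a * b) + s * s * (b * b))" for s
        by (simp add: algebra_simps)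
      ultimately show ?thesis by (simp only:)
    qed
    then have "L ((a + biC t * b) * (a + biC t * b)) = L (a * a) + 2 * t * L (a * b) + t\<^sup>2 * L (b * b)"
      by (simp only: add scale)
    with psd[of "a + biC t * b"] a show "0 \<le> 2 * t * L (a * b) + t\<^sup>2 * L (b * b)" by simp
  qed
  then show ?thesis by (simp add: null_def)
qed

text \<open>The map \<open>\<kappa>\<close> parametrises representatives of all classes modulo
  \<open>null\<close> by a Euclidean space, so the quotient is finite-dimensional. Multiplication by
  \<open>t\<close> is symmetric for the form L (p q); hence a Rayleigh minimiser is an eigenvector
  with real eigenvalue. \<open>L b \<noteq> 0\<close> keeps the form from vanishing
  identically.\<close>

lemma exists_eigenvector:
  fixes \<kappa> :: "'e::euclidean_space \<Rightarrow> real poly poly"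
  assumes \<kappa>: "\<And>u v. \<kappa> (u + v) = \<kappa> u + \<kappa> v" "\<And>r u. \<kappa> (r *\<^sub>R u) = biC r * \<kappa> u"
    and span: "\<And>p. \<exists>v. p - \<kappa> v \<in> null" and "L b \<noteq> 0"
  obtains r a where "0 < L (a * a)" "(t - biC r) * a \<in> null"
proof -
  define B where "B u v = L (\<kappa> u * \<kappa> v)" for u v
  define B' where "B' u v = L (t * (\<kappa> u * \<kappa> v))" for u v
  have *: "biC r * p * q = biC r * (p * q)" "p * (biC r * q) = biC r * (p * q)" for r p q
    by (simp_all add: mult.left_commute)
  have "bilinear B" "bilinear B'"
    unfolding bilinear_def
    by (auto intro!: linearI simp: B_def B'_def \<kappa> distrib_left distrib_right add * scale)
  obtain w where w: "1 - \<kappa> w \<in> null" using span by blast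
  have "B w w \<noteq> 0"
  proof
    assume "B w w = 0"
    then have "\<kappa> w \<in> null" using nullI by (simp add: B_def)
    from null_closed(2)[OF w this] have "1 \<in> null" by simp
    then show False using \<open>L b \<noteq> 0\<close> by (auto simp: null_def)
  qed
  have kernel: "B' u v = 0" if "B u u = 0" for u v
  proof -
    have "\<kappa> u \<in> null" using nullI that by (simp add: B_def)
    then have "\<kappa> u * (t * \<kappa> v) \<in> null" by (rule null_closed)
    then have "L (\<kappa> u * (t * \<kappa> v) * 1) = 0" unfolding null_def by blast
    then show ?thesis by (simp add: B'_def mult.left_commute)
  qed
  obtain r v where rv: "0 < B v v" "\<And>u. B' v u = r * B v u"
    by (rule rayleigh_minimiser[of B w B'])
       (use \<open>bilinear B\<close> \<open>bilinear B'\<close> \<open>B w w \<noteq> 0\<close> kernel psd in \<open>auto simp: B_def B'_def mult.commute\<close>)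
  have "L ((t - biC r) * \<kappa> v * p) = 0" for p
  proof -
    obtain u where u: "p - \<kappa> u \<in> null" using span by blast
    have "(p - \<kappa> u) * ((t - biC r) * \<kappa> v) \<in> null" using u by (rule null_closed)
    then have "L ((p - \<kappa> u) * ((t - biC r) * \<kappa> v) * 1) = 0" unfolding null_def by blast
    moreover have "(t - biC r) * \<kappa> v * p = (p - \<kappa> u) * ((t - biC r) * \<kappa> v) * 1 + (t * (\<kappa> v * \<kappa> u) - biC r * (\<kappa> v * \<kappa> u))"
      by algebra
    ultimately have "L ((t - biC r) * \<kappa> v * p) = L (t * (\<kappa> v * \<kappa> u)) - r * L (\<kappa> v * \<kappa> u)"
      by (simp only: add diff scale)
    then show ?thesis using rv(2)[of u] by (simp add: B_def B'_def)
  qed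
  then have "(t - biC r) * \<kappa> v \<in> null" by (simp add: null_def)
  then show thesis using that[of "\<kappa> v" r] rv by (simp add: B_def)
qed

text \<open>The weight is itself a square: a^2 p^2 = (a p)^2.\<close>

lemma weighted: "psd_functional (\<lambda>b. L (a * a * b))"
proof
  fix p q r
  show "L (a * a * (p + q)) = L (a * a * p) + L (a * a * q)" by (simp add: distrib_left add)
  show "L (a * a * (biC r * p)) = r * L (a * a * p)" by (subst mult.left_commute) (rule scale)
  show "0 \<le> L (a * a * (p * p))" using psd[of "a * p"] by (simp add: mult_ac)
qed

text \<open>
  Adjoining a Rayleigh eigenvector as a weight \<open>a\<^sup>2\<close> turns multiplication by \<open>x\<close> into a scalar; a second
  weight does the same for \<open>y\<close>.
\<close>

lemma exists_real_zero:
  fixes \<kappa> :: "'e::euclidean_space \<Rightarrow> real poly poly"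
  assumes \<kappa>: "\<And>u v. \<kappa> (u + v) = \<kappa> u + \<kappa> v" "\<And>r u. \<kappa> (r *\<^sub>R u) = biC r * \<kappa> u"
    and span: "\<And>p. \<exists>v. p - \<kappa> v \<in> null" and "L b \<noteq> 0"
  obtains x y where "\<And>p. p \<in> null \<Longrightarrow> bieval p x y = 0"
proof -
  obtain x a where a: "0 < L (a * a)" "(biX - biC x) * a \<in> null"
    by (rule exists_eigenvector[OF assms])
  interpret L1: psd_functional "\<lambda>b. L (a * a * b)" by (rule weighted)
  have sub1: "null \<subseteq> L1.null"
  proof
    fix p assume "p \<in> null"
    then have "L (p * (a * a * b)) = 0" for b unfolding null_def by blast
    then show "p \<in> L1.null" unfolding L1.null_def by (simp add: mult_ac)
  qed
  have span1: "\<exists>v. p - \<kappa> v \<in> L1.null" for p using span sub1 by blast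
  have "L (a * a * 1) \<noteq> 0" using a(1) by simp
  then obtain y c where c: "0 < L (a * a * (c * c))" "(biY - biC y) * c \<in> L1.null"
    by (rule L1.exists_eigenvector[OF \<kappa> span1])
  interpret L2: psd_functional "\<lambda>b. L (a * a * (c * c * b))" by (rule L1.weighted)
  have sub2: "L1.null \<subseteq> L2.null"
  proof
    fix p assume "p \<in> L1.null"
    then have "L (a * a * (p * (c * c * b))) = 0" for b unfolding L1.null_def by blast
    then show "p \<in> L2.null" unfolding L2.null_def by (simp add: mult_ac)
  qed
  \<comment> \<open>The eigenvector equation for \<open>a\<close> is absorbed by the weight
    \<open>a * a\<close>, so under the weighted functional x acts as the scalar
    \<open>x\<close>.\<close>
  have X: "biX - biC x \<in> L2.null"
  proof -
    have "L ((biX - biC x) * a * (a * (c * c * b))) = 0" for b using a(2) unfolding null_def by blast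
    then show ?thesis unfolding L2.null_def by (simp add: mult_ac)
  qed
  have Y: "biY - biC y \<in> L2.null"
  proof -
    have "L (a * a * ((biY - biC y) * c * (c * b))) = 0" for b using c(2) unfolding L1.null_def by blast
    then show ?thesis unfolding L2.null_def by (simp add: mult_ac)
  qed
  have "bieval p x y = 0" if p: "p \<in> null" for p
  proof -
    obtain s t where st: "p = biC (bieval p x y) + (biX - biC x) * s + (biY - biC y) * t"
      using bieval_decompose by blast
    have "(biX - biC x) * s + (biY - biC y) * t \<in> L2.null"
      using X Y by (blast intro: L2.null_closed(2,5))
    moreover have "p \<in> L2.null" using p sub1 sub2 by blast
    \<comment> \<open>Modulo \<open>L2.null\<close>, \<open>p\<close> is the constant p(x, y). This
      constant is null, while L (a a c c) > 0, so it must be 0.\<close>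
    ultimately have "p - ((biX - biC x) * s + (biY - biC y) * t) \<in> L2.null" by (rule L2.null_closed(3)[rotated])
    moreover have "p - ((biX - biC x) * s + (biY - biC y) * t) = biC (bieval p x y) * 1"
      using st by (simp add: algebra_simps)
    ultimately have "biC (bieval p x y) * 1 \<in> L2.null" by simp
    then have "L (a * a * (c * c * (biC (bieval p x y) * 1 * 1))) = 0" unfolding L2.null_def by blast
    moreover have "a * a * (c * c * (biC (bieval p x y) * 1 * 1)) = biC (bieval p x y) * (a * a * (c * c))"
      by algebra
    ultimately have "bieval p x y * L (a * a * (c * c)) = 0" by (simp only: scale)
    then show ?thesis using c(1) by simp
  qed
  then show thesis by (rule that)
qed

end

section \<open>A functional killing two cubics\<close>

text \<open>Two affine cubics whose leading forms have no common zero: x^3 vanishes only for x = 0,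
  where the other form is y^3. The conditions on \<open>L\<close> beyond linearity concern products
  of degree at most 6 only, because they come from a functional on sextics.\<close>

locale complete_intersection = bivariate_functional +
  fixes \<alpha> \<beta> :: real and r1 r2 q1 q2 :: "real poly poly"
  defines "q1 \<equiv> biX ^ 3 + r1"
    and "q2 \<equiv> biY ^ 3 + biC \<alpha> * (biX ^ 1 * biY ^ 2) + biC \<beta> * (biX ^ 2 * biY ^ 1) + r2"
  assumes r1: "r1 \<in> bideg_le 2" and r2: "r2 \<in> bideg_le 2"
    and L_q1: "\<And>p. p \<in> bideg_le 3 \<Longrightarrow> L (p * q1) = 0"
    and L_q2: "\<And>p. p \<in> bideg_le 3 \<Longrightarrow> L (p * q2) = 0"
    and L_psd: "\<And>p. p \<in> bideg_le 3 \<Longrightarrow> 0 \<le> L (p * p)"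
begin

text \<open>In degree e + 3 only the leading form of \<open>q1\<close> meets the top part of
  \<open>a\<close>; the same holds for \<open>q2\<close> below.\<close>

lemma top_coeff_q1:
  assumes "a \<in> bideg_le e" "i + j = e + 3"
  shows "bicoeff (a * q1) i j = (if i < 3 then 0 else bicoeff a (i - 3) j)"
proof -
  have eq: "a * q1 = biX ^ 3 * a + a * r1" unfolding q1_def by algebra
  have "a * r1 \<in> bideg_le (e + 2)" using assms(1) r1 by (rule bideg_le_mult)
  then have "bicoeff (a * r1) i j = 0" using assms(2) by (simp add: bideg_le_def)
  then show ?thesis unfolding eq bicoeff_simps bicoeff_X_power by simp
qed

lemma top_coeff_q2:
  assumes "b \<in> bideg_le e" "i + j = e + 3"
  shows "bicoeff (b * q2) i j = (if j < 3 then 0 else bicoeff b i (j - 3))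
    + \<alpha> * (if i < 1 \<or> j < 2 then 0 else bicoeff b (i - 1) (j - 2))
    + \<beta> * (if i < 2 \<or> j < 1 then 0 else bicoeff b (i - 2) (j - 1))"
proof -
  have eq: "b * q2 = biY ^ 3 * b + biC \<alpha> * (biX ^ 1 * (biY ^ 2 * b)) + biC \<beta> * (biX ^ 2 * (biY ^ 1 * b)) + b * r2"
    unfolding q2_def by algebra
  have "b * r2 \<in> bideg_le (e + 2)" using assms(1) r2 by (rule bideg_le_mult)
  then have "bicoeff (b * r2) i j = 0" using assms(2) by (simp add: bideg_le_def)
  then show ?thesis unfolding eq bicoeff_simps bicoeff_X_power bicoeff_Y_power by auto
qed

lemma q_bideg: "q1 \<in> bideg_le 3" "q2 \<in> bideg_le 3"
proof -
  have "r1 \<in> bideg_le 3" "r2 \<in> bideg_le 3" using r1 r2 bideg_le_mono[of 2 3] by auto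
  moreover have "biX ^ 3 * biY ^ 0 \<in> bideg_le 3" "biX ^ 0 * biY ^ 3 \<in> bideg_le 3"
    "biX ^ 1 * biY ^ 2 \<in> bideg_le 3" "biX ^ 2 * biY ^ 1 \<in> bideg_le 3"
    by (intro bideg_le_monomial; simp)+
  then have "biX ^ 3 \<in> bideg_le 3" "biY ^ 3 \<in> bideg_le 3"
    "biX ^ 1 * biY ^ 2 \<in> bideg_le 3" "biX ^ 2 * biY ^ 1 \<in> bideg_le 3"
    by (simp_all only: power_0 mult_1_right mult_1_left)
  ultimately show "q1 \<in> bideg_le 3" "q2 \<in> bideg_le 3"
    unfolding q1_def q2_def by (blast intro: bideg_le_closed)+
qed

lemma bideg_le_lower:
  assumes "p \<in> bideg_le (Suc n)" "\<And>i j. i + j = Suc n \<Longrightarrow> bicoeff p i j = 0"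
  shows "p \<in> bideg_le n"
  unfolding bideg_le_def mem_Collect_eq
proof (intro allI impI)
  fix i j assume "n < i + j"
  then have "i + j = Suc n \<or> Suc n < i + j" by linarith
  then show "bicoeff p i j = 0" using assms by (auto simp: bideg_le_def)
qed

text \<open>Cofactors of degree e > 3 cancel in top degree: a_e x^3 + b_e h = 0, where h is the
  leading form of \<open>q2\<close>. As h is prime to x, b_e = x^3 t, and adding the syzygy (t
  \<open>q2\<close>, - t \<open>q1\<close>) removes both top parts.\<close>

lemma bounded_representation:
  assumes "a \<in> bideg_le n" "b \<in> bideg_le n" "a * q1 + b * q2 \<in> bideg_le 6"
  shows "\<exists>a'\<in>bideg_le 3. \<exists>b'\<in>bideg_le 3. a * q1 + b * q2 = a' * q1 + b' * q2"
  using assms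
proof (induction n arbitrary: a b)
  case 0
  then show ?case using bideg_le_mono[of 0 3] by blast
next
  case (Suc n)
  show ?case
  proof (cases "Suc n \<le> 3")
    case True
    then show ?thesis using Suc.prems bideg_le_mono[OF True] by blast
  next
    case False
    define e where "e = Suc n"
    have e: "e \<ge> 4" using False by (simp add: e_def)
    have a: "a \<in> bideg_le e" and b: "b \<in> bideg_le e" using Suc.prems by (simp_all add: e_def)
    have E: "(if i < 3 then 0 else bicoeff a (i - 3) j) + ((if j < 3 then 0 else bicoeff b i (j - 3))
      + \<alpha> * (if i < 1 \<or> j < 2 then 0 else bicoeff b (i - 1) (j - 2))
      + \<beta> * (if i < 2 \<or> j < 1 then 0 else bicoeff b (i - 2) (j - 1))) = 0" if "i + j = e + 3" for i j
    proof -
      have "bicoeff (a * q1 + b * q2) i j = 0" using Suc.prems(3) that e by (simp add: bideg_le_def)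
      then show ?thesis using top_coeff_q1[OF a that] top_coeff_q2[OF b that] by simp
    qed
    \<comment> \<open>At x-exponents below 3 the cofactor \<open>a\<close> does not contribute.
      Since h contains y^3, the coefficients of \<open>b\<close> at x-exponents 0, 1, 2 vanish one
      after the other.\<close>
    have b0: "bicoeff b 0 e = 0" using E[of 0 "e + 3"] by simp
    have b1: "bicoeff b 1 (e - 1) = 0"
      using E[of 1 "e + 2"] b0 e by (simp add: Suc_diff_le numeral_eq_Suc split: if_splits)
    have b2: "bicoeff b 2 (e - 2) = 0"
      using E[of 2 "e + 1"] b0 b1 e by (simp add: numeral_eq_Suc split: if_splits)
    define t where "t = bisum (e - 3) (\<lambda>i j. if i + j = e - 3 then bicoeff b (i + 3) j else 0)"
    have t: "bicoeff t i j = (if i + j = e - 3 then bicoeff b (i + 3) j else 0)" for i j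
      by (simp add: t_def bicoeff_bisum)
    have tdeg: "t \<in> bideg_le (e - 3)" by (simp add: t_def bisum_bideg_le)
    have "t * q1 \<in> bideg_le e" "t * q2 \<in> bideg_le e"
      using bideg_le_mult[OF tdeg q_bideg(1)] bideg_le_mult[OF tdeg q_bideg(2)] e by simp_all
    then have deg: "a + t * q2 \<in> bideg_le (Suc n)" "b - t * q1 \<in> bideg_le (Suc n)"
      using a b unfolding e_def by (blast intro: bideg_le_closed)+
    have "bicoeff (b - t * q1) i j = 0" if ij: "i + j = Suc n" for i j
    proof -
      have "bicoeff (t * q1) i j = (if i < 3 then 0 else bicoeff t (i - 3) j)"
        using ij e by (intro top_coeff_q1[OF tdeg]) (simp add: e_def)
      moreover have "bicoeff b i j = 0" if "i < 3"
      proof -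
        have "i = 0 \<or> i = 1 \<or> i = 2" "j = e - i" using that ij by (auto simp: e_def)
        then show ?thesis using b0 b1 b2 by auto
      qed
      ultimately show ?thesis using ij e by (auto simp: t e_def)
    qed
    with deg(2) have bdeg: "b - t * q1 \<in> bideg_le n" by (rule bideg_le_lower)
    have "bicoeff (a + t * q2) i j = 0" if ij: "i + j = Suc n" for i j
    proof -
      have 1: "bicoeff (t * q2) i j = (if j < 3 then 0 else bicoeff t i (j - 3))
        + \<alpha> * (if i < 1 \<or> j < 2 then 0 else bicoeff t (i - 1) (j - 2))
        + \<beta> * (if i < 2 \<or> j < 1 then 0 else bicoeff t (i - 2) (j - 1))"
        using ij e by (intro top_coeff_q2[OF tdeg]) (simp add: e_def)
      \<comment> \<open>For i = 0 the guard makes the left side 0, and the right side is a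
        coefficient of \<open>b\<close> at x-exponent 2, which is 0 by \<open>b2\<close>. The next
        fact treats i < 2 in the same way.\<close>
      have 2: "(if i < 1 \<or> j < 2 then 0 else bicoeff t (i - 1) (j - 2)) = (if j < 2 then 0 else bicoeff b (i + 2) (j - 2))"
      proof (cases "i < 1")
        case True
        then show ?thesis using b2 ij by (auto simp: e_def numeral_2_eq_2)
      next
        case False
        then have "i - 1 + 3 = i + 2" by simp
        then show ?thesis using False ij by (auto simp: t e_def)
      qed
      have 3: "(if i < 2 \<or> j < 1 then 0 else bicoeff t (i - 2) (j - 1)) = (if j < 1 then 0 else bicoeff b (i + 1) (j - 1))"
      proof (cases "i < 2")
        case True
        then have "i = 0 \<or> i = 1" by auto
        then show ?thesis using b1 b2 ij by (auto simp: e_def numeral_2_eq_2)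
      next
        case False
        then have "i - 2 + 3 = i + 1" by simp
        then show ?thesis using False ij by (auto simp: t e_def)
      qed
      have 4: "(if j < 3 then 0 else bicoeff t i (j - 3)) = (if j < 3 then 0 else bicoeff b (i + 3) (j - 3))"
        using ij by (auto simp: t e_def)
      have "bicoeff a i j + ((if j < 3 then 0 else bicoeff b (i + 3) (j - 3))
        + \<alpha> * (if j < 2 then 0 else bicoeff b (i + 2) (j - 2))
        + \<beta> * (if j < 1 then 0 else bicoeff b (i + 1) (j - 1))) = 0"
      proof -
        have idx: "i + 3 - 3 = i" "i + 3 - 1 = i + 2" "i + 3 - 2 = i + 1"
          "(i + 3 < 3) = False" "(i + 3 < 1) = False" "(i + 3 < 2) = False" by auto
        \<comment> \<open>Read at x-exponent i + 3, the cancellation relation expresses the top part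
          of \<open>a\<close> as minus that of \<open>t * q2\<close>.\<close>
        have "i + 3 + j = e + 3" using ij by (simp add: e_def)
        from E[OF this] show ?thesis by (simp only: idx if_False simp_thms)
      qed
      then show ?thesis unfolding bicoeff_simps 1 2 3 4 .
    qed
    with deg(1) have adeg: "a + t * q2 \<in> bideg_le n" by (rule bideg_le_lower)
    have same: "a * q1 + b * q2 = (a + t * q2) * q1 + (b - t * q1) * q2" by algebra
    show ?thesis using Suc.IH[OF adeg bdeg] Suc.prems(3) unfolding same by blast
  qed
qed

definition gen_ideal :: "real poly poly set" where
  "gen_ideal = {p. \<exists>a b. p = a * q1 + b * q2}"

lemma gen_ideal_closed:
  "0 \<in> gen_ideal" "q1 \<in> gen_ideal" "q2 \<in> gen_ideal"
  "p \<in> gen_ideal \<Longrightarrow> p' \<in> gen_ideal \<Longrightarrow> p + p' \<in> gen_ideal"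
  "p \<in> gen_ideal \<Longrightarrow> p' \<in> gen_ideal \<Longrightarrow> p - p' \<in> gen_ideal"
  "p \<in> gen_ideal \<Longrightarrow> c * p \<in> gen_ideal"
proof -
  have "0 = 0 * q1 + 0 * q2" "q1 = 1 * q1 + 0 * q2" "q2 = 0 * q1 + 1 * q2" by simp_all
  then show "0 \<in> gen_ideal" "q1 \<in> gen_ideal" "q2 \<in> gen_ideal"
    unfolding gen_ideal_def by blast+
  have "(a * q1 + b * q2) + (a' * q1 + b' * q2) = (a + a') * q1 + (b + b') * q2"
    "(a * q1 + b * q2) - (a' * q1 + b' * q2) = (a - a') * q1 + (b - b') * q2"
    "c * (a * q1 + b * q2) = (c * a) * q1 + (c * b) * q2" for a b a' b'
    by algebra+
  then show "p \<in> gen_ideal \<Longrightarrow> p' \<in> gen_ideal \<Longrightarrow> p + p' \<in> gen_ideal"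
    "p \<in> gen_ideal \<Longrightarrow> p' \<in> gen_ideal \<Longrightarrow> p - p' \<in> gen_ideal"
    "p \<in> gen_ideal \<Longrightarrow> c * p \<in> gen_ideal"
    unfolding gen_ideal_def by blast+
qed

text \<open>Cofactors of degree at most 3 are exactly what the hypotheses on \<open>L\<close> cover.
  This makes the extension of \<open>L\<close> below independent of choices.\<close>

lemma L_gen_ideal:
  assumes "p \<in> gen_ideal" "p \<in> bideg_le 6"
  shows "L p = 0"
proof -
  obtain a b where p: "p = a * q1 + b * q2" using assms(1) by (auto simp: gen_ideal_def)
  obtain m n where "a \<in> bideg_le m" "b \<in> bideg_le n" using ex_bideg_le by metis
  then have "a \<in> bideg_le (m + n)" "b \<in> bideg_le (m + n)"
    using bideg_le_mono[of m "m + n"] bideg_le_mono[of n "m + n"] by auto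
  then obtain a' b' where "a' \<in> bideg_le 3" "b' \<in> bideg_le 3" "p = a' * q1 + b' * q2"
    using bounded_representation[of a "m + n" b] assms(2) p by blast
  then show ?thesis using L_q1 L_q2 by (simp add: add)
qed

text \<open>
  The leading forms \<open>x\<^sup>3\<close> and \<open>y\<^sup>3 + \<alpha> x y\<^sup>2 + \<beta> x\<^sup>2 y\<close> have no common zero, so the quotient by them has
  Hilbert function \<open>1, 2, 3, 2, 1\<close> with top degree spanned by \<open>x\<^sup>2 y\<^sup>2\<close>; \<open>s\<close> is the top coordinate.
\<close>

definition socle_class :: "real \<Rightarrow> real poly poly set" where
  "socle_class s = {p. \<exists>r\<in>bideg_le 3. p - (r + biC s * (biX ^ 2 * biY ^ 2)) \<in> gen_ideal}"

lemma socle_class_add: "p \<in> socle_class s \<Longrightarrow> p' \<in> socle_class s' \<Longrightarrow> p + p' \<in> socle_class (s + s')"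
proof -
  assume "p \<in> socle_class s" "p' \<in> socle_class s'"
  then obtain r r' where r: "r \<in> bideg_le 3" "r' \<in> bideg_le 3"
    and g: "p - (r + biC s * (biX ^ 2 * biY ^ 2)) \<in> gen_ideal" "p' - (r' + biC s' * (biX ^ 2 * biY ^ 2)) \<in> gen_ideal"
    by (auto simp: socle_class_def)
  have "p + p' - ((r + r') + biC (s + s') * (biX ^ 2 * biY ^ 2)) =
      (p - (r + biC s * (biX ^ 2 * biY ^ 2))) + (p' - (r' + biC s' * (biX ^ 2 * biY ^ 2)))"
    by (simp add: biC_arith algebra_simps)
  then show ?thesis
    unfolding socle_class_def mem_Collect_eq using gen_ideal_closed(4)[OF g] bideg_le_closed(2)[OF r] by metis
qed

lemma socle_class_scale: "p \<in> socle_class s \<Longrightarrow> biC c * p \<in> socle_class (c * s)"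
proof -
  assume "p \<in> socle_class s"
  then obtain r where r: "r \<in> bideg_le 3" and g: "p - (r + biC s * (biX ^ 2 * biY ^ 2)) \<in> gen_ideal"
    by (auto simp: socle_class_def)
  have "biC c * p - (biC c * r + biC (c * s) * (biX ^ 2 * biY ^ 2)) =
      biC c * (p - (r + biC s * (biX ^ 2 * biY ^ 2)))"
    by (simp add: biC_arith algebra_simps)
  then show ?thesis
    unfolding socle_class_def mem_Collect_eq using r g gen_ideal_closed(6)[OF g, of "biC c"] bideg_le_closed(4)[OF r]
    by metis
qed

lemma socle_class_low: "p \<in> bideg_le 3 \<Longrightarrow> p \<in> socle_class 0"
  unfolding socle_class_def using gen_ideal_closed(1) by force

lemma socle_class_ideal: "p \<in> gen_ideal \<Longrightarrow> p \<in> socle_class 0"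
  unfolding socle_class_def using bideg_le_closed(1)[of 3] by force

lemma socle_class_diff: "p \<in> socle_class s \<Longrightarrow> p' \<in> socle_class s' \<Longrightarrow> p - p' \<in> socle_class (s - s')"
  using socle_class_add[of p s "biC (- 1) * p'" "- 1 * s'"] socle_class_scale[of p' s' "- 1"] by (simp add: biC_arith)

text \<open>Up to degree at most 3, the ideal gives x^3 y = x^4 = 0, then x y^3 = -\<alpha> x^2 y^2
  - \<beta> x^3 y from x \<open>q2\<close>, and y^4 = -\<alpha> x y^3 - \<beta> x^2 y^2 from y
  \<open>q2\<close>. The last two values follow by substitution.\<close>

lemma socle_class_monomials:
  "biX ^ 4 * biY ^ 0 \<in> socle_class 0" "biX ^ 3 * biY ^ 1 \<in> socle_class 0" "biX ^ 2 * biY ^ 2 \<in> socle_class 1"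
  "biX ^ 1 * biY ^ 3 \<in> socle_class (- \<alpha>)" "biX ^ 0 * biY ^ 4 \<in> socle_class (\<alpha> * \<alpha> - \<beta>)"
proof -
  have low: "biX * r1 \<in> socle_class 0" "biY * r1 \<in> socle_class 0" "biX * r2 \<in> socle_class 0" "biY * r2 \<in> socle_class 0"
    by (intro socle_class_low bideg_le_mult'[OF bideg_le_gens(1) r1] bideg_le_mult'[OF bideg_le_gens(2) r1]
        bideg_le_mult'[OF bideg_le_gens(1) r2] bideg_le_mult'[OF bideg_le_gens(2) r2]; simp)+
  have gen: "c * q1 \<in> socle_class 0" "c * q2 \<in> socle_class 0" for c
    using gen_ideal_closed(2,3,6) by (auto intro: socle_class_ideal)
  have "biX * q1 - biX * r1 \<in> socle_class (0 - 0)" by (intro socle_class_diff gen low)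
  then show 1: "biX ^ 4 * biY ^ 0 \<in> socle_class 0" unfolding q1_def by (simp add: algebra_simps power_numeral_reduce)
  have "biY * q1 - biY * r1 \<in> socle_class (0 - 0)" by (intro socle_class_diff gen low)
  moreover have "biY * q1 - biY * r1 = biX ^ 3 * biY ^ 1" unfolding q1_def by algebra
  ultimately show 2: "biX ^ 3 * biY ^ 1 \<in> socle_class 0" by simp
  have "(biX ^ 2 * biY ^ 2) - (0 + biC 1 * (biX ^ 2 * biY ^ 2)) \<in> gen_ideal"
    using gen_ideal_closed(1) by simp
  then show 3: "biX ^ 2 * biY ^ 2 \<in> socle_class 1"
    unfolding socle_class_def using bideg_le_closed(1)[of 3] by blast
  have "biX * q2 - biX * r2 - biC \<alpha> * (biX ^ 2 * biY ^ 2) - biC \<beta> * (biX ^ 3 * biY ^ 1) \<in> socle_class (0 - 0 - \<alpha> * 1 - \<beta> * 0)"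
    by (intro socle_class_diff socle_class_scale gen low 2 3)
  moreover have "biX * q2 - biX * r2 - biC \<alpha> * (biX ^ 2 * biY ^ 2) - biC \<beta> * (biX ^ 3 * biY ^ 1) = biX ^ 1 * biY ^ 3"
    unfolding q2_def by algebra
  ultimately show 4: "biX ^ 1 * biY ^ 3 \<in> socle_class (- \<alpha>)" by simp
  have "biY * q2 - biY * r2 - biC \<alpha> * (biX ^ 1 * biY ^ 3) - biC \<beta> * (biX ^ 2 * biY ^ 2) \<in> socle_class (0 - 0 - \<alpha> * (- \<alpha>) - \<beta> * 1)"
    by (intro socle_class_diff socle_class_scale gen low 4 3)
  moreover have "biY * q2 - biY * r2 - biC \<alpha> * (biX ^ 1 * biY ^ 3) - biC \<beta> * (biX ^ 2 * biY ^ 2) = biX ^ 0 * biY ^ 4"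
    unfolding q2_def by algebra
  ultimately show "biX ^ 0 * biY ^ 4 \<in> socle_class (\<alpha> * \<alpha> - \<beta>)" by simp
qed

lemma Ex_socle_class_sum:
  assumes "\<And>i. i \<in> A \<Longrightarrow> \<exists>s. g i \<in> socle_class s"
  shows "\<exists>s. sum g A \<in> socle_class s"
  using assms
proof (induction A rule: infinite_finite_induct)
  case (insert x F)
  then show ?case using socle_class_add by (metis insertCI sum.insert)
qed (use socle_class_low[OF bideg_le_closed(1)] in auto)

lemma Ex_socle_class_bisum:
  assumes "\<And>i j. i + j \<le> d \<Longrightarrow> \<exists>s. biX ^ i * biY ^ j \<in> socle_class s"
  shows "\<exists>s. bisum d h \<in> socle_class s"
  unfolding bisum_def
proof (intro Ex_socle_class_sum)
  fix i j assume "i \<in> {..d}" "j \<in> {..d - i}"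
  then have "i + j \<le> d" by auto
  then obtain s where "biX ^ i * biY ^ j \<in> socle_class s" using assms by blast
  then show "\<exists>s. biC (h i j) * (biX ^ i * biY ^ j) \<in> socle_class s" using socle_class_scale by blast
qed

lemma Ex_socle_class_bideg4:
  assumes "p \<in> bideg_le 4"
  shows "\<exists>s. p \<in> socle_class s"
proof -
  have "\<exists>s. biX ^ i * biY ^ j \<in> socle_class s" if "i + j \<le> 4" for i j
  proof (cases "i + j \<le> 3")
    case True
    then show ?thesis using socle_class_low bideg_le_monomial by blast
  next
    case False
    then have "i = 4 \<and> j = 0 \<or> i = 3 \<and> j = 1 \<or> i = 2 \<and> j = 2 \<or> i = 1 \<and> j = 3 \<or> i = 0 \<and> j = 4"
      using that by linarith
    then show ?thesis using socle_class_monomials by blast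
  qed
  then show ?thesis using Ex_socle_class_bisum bideg_le_eq_bisum[OF assms] by metis
qed

text \<open>A linear factor raises degree 3 to at most 4, where classes already exist; only the
  shifted socle monomial has to be supplied separately.\<close>

lemma Ex_socle_class_shift:
  assumes c: "c \<in> bideg_le 1" and m: "\<exists>s. c * (biX ^ 2 * biY ^ 2) \<in> socle_class s" and p: "p \<in> socle_class t"
  shows "\<exists>s. c * p \<in> socle_class s"
proof -
  obtain r where r: "r \<in> bideg_le 3" and g: "p - (r + biC t * (biX ^ 2 * biY ^ 2)) \<in> gen_ideal"
    using p by (auto simp: socle_class_def)
  have "c * r \<in> bideg_le 4" using bideg_le_mult[OF c r] by simp
  then obtain s1 where s1: "c * r \<in> socle_class s1" using Ex_socle_class_bideg4 by blast
  obtain s2 where "c * (biX ^ 2 * biY ^ 2) \<in> socle_class s2" using m by blast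
  then have s2: "biC t * (c * (biX ^ 2 * biY ^ 2)) \<in> socle_class (t * s2)" by (rule socle_class_scale)
  have "c * (p - (r + biC t * (biX ^ 2 * biY ^ 2))) \<in> socle_class 0"
    using g gen_ideal_closed(6) socle_class_ideal by blast
  then have "c * r + biC t * (c * (biX ^ 2 * biY ^ 2)) + c * (p - (r + biC t * (biX ^ 2 * biY ^ 2))) \<in> socle_class (s1 + t * s2 + 0)"
    by (intro socle_class_add s1 s2)
  moreover have "c * r + biC t * (c * (biX ^ 2 * biY ^ 2)) + c * (p - (r + biC t * (biX ^ 2 * biY ^ 2))) = c * p"
    by algebra
  ultimately show ?thesis by metis
qed

text \<open>Both x^3 y^2 and x^2 y^3 reduce to degree at most 4, the first by y^2 \<open>q1\<close>,
  the second by x^2 \<open>q2\<close> together with x y \<open>q1\<close> and the first. Hence the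
  set of polynomials that have a class is stable under multiplication by x and y.\<close>

lemma Ex_socle_class: "\<exists>s. p \<in> socle_class s"
proof -
  have gen: "c * q1 \<in> socle_class 0" "c * q2 \<in> socle_class 0" for c
    using gen_ideal_closed(2,3,6) by (auto intro: socle_class_ideal)
  have low: "\<exists>s. biX ^ i * biY ^ j * r \<in> socle_class s" if "i + j \<le> 2" "r \<in> bideg_le 2" for i j r
    using bideg_le_mult[OF bideg_le_monomial[of i j 2] that(2)] that(1) Ex_socle_class_bideg4 by simp
  have X: "\<exists>s. biX * (biX ^ 2 * biY ^ 2) \<in> socle_class s"
  proof -
    obtain s where "biX ^ 0 * biY ^ 2 * r1 \<in> socle_class s" using low[of 0 2 r1] r1 by auto
    then have "biY ^ 2 * q1 - biX ^ 0 * biY ^ 2 * r1 \<in> socle_class (0 - s)" by (intro socle_class_diff gen)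
    moreover have "biY ^ 2 * q1 - biX ^ 0 * biY ^ 2 * r1 = biX * (biX ^ 2 * biY ^ 2)" unfolding q1_def by algebra
    ultimately show ?thesis by metis
  qed
  have Y: "\<exists>s. biY * (biX ^ 2 * biY ^ 2) \<in> socle_class s"
  proof -
    obtain s where s: "biX * (biX ^ 2 * biY ^ 2) \<in> socle_class s" using X by blast
    obtain t where "biX ^ 1 * biY ^ 1 * r1 \<in> socle_class t" using low[of 1 1 r1] r1 by auto
    then have t: "biX * biY * q1 - biX ^ 1 * biY ^ 1 * r1 \<in> socle_class (0 - t)" by (intro socle_class_diff gen)
    obtain u where u: "biX ^ 2 * biY ^ 0 * r2 \<in> socle_class u" using low[of 2 0 r2] r2 by auto
    have "biX ^ 2 * q2 - biX ^ 2 * biY ^ 0 * r2 - biC \<alpha> * (biX * (biX ^ 2 * biY ^ 2))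
      - biC \<beta> * (biX * biY * q1 - biX ^ 1 * biY ^ 1 * r1) \<in> socle_class (0 - u - \<alpha> * s - \<beta> * (0 - t))"
      by (intro socle_class_diff socle_class_scale gen s t u)
    moreover have "biX ^ 2 * q2 - biX ^ 2 * biY ^ 0 * r2 - biC \<alpha> * (biX * (biX ^ 2 * biY ^ 2))
      - biC \<beta> * (biX * biY * q1 - biX ^ 1 * biY ^ 1 * r1) = biY * (biX ^ 2 * biY ^ 2)"
      unfolding q1_def q2_def by algebra
    ultimately show ?thesis by metis
  qed
  have mon: "\<exists>s. biX ^ i * biY ^ j \<in> socle_class s" for i j
  proof (induction i)
    case 0
    show ?case
    proof (induction j)
      case 0
      then show ?case using socle_class_low[OF bideg_le_gens(3)] by auto
    next
      case (Suc j)
      then obtain s where "biX ^ 0 * biY ^ j \<in> socle_class s" by blast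
      from Ex_socle_class_shift[OF bideg_le_gens(2) Y this]
      show ?case by (simp only: power_Suc power_0 mult_1_left)
    qed
  next
    case (Suc i)
    then obtain s where "biX ^ i * biY ^ j \<in> socle_class s" by blast
    from Ex_socle_class_shift[OF bideg_le_gens(1) X this]
    show ?case by (simp only: power_Suc mult.assoc)
  qed
  obtain d where "p \<in> bideg_le d" using ex_bideg_le by blast
  then have "p = bisum d (bicoeff p)" by (rule bideg_le_eq_bisum)
  then show ?thesis using Ex_socle_class_bisum mon by metis
qed

section \<open>Extension of the functional to all degrees\<close>

definition ext :: "real poly poly \<Rightarrow> real" where
  "ext p = L (SOME r. r \<in> bideg_le 6 \<and> p - r \<in> gen_ideal)"

text \<open>Two remainders of degree at most 6 differ by an element of the ideal of degree at most
  6, on which \<open>L\<close> vanishes.\<close>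

lemma ext_eq:
  assumes "r \<in> bideg_le 6" "p - r \<in> gen_ideal"
  shows "ext p = L r"
proof -
  define r' where "r' = (SOME r. r \<in> bideg_le 6 \<and> p - r \<in> gen_ideal)"
  have r': "r' \<in> bideg_le 6 \<and> p - r' \<in> gen_ideal"
    unfolding r'_def by (rule someI) (use assms in blast)
  have "(p - r) - (p - r') \<in> gen_ideal" "r' - r \<in> bideg_le 6"
    using assms r' by (blast intro: gen_ideal_closed bideg_le_closed)+
  then have "L (r' - r) = 0" by (intro L_gen_ideal) simp_all
  then show ?thesis by (simp add: ext_def r'_def diff)
qed

lemma Ex_bounded_remainder: "\<exists>r\<in>bideg_le 6. p - r \<in> gen_ideal"
proof -
  obtain s r where r: "r \<in> bideg_le 3" "p - (r + biC s * (biX ^ 2 * biY ^ 2)) \<in> gen_ideal"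
    using Ex_socle_class[of p] by (auto simp: socle_class_def)
  have "r \<in> bideg_le 6" "biC s * (biX ^ 2 * biY ^ 2) \<in> bideg_le 6"
    using r bideg_le_mono[of 3 6] bideg_le_monomial[of 2 2 6] by (auto intro!: bideg_le_closed(4))
  then have "r + biC s * (biX ^ 2 * biY ^ 2) \<in> bideg_le 6" by (rule bideg_le_closed)
  with r(2) show ?thesis by blast
qed

lemma ext_bideg: "p \<in> bideg_le 6 \<Longrightarrow> ext p = L p"
  using gen_ideal_closed(1) by (intro ext_eq) simp_all

lemma ext_ideal: "p \<in> gen_ideal \<Longrightarrow> ext p = 0"
  using ext_eq[of 0 p] bideg_le_closed(1) by simp

sublocale ext: bivariate_functional ext
proof
  fix p q r
  obtain p' q' where p': "p' \<in> bideg_le 6" "p - p' \<in> gen_ideal" and q': "q' \<in> bideg_le 6" "q - q' \<in> gen_ideal"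
    using Ex_bounded_remainder by meson
  have "(p + q) - (p' + q') \<in> gen_ideal" using gen_ideal_closed(4)[OF p'(2) q'(2)] by (simp add: algebra_simps)
  then show "ext (p + q) = ext p + ext q"
    using ext_eq[of "p' + q'" "p + q"] ext_eq[OF p'] ext_eq[OF q'] bideg_le_closed(2) p' q' by (simp add: add)
  have "biC r * p - biC r * p' \<in> gen_ideal"
    using gen_ideal_closed(6)[OF p'(2), of "biC r"] by (simp only: right_diff_distrib)
  then show "ext (biC r * p) = r * ext p"
    using ext_eq[of "biC r * p'" "biC r * p"] ext_eq[OF p'] bideg_le_closed(4) p' by (simp only: scale)
qed

text \<open>The quotient by the leading forms is Gorenstein, so multiplication into the socle is a
  perfect pairing. Vanishing x^3 and y^3 coefficients exclude combinations of \<open>q1\<close> and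
  \<open>q2\<close>. From degree 3 downwards, each homogeneous part of \<open>w\<close> is tested
  against monomials of complementary degree and forced to vanish.\<close>

lemma socle_pairing:
  assumes w: "w \<in> bideg_le 3" "w \<noteq> 0" "bicoeff w 3 0 = 0" "bicoeff w 0 3 = 0"
  shows "\<exists>m s. s \<noteq> 0 \<and> m * w \<in> socle_class s"
proof -
  have low: "biX ^ i * biY ^ j * r \<in> socle_class 0" if "r \<in> bideg_le n" "i + j + n \<le> 3" for i j r n
    using bideg_le_mult[OF bideg_le_monomial[of i j "i + j"] that(1)] bideg_le_mono[OF that(2)]
    by (auto intro!: socle_class_low)
  show ?thesis
  proof (rule ccontr)
    assume "\<not> ?thesis"
    \<comment> \<open>No uniqueness of the socle value enters: under the contradiction hypothesis
      every value attained by any multiple of \<open>w\<close> is 0.\<close>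
    then have neg: "s = 0" if "m * w \<in> socle_class s" for m s using that by blast
    have pair: "a = 0 \<and> b = 0" if "m * w \<in> socle_class b" "m' * w \<in> socle_class (a - \<alpha> * b)" for m m' a b
      using neg[OF that(1)] neg[OF that(2)] by simp
    define a b where "a = bicoeff w 2 1" and "b = bicoeff w 1 2"
    define r where "r = w - biC a * (biX ^ 2 * biY ^ 1) - biC b * (biX ^ 1 * biY ^ 2)"
    have "r \<in> bideg_le (Suc 2)"
    proof -
      have "w \<in> bideg_le (Suc 2)" using w(1) by simp
      moreover have "biX ^ 2 * biY ^ 1 \<in> bideg_le (Suc 2)" "biX ^ 1 * biY ^ 2 \<in> bideg_le (Suc 2)"
        by (intro bideg_le_monomial; simp)+
      ultimately show ?thesis unfolding r_def by (intro bideg_le_closed)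
    qed
    then have r: "r \<in> bideg_le 2"
    proof (rule bideg_le_lower)
      fix i j :: nat assume "i + j = Suc 2"
      then have "i = 3 \<and> j = 0 \<or> i = 2 \<and> j = 1 \<or> i = 1 \<and> j = 2 \<or> i = 0 \<and> j = 3" by linarith
      then show "bicoeff r i j = 0" using w unfolding r_def bicoeff_simps bicoeff_monomial a_def b_def by auto
    qed
    have "biX * w = biC a * (biX ^ 3 * biY ^ 1) + biC b * (biX ^ 2 * biY ^ 2) + biX ^ 1 * biY ^ 0 * r"
      "biY * w = biC a * (biX ^ 2 * biY ^ 2) + biC b * (biX ^ 1 * biY ^ 3) + biX ^ 0 * biY ^ 1 * r"
      unfolding r_def by algebra+
    moreover have "biC a * (biX ^ 3 * biY ^ 1) + biC b * (biX ^ 2 * biY ^ 2) + biX ^ 1 * biY ^ 0 * r \<in> socle_class (a * 0 + b * 1 + 0)"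
      "biC a * (biX ^ 2 * biY ^ 2) + biC b * (biX ^ 1 * biY ^ 3) + biX ^ 0 * biY ^ 1 * r \<in> socle_class (a * 1 + b * (- \<alpha>) + 0)"
      by (intro socle_class_add socle_class_scale socle_class_monomials low[OF r]; simp)+
    ultimately have "a = 0 \<and> b = 0" by (intro pair[of biX b biY a]) (simp_all add: mult.commute)
    then have w2: "w \<in> bideg_le 2" using r by (simp add: r_def)
    define a b c where "a = bicoeff w 2 0" and "b = bicoeff w 1 1" and "c = bicoeff w 0 2"
    define r where "r = w - biC a * (biX ^ 2 * biY ^ 0) - biC b * (biX ^ 1 * biY ^ 1) - biC c * (biX ^ 0 * biY ^ 2)"
    have "r \<in> bideg_le (Suc 1)"
    proof -
      have "w \<in> bideg_le (Suc 1)" using w2 by (simp add: numeral_2_eq_2)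
      moreover have "biX ^ 2 * biY ^ 0 \<in> bideg_le (Suc 1)" "biX ^ 1 * biY ^ 1 \<in> bideg_le (Suc 1)"
        "biX ^ 0 * biY ^ 2 \<in> bideg_le (Suc 1)"
        by (intro bideg_le_monomial; simp)+
      ultimately show ?thesis unfolding r_def by (intro bideg_le_closed)
    qed
    then have r: "r \<in> bideg_le 1"
    proof (rule bideg_le_lower)
      fix i j :: nat assume "i + j = Suc 1"
      then have "i = 2 \<and> j = 0 \<or> i = 1 \<and> j = 1 \<or> i = 0 \<and> j = 2" by linarith
      then show "bicoeff r i j = 0" unfolding r_def bicoeff_simps bicoeff_monomial a_def b_def c_def by auto
    qed
    \<comment> \<open>For the quadratic part a x^2 + b x y + c y^2, the multipliers x^2, x y, y^2
      give the triangular system c, b - \<alpha> c, a - \<alpha> b + (\<alpha>^2 - \<beta>)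
      c.\<close>
    have "biX ^ 2 * w = biC a * (biX ^ 4 * biY ^ 0) + biC b * (biX ^ 3 * biY ^ 1) + biC c * (biX ^ 2 * biY ^ 2) + biX ^ 2 * biY ^ 0 * r"
      "biX * biY * w = biC a * (biX ^ 3 * biY ^ 1) + biC b * (biX ^ 2 * biY ^ 2) + biC c * (biX ^ 1 * biY ^ 3) + biX ^ 1 * biY ^ 1 * r"
      "biY ^ 2 * w = biC a * (biX ^ 2 * biY ^ 2) + biC b * (biX ^ 1 * biY ^ 3) + biC c * (biX ^ 0 * biY ^ 4) + biX ^ 0 * biY ^ 2 * r"
      unfolding r_def by algebra+
    moreover have "biC a * (biX ^ 4 * biY ^ 0) + biC b * (biX ^ 3 * biY ^ 1) + biC c * (biX ^ 2 * biY ^ 2) + biX ^ 2 * biY ^ 0 * r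
        \<in> socle_class (a * 0 + b * 0 + c * 1 + 0)"
      "biC a * (biX ^ 3 * biY ^ 1) + biC b * (biX ^ 2 * biY ^ 2) + biC c * (biX ^ 1 * biY ^ 3) + biX ^ 1 * biY ^ 1 * r
        \<in> socle_class (a * 0 + b * 1 + c * (- \<alpha>) + 0)"
      "biC a * (biX ^ 2 * biY ^ 2) + biC b * (biX ^ 1 * biY ^ 3) + biC c * (biX ^ 0 * biY ^ 4) + biX ^ 0 * biY ^ 2 * r
        \<in> socle_class (a * 1 + b * (- \<alpha>) + c * (\<alpha> * \<alpha> - \<beta>) + 0)"
      by (intro socle_class_add socle_class_scale socle_class_monomials low[OF r]; simp)+
    ultimately have "b = 0 \<and> c = 0" "a = 0 \<or> b \<noteq> 0 \<or> c \<noteq> 0"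
    proof -
      assume A: "biX ^ 2 * w = biC a * (biX ^ 4 * biY ^ 0) + biC b * (biX ^ 3 * biY ^ 1) + biC c * (biX ^ 2 * biY ^ 2) + biX ^ 2 * biY ^ 0 * r"
      "biX * biY * w = biC a * (biX ^ 3 * biY ^ 1) + biC b * (biX ^ 2 * biY ^ 2) + biC c * (biX ^ 1 * biY ^ 3) + biX ^ 1 * biY ^ 1 * r"
      "biY ^ 2 * w = biC a * (biX ^ 2 * biY ^ 2) + biC b * (biX ^ 1 * biY ^ 3) + biC c * (biX ^ 0 * biY ^ 4) + biX ^ 0 * biY ^ 2 * r"
      and B: "biC a * (biX ^ 4 * biY ^ 0) + biC b * (biX ^ 3 * biY ^ 1) + biC c * (biX ^ 2 * biY ^ 2) + biX ^ 2 * biY ^ 0 * r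
        \<in> socle_class (a * 0 + b * 0 + c * 1 + 0)"
      "biC a * (biX ^ 3 * biY ^ 1) + biC b * (biX ^ 2 * biY ^ 2) + biC c * (biX ^ 1 * biY ^ 3) + biX ^ 1 * biY ^ 1 * r
        \<in> socle_class (a * 0 + b * 1 + c * (- \<alpha>) + 0)"
      "biC a * (biX ^ 2 * biY ^ 2) + biC b * (biX ^ 1 * biY ^ 3) + biC c * (biX ^ 0 * biY ^ 4) + biX ^ 0 * biY ^ 2 * r
        \<in> socle_class (a * 1 + b * (- \<alpha>) + c * (\<alpha> * \<alpha> - \<beta>) + 0)"
      have C: "biX ^ 2 * w \<in> socle_class c" "biX * biY * w \<in> socle_class (b - \<alpha> * c)"
        "biY ^ 2 * w \<in> socle_class (a - \<alpha> * b + c * (\<alpha> * \<alpha> - \<beta>))"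
        using B unfolding A[symmetric] by (simp_all add: mult.commute)
      show 1: "b = 0 \<and> c = 0" using pair[OF C(1,2)] .
      show "a = 0 \<or> b \<noteq> 0 \<or> c \<noteq> 0" using neg[OF C(3)] 1 by simp
    qed
    then have "a = 0" "b = 0" "c = 0" by auto
    then have w1: "w \<in> bideg_le 1" using r by (simp add: r_def)
    define a b where "a = bicoeff w 1 0" and "b = bicoeff w 0 1"
    define r where "r = w - biC a * (biX ^ 1 * biY ^ 0) - biC b * (biX ^ 0 * biY ^ 1)"
    have "r \<in> bideg_le (Suc 0)"
    proof -
      have "w \<in> bideg_le (Suc 0)" using w1 by simp
      moreover have "biX ^ 1 * biY ^ 0 \<in> bideg_le (Suc 0)" "biX ^ 0 * biY ^ 1 \<in> bideg_le (Suc 0)"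
        by (intro bideg_le_monomial; simp)+
      ultimately show ?thesis unfolding r_def by (intro bideg_le_closed)
    qed
    then have r: "r \<in> bideg_le 0"
    proof (rule bideg_le_lower)
      fix i j :: nat assume "i + j = Suc 0"
      then have "i = 1 \<and> j = 0 \<or> i = 0 \<and> j = 1" by linarith
      then show "bicoeff r i j = 0" unfolding r_def bicoeff_simps bicoeff_monomial a_def b_def by auto
    qed
    have "biX ^ 2 * biY * w = biC a * (biX ^ 3 * biY ^ 1) + biC b * (biX ^ 2 * biY ^ 2) + biX ^ 2 * biY ^ 1 * r"
      "biX * biY ^ 2 * w = biC a * (biX ^ 2 * biY ^ 2) + biC b * (biX ^ 1 * biY ^ 3) + biX ^ 1 * biY ^ 2 * r"
      unfolding r_def by algebra+
    moreover have "biC a * (biX ^ 3 * biY ^ 1) + biC b * (biX ^ 2 * biY ^ 2) + biX ^ 2 * biY ^ 1 * r \<in> socle_class (a * 0 + b * 1 + 0)"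
      "biC a * (biX ^ 2 * biY ^ 2) + biC b * (biX ^ 1 * biY ^ 3) + biX ^ 1 * biY ^ 2 * r \<in> socle_class (a * 1 + b * (- \<alpha>) + 0)"
      by (intro socle_class_add socle_class_scale socle_class_monomials low[OF r]; simp)+
    ultimately have "a = 0 \<and> b = 0"
      by (intro pair[of "biX ^ 2 * biY" b "biX * biY ^ 2" a]) (simp_all add: mult.commute)
    then have w0: "w \<in> bideg_le 0" using r by (simp add: r_def)
    define a where "a = bicoeff w 0 0"
    have "w = biC a * 1"
    proof (rule bicoeff_eqI)
      fix i j show "bicoeff w i j = bicoeff (biC a * 1) i j"
        using w0 unfolding bicoeff_simps by (auto simp: a_def bideg_le_def)
    qed
    then have "biX ^ 2 * biY ^ 2 * w = biC a * (biX ^ 2 * biY ^ 2)" by algebra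
    moreover have "biC a * (biX ^ 2 * biY ^ 2) \<in> socle_class (a * 1)"
      by (intro socle_class_scale socle_class_monomials)
    ultimately have "biX ^ 2 * biY ^ 2 * w \<in> socle_class (a * 1)" by (simp only:)
    from neg[OF this] have "a = 0" by simp
    with \<open>w = biC a * 1\<close> w(2) show False by simp
  qed
qed

text \<open>The element \<open>w\<close> pairs to 0 with degree at most 3 and with x^2 y^2, hence
  with everything. A multiple of it with nonzero socle value expresses x^2 y^2 through degree at
  most 3 modulo \<open>ext.null\<close>. So every class has a representative to which
  \<open>L_psd\<close> applies, \<open>ext\<close> is positive, and \<open>exists_real_zero\<close>
  gives a point at which all of \<open>ext.null\<close> vanishes.\<close>

lemma common_real_zero:
  fixes \<kappa> :: "'e::euclidean_space \<Rightarrow> real poly poly"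
  assumes \<kappa>: "\<And>u v. \<kappa> (u + v) = \<kappa> u + \<kappa> v" "\<And>r u. \<kappa> (r *\<^sub>R u) = biC r * \<kappa> u"
    and surj: "\<And>p. p \<in> bideg_le 3 \<Longrightarrow> \<exists>v. p = \<kappa> v"
    and w: "w \<in> bideg_le 3" "w \<noteq> 0" "bicoeff w 3 0 = 0" "bicoeff w 0 3 = 0"
      "\<And>p. p \<in> bideg_le 3 \<Longrightarrow> L (w * p) = 0" "ext (w * (biX ^ 2 * biY ^ 2)) = 0"
    and nz: "b \<in> bideg_le 6" "L b \<noteq> 0"
  obtains x y where "\<And>v. v \<in> bideg_le 3 \<Longrightarrow> (\<And>p. p \<in> bideg_le 3 \<Longrightarrow> L (v * p) = 0) \<Longrightarrow> bieval v x y = 0"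
proof -
  have deg6: "p * p' \<in> bideg_le 6" if "p \<in> bideg_le 3" "p' \<in> bideg_le 3" for p p'
    using bideg_le_mult[OF that] by simp
  have ideal_null: "g \<in> ext.null" if "g \<in> gen_ideal" for g
  proof -
    have "ext (c * g) = 0" for c using gen_ideal_closed(6)[OF that] by (rule ext_ideal)
    then show ?thesis by (simp add: ext.null_def mult.commute)
  qed
  have "ext (w * p) = 0" for p
  proof -
    obtain s r where r: "r \<in> bideg_le 3" and g: "p - (r + biC s * (biX ^ 2 * biY ^ 2)) \<in> gen_ideal"
      using Ex_socle_class[of p] by (auto simp: socle_class_def)
    have "w * p = w * r + biC s * (w * (biX ^ 2 * biY ^ 2)) + w * (p - (r + biC s * (biX ^ 2 * biY ^ 2)))"
      by algebra
    then have "ext (w * p) = ext (w * r) + s * ext (w * (biX ^ 2 * biY ^ 2)) + ext (w * (p - (r + biC s * (biX ^ 2 * biY ^ 2))))"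
      by (simp only: ext.add ext.scale)
    then show ?thesis
      using w(5,6) r ext_bideg[OF deg6[OF w(1) r]] ext_ideal[OF gen_ideal_closed(6)[OF g]] by simp
  qed
  then have w_null: "w \<in> ext.null" by (simp add: ext.null_def)
  obtain m s where ms: "s \<noteq> 0" "m * w \<in> socle_class s" using socle_pairing w(1-4) by blast
  have socle: "\<exists>r\<in>bideg_le 3. biX ^ 2 * biY ^ 2 - r \<in> ext.null"
  proof -
    obtain r where r: "r \<in> bideg_le 3" and g: "m * w - (r + biC s * (biX ^ 2 * biY ^ 2)) \<in> gen_ideal"
      using ms by (auto simp: socle_class_def)
    have "m * w \<in> ext.null" using w_null by (rule ext.null_closed)
    then have "biC (1 / s) * (m * w - (m * w - (r + biC s * (biX ^ 2 * biY ^ 2)))) \<in> ext.null"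
      using ideal_null[OF g] by (rule ext.null_closed(4)[OF ext.null_closed(3)])
    moreover have "biC (1 / s) * biC s = 1" using ms by (simp flip: biC_arith)
    then have "biC (1 / s) * (m * w - (m * w - (r + biC s * (biX ^ 2 * biY ^ 2)))) =
        biX ^ 2 * biY ^ 2 - biC (- (1 / s)) * r"
      by (simp add: biC_arith right_diff_distrib distrib_left flip: mult.assoc)
    ultimately show ?thesis using bideg_le_closed(4)[OF r] by metis
  qed
  have span: "\<exists>r\<in>bideg_le 3. p - r \<in> ext.null" for p
  proof -
    obtain s r where r: "r \<in> bideg_le 3" and g: "p - (r + biC s * (biX ^ 2 * biY ^ 2)) \<in> gen_ideal"
      using Ex_socle_class[of p] by (auto simp: socle_class_def)
    obtain r' where r': "r' \<in> bideg_le 3" "biX ^ 2 * biY ^ 2 - r' \<in> ext.null" using socle by blast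
    have "(p - (r + biC s * (biX ^ 2 * biY ^ 2))) + biC s * (biX ^ 2 * biY ^ 2 - r') \<in> ext.null"
      using ideal_null[OF g] ext.null_closed(4)[OF r'(2)] by (rule ext.null_closed)
    moreover have "(p - (r + biC s * (biX ^ 2 * biY ^ 2))) + biC s * (biX ^ 2 * biY ^ 2 - r') = p - (r + biC s * r')"
      by algebra
    ultimately show ?thesis using bideg_le_closed(2)[OF r bideg_le_closed(4)[OF r'(1)]] by metis
  qed
  have psd: "0 \<le> ext (p * p)" for p
  proof -
    obtain r where r: "r \<in> bideg_le 3" "p - r \<in> ext.null" using span by blast
    have "ext ((p - r) * (p + r)) = 0" using r(2) unfolding ext.null_def by blast
    moreover have "p * p = r * r + (p - r) * (p + r)" by algebra
    ultimately have "ext (p * p) = ext (r * r)" by (simp add: ext.add)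
    then show ?thesis using L_psd[OF r(1)] ext_bideg[OF deg6[OF r(1) r(1)]] by simp
  qed
  interpret P: psd_functional ext by unfold_locales (rule psd)
  have "ext b \<noteq> 0" using nz ext_bideg by simp
  have "\<exists>v. p - \<kappa> v \<in> ext.null" for p using span surj by metis
  then obtain x y where xy: "\<And>p. p \<in> ext.null \<Longrightarrow> bieval p x y = 0"
    using P.exists_real_zero[OF \<kappa> _ \<open>ext b \<noteq> 0\<close>] by blast
  have "bieval v x y = 0" if v: "v \<in> bideg_le 3" "\<And>p. p \<in> bideg_le 3 \<Longrightarrow> L (v * p) = 0" for v
  proof (rule xy)
    have "ext (v * p) = 0" for p
    proof -
      obtain r where r: "r \<in> bideg_le 3" "p - r \<in> ext.null" using span by blast
      have "ext ((p - r) * v) = 0" using r(2) unfolding ext.null_def by blast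
      moreover have "v * p = v * r + (p - r) * v" by algebra
      ultimately have "ext (v * p) = ext (v * r)" by (simp add: ext.add)
      then show ?thesis using v(2)[OF r(1)] ext_bideg[OF deg6[OF v(1) r(1)]] by simp
    qed
    then show "v \<in> ext.null" by (simp add: ext.null_def)
  qed
  then show thesis by (rule that)
qed

end

section \<open>Ternary forms in affine coordinates\<close>

definition mconst :: "'a::comm_ring_1 \<Rightarrow> ('x, 'a) mpoly" where
  "mconst r = Poly_Mapping.single 0 r"

definition mvar :: "'x \<Rightarrow> ('x, 'a::comm_ring_1) mpoly" where
  "mvar i = Poly_Mapping.single (Poly_Mapping.single i 1) 1"

lemma mconst_simps [simp]: "mconst 0 = 0" "mconst 1 = 1"
  by (simp_all add: mconst_def)

lemma mconst_arith:
  "mconst (r + s) = mconst r + mconst s" "mconst (r * s) = mconst r * mconst s"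
  "mconst (r - s) = mconst r - mconst s" "mconst (- r) = - mconst r"
  by (simp_all add: mconst_def single_add mult_single single_diff single_uminus)

lemma lookup_mconst_mult: "Poly_Mapping.lookup (mconst r * p) m = r * Poly_Mapping.lookup p m"
proof -
  have "mconst r * p = Poly_Mapping.map ((*) r) p"
    by (simp add: mconst_def mult_map_scale_conv_mult)
  then show ?thesis by (simp add: map.rep_eq when_def)
qed

lemma mpoly_sum_single: "p = (\<Sum>m\<in>Poly_Mapping.keys p. Poly_Mapping.single m (Poly_Mapping.lookup p m))"
  by (rule poly_mapping_eqI) (simp add: lookup_sum lookup_single when_def in_keys_iff sum.delta)

lemma mpoly_eval_superset:
  assumes "finite A" "Poly_Mapping.keys p \<subseteq> A"
  shows "mpoly_eval p a = (\<Sum>m\<in>A. Poly_Mapping.lookup p m * (\<Prod>i\<in>UNIV. a $ i ^ Poly_Mapping.lookup m i))"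
  unfolding mpoly_eval_def using assms by (intro sum.mono_neutral_left) (auto simp: in_keys_iff)

lemma mpoly_eval_0 [simp]: "mpoly_eval 0 a = 0"
  by (simp add: mpoly_eval_def)

lemma mpoly_eval_add [simp]: "mpoly_eval (p + q) a = mpoly_eval p a + mpoly_eval q a"
proof -
  let ?A = "Poly_Mapping.keys p \<union> Poly_Mapping.keys q"
  have "Poly_Mapping.keys (p + q) \<subseteq> ?A" by (rule keys_add)
  then show ?thesis
    by (simp add: mpoly_eval_superset[of ?A] lookup_add distrib_right sum.distrib)
qed

lemma mpoly_eval_sum [simp]: "mpoly_eval (\<Sum>i\<in>I. g i) a = (\<Sum>i\<in>I. mpoly_eval (g i) a)"
  by (induction I rule: infinite_finite_induct) auto

lemma mpoly_eval_single:
  "mpoly_eval (Poly_Mapping.single m c) a = c * (\<Prod>i\<in>UNIV. a $ i ^ Poly_Mapping.lookup m i)"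
  by (subst mpoly_eval_superset[of "{m}"]) auto

lemma mpoly_eval_mult [simp]:
  fixes p q :: "('x::finite, 'a::comm_ring_1) mpoly"
  shows "mpoly_eval (p * q) a = mpoly_eval p a * mpoly_eval q a"
proof -
  let ?s = "\<lambda>p m. Poly_Mapping.single m (Poly_Mapping.lookup p m)"
  have "p * q = (\<Sum>m\<in>Poly_Mapping.keys p. ?s p m) * (\<Sum>n\<in>Poly_Mapping.keys q. ?s q n)"
    using mpoly_sum_single by metis
  also have "\<dots> = (\<Sum>m\<in>Poly_Mapping.keys p. \<Sum>n\<in>Poly_Mapping.keys q. ?s p m * ?s q n)"
    by (rule sum_product)
  finally have "mpoly_eval (p * q) a =
      (\<Sum>m\<in>Poly_Mapping.keys p. \<Sum>n\<in>Poly_Mapping.keys q. mpoly_eval (?s p m) a * mpoly_eval (?s q n) a)"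
    by (simp add: mult_single mpoly_eval_single lookup_add power_add prod.distrib mult_ac)
  also have "\<dots> = mpoly_eval p a * mpoly_eval q a"
    unfolding mpoly_eval_single by (simp only: mpoly_eval_def[of p] mpoly_eval_def[of q] sum_product)
  finally show ?thesis .
qed

lemma mpoly_eval_mconst [simp]: "mpoly_eval (mconst r) a = r"
  by (simp add: mconst_def mpoly_eval_single)

lemma mpoly_eval_1 [simp]: "mpoly_eval (1 :: ('x::finite, 'a::comm_ring_1) mpoly) a = 1"
  using mpoly_eval_mconst[of 1 a] by simp

lemma mpoly_eval_diff [simp]:
  "mpoly_eval (p - q) a = mpoly_eval p a - mpoly_eval (q :: ('x::finite, 'a::comm_ring_1) mpoly) a"
  using mpoly_eval_add[of "p - q" q a] by simp

lemma mpoly_eval_power [simp]: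
  "mpoly_eval (p ^ n) a = mpoly_eval (p :: ('x::finite, 'a::comm_ring_1) mpoly) a ^ n"
  by (induction n) auto

lemma mpoly_eval_mvar [simp]: "mpoly_eval (mvar i :: ('x::finite, 'a::comm_ring_1) mpoly) a = a $ i"
proof -
  have "(\<Prod>j\<in>UNIV. a $ j ^ (if i = j then Suc 0 else 0)) = (\<Prod>j\<in>UNIV. if i = j then a $ j else 1)"
    by (intro prod.cong) auto
  then show ?thesis by (simp add: mvar_def mpoly_eval_single lookup_single when_def prod.delta')
qed

lemma total_degree_add: "total_degree (m + n) = total_degree m + total_degree n"
  by (simp add: total_degree_def lookup_add sum.distrib)

lemma total_degree_single: "total_degree (Poly_Mapping.single i k) = k"
  by (simp add: total_degree_def lookup_single when_def)

lemma forms_closed: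
  fixes p q :: "('x::finite, 'a::comm_ring_1) mpoly"
  shows "0 \<in> forms d" "mconst r \<in> forms 0" "mvar i \<in> forms 1"
    "p \<in> forms d \<Longrightarrow> q \<in> forms d \<Longrightarrow> p + q \<in> forms d"
    "p \<in> forms d \<Longrightarrow> q \<in> forms d \<Longrightarrow> p - q \<in> forms d"
    "p \<in> forms d \<Longrightarrow> q \<in> forms e \<Longrightarrow> p * q \<in> forms (d + e)"
    "p \<in> forms d \<Longrightarrow> mconst r * p \<in> forms d"
    "p \<in> forms d \<Longrightarrow> p ^ n \<in> forms (d * n)"
proof -
  show "0 \<in> forms d" by (simp add: forms_def)
  show C: "mconst r \<in> forms 0" for r by (simp add: forms_def mconst_def total_degree_def)
  show "mvar i \<in> forms 1" by (simp add: forms_def mvar_def total_degree_single)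
  show "p \<in> forms d \<Longrightarrow> q \<in> forms d \<Longrightarrow> p + q \<in> forms d"
    using keys_add[of p q] by (auto simp: forms_def)
  show "p \<in> forms d \<Longrightarrow> q \<in> forms d \<Longrightarrow> p - q \<in> forms d"
    using keys_diff[of p q] by (auto simp: forms_def)
  show M: "p \<in> forms d \<Longrightarrow> q \<in> forms e \<Longrightarrow> p * q \<in> forms (d + e)" for p q d e
    using keys_mult[of p q] by (fastforce simp: forms_def total_degree_add)
  show "p \<in> forms d \<Longrightarrow> mconst r * p \<in> forms d"
    using M[OF C] by simp
  have "(1 :: ('x, 'a) mpoly) \<in> forms 0" using C[of 1] by simp
  then show "p \<in> forms d \<Longrightarrow> p ^ n \<in> forms (d * n)"
    by (induction n) (auto intro: M)
qed

lemma forms_sum: "(\<And>i. i \<in> I \<Longrightarrow> g i \<in> forms d) \<Longrightarrow> (\<Sum>i\<in>I. g i :: ('x::finite, 'a::comm_ring_1) mpoly) \<in> forms d"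
  by (induction I rule: infinite_finite_induct) (auto intro: forms_closed)

lemma mpoly_eval_scaleR:
  fixes p :: "('x::finite, real) mpoly"
  assumes "p \<in> forms d"
  shows "mpoly_eval p (t *\<^sub>R a) = t ^ d * mpoly_eval p a"
proof -
  have "(\<Prod>i\<in>UNIV. (t *\<^sub>R a) $ i ^ Poly_Mapping.lookup m i) = t ^ d * (\<Prod>i\<in>UNIV. a $ i ^ Poly_Mapping.lookup m i)"
    if "m \<in> Poly_Mapping.keys p" for m
    using that assms by (simp add: forms_def total_degree_def power_mult_distrib prod.distrib flip: power_sum)
  then show ?thesis
    by (simp add: mpoly_eval_def sum_distrib_left mult_ac)
qed

lemma continuous_on_mpoly_eval [continuous_intros]:
  fixes p :: "('x::finite, real) mpoly"
  assumes "continuous_on S g"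
  shows "continuous_on S (\<lambda>t. mpoly_eval p (g t))"
  unfolding mpoly_eval_def using assms by (intro continuous_intros)

lemma single_eq_prod:
  fixes m :: "'x::finite exponent" and c :: "'b::comm_ring_1"
  shows "Poly_Mapping.single m c = mconst c * (\<Prod>i\<in>UNIV. mvar i ^ Poly_Mapping.lookup m i)"
proof -
  have pow: "mvar i ^ n = Poly_Mapping.single (Poly_Mapping.single i n) (1::'b::comm_ring_1)" for i :: 'x and n
  proof (induction n)
    case (Suc n)
    have "Poly_Mapping.single i 1 + Poly_Mapping.single i n = Poly_Mapping.single i (Suc n)"
      by (simp add: single_add[symmetric])
    then show ?case using Suc by (simp add: mvar_def mult_single)
  qed simp
  have prod: "(\<Prod>i\<in>I. Poly_Mapping.single (g i) (1::'b)) = Poly_Mapping.single (\<Sum>i\<in>I. g i) 1"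
    if "finite I" for I and g :: "'x \<Rightarrow> 'x exponent"
    using that by (induction I) (simp_all add: mult_single)
  have "(\<Sum>i\<in>UNIV. Poly_Mapping.single i (Poly_Mapping.lookup m i)) = m"
    by (rule poly_mapping_eqI) (simp add: lookup_sum lookup_single when_def)
  then show ?thesis by (simp add: pow prod mconst_def mult_single)
qed

section \<open>Homogenisation relative to a frame\<close>

definition homogenize :: "(3, real) mpoly \<Rightarrow> (3, real) mpoly \<Rightarrow> (3, real) mpoly \<Rightarrow> nat \<Rightarrow> real poly poly \<Rightarrow> (3, real) mpoly" where
  "homogenize A B C d p = (\<Sum>i\<le>d. \<Sum>j\<le>d - i. mconst (bicoeff p i j) * (A ^ i * B ^ j * C ^ (d - i - j)))"

text \<open>The forms \<open>A\<close>, \<open>B\<close>, \<open>C\<close> are the coordinates dual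
  to the basis \<open>a\<close>, \<open>b\<close>, \<open>c\<close>. The plane C = 0, spanned by
  \<open>a\<close> and \<open>b\<close>, is the projective line at infinity, and C = 1 is the affine
  chart.\<close>

locale frame =
  fixes a b c :: "real ^ 3" and A B C :: "(3, real) mpoly"
  assumes forms: "A \<in> forms 1" "B \<in> forms 1" "C \<in> forms 1"
    and eval: "mpoly_eval A (x *\<^sub>R a + y *\<^sub>R b + z *\<^sub>R c) = x"
      "mpoly_eval B (x *\<^sub>R a + y *\<^sub>R b + z *\<^sub>R c) = y" "mpoly_eval C (x *\<^sub>R a + y *\<^sub>R b + z *\<^sub>R c) = z"
    and mvar: "mvar i = mconst (a $ i) * A + mconst (b $ i) * B + mconst (c $ i) * C"
begin

abbreviation "hom \<equiv> homogenize A B C"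

lemma hom_add: "hom d (p + q) = hom d p + hom d q"
  by (simp add: homogenize_def mconst_arith distrib_right sum.distrib)

lemma hom_scale: "hom d (biC r * p) = mconst r * hom d p"
  by (simp add: homogenize_def mconst_arith sum_distrib_left mult.assoc)

lemma hom_0: "hom d 0 = 0"
  by (simp add: homogenize_def)

lemma hom_sum: "hom d (\<Sum>i\<in>I. g i) = (\<Sum>i\<in>I. hom d (g i))"
  by (induction I rule: infinite_finite_induct) (simp_all add: hom_0 hom_add)

lemma hom_forms: "hom d p \<in> forms d"
  unfolding homogenize_def
proof (intro forms_sum forms_closed(7))
  fix i j assume "i \<in> {..d}" "j \<in> {..d - i}"
  then have "1 * i + 1 * j + 1 * (d - i - j) = d" by auto
  then show "A ^ i * B ^ j * C ^ (d - i - j) \<in> forms d"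
    using forms forms_closed(6,8) by metis
qed

lemma hom_monomial:
  assumes "i + j \<le> d"
  shows "hom d (biX ^ i * biY ^ j) = A ^ i * B ^ j * C ^ (d - i - j)"
proof -
  have mconst_if: "mconst (if k = i \<and> l = j then 1 else 0) * t = (if k = i then if l = j then t else 0 else 0)" for k l t
    by simp
  have "hom d (biX ^ i * biY ^ j) =
      (\<Sum>k\<le>d. if k = i then (\<Sum>l\<le>d - k. if l = j then A ^ k * B ^ l * C ^ (d - k - l) else 0) else 0)"
    unfolding homogenize_def bicoeff_monomial mconst_if by (intro sum.cong refl) simp
  also have "\<dots> = A ^ i * B ^ j * C ^ (d - i - j)"
    using assms by (simp add: sum.delta)
  finally show ?thesis .
qed

text \<open>On monomials the exponents of \<open>C\<close> add up, since the degree bounds keep the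
  truncated subtractions exact; the general case follows by expanding one factor after the
  other.\<close>

lemma hom_mult:
  assumes "p \<in> bideg_le d" "q \<in> bideg_le e"
  shows "hom (d + e) (p * q) = hom d p * hom e q"
proof -
  have mono: "hom (d + e) ((biX ^ i * biY ^ j) * (biX ^ k * biY ^ l)) = hom d (biX ^ i * biY ^ j) * hom e (biX ^ k * biY ^ l)"
    if "i + j \<le> d" "k + l \<le> e" for i j k l
  proof -
    have "(biX ^ i * biY ^ j) * (biX ^ k * biY ^ l) = biX ^ (i + k) * biY ^ (j + l)"
      by (simp add: power_add mult_ac)
    moreover have "hom (d + e) (biX ^ (i + k) * biY ^ (j + l)) = A ^ (i + k) * B ^ (j + l) * C ^ ((d - i - j) + (e - k - l))"
    proof -
      have "d + e - (i + k) - (j + l) = (d - i - j) + (e - k - l)" "i + k + (j + l) \<le> d + e" using that by simp_all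
      then show ?thesis using hom_monomial[of "i + k" "j + l" "d + e"] by (simp only:)
    qed
    ultimately show ?thesis
      using that by (simp only: hom_monomial power_add mult_ac)
  qed
  have right: "hom (d + e) (u * bisum e h) = hom d u * hom e (bisum e h)"
    if "\<And>k l. k + l \<le> e \<Longrightarrow> hom (d + e) (u * (biX ^ k * biY ^ l)) = hom d u * hom e (biX ^ k * biY ^ l)" for u h
  proof -
    have "hom (d + e) (u * bisum e h) = (\<Sum>k\<le>e. \<Sum>l\<le>e - k. mconst (h k l) * hom (d + e) (u * (biX ^ k * biY ^ l)))"
      unfolding bisum_def sum_distrib_left hom_sum mult.left_commute[of u] hom_scale ..
    also have "\<dots> = (\<Sum>k\<le>e. \<Sum>l\<le>e - k. mconst (h k l) * (hom d u * hom e (biX ^ k * biY ^ l)))"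
      by (intro sum.cong refl arg_cong2[of _ _ _ _ "(*)"] that) auto
    also have "\<dots> = hom d u * hom e (bisum e h)"
      unfolding bisum_def sum_distrib_left hom_sum hom_scale by (simp add: mult_ac)
    finally show ?thesis .
  qed
  have left: "hom (d + e) (bisum d h * v) = hom d (bisum d h) * hom e v"
    if "\<And>k l. k + l \<le> d \<Longrightarrow> hom (d + e) (biX ^ k * biY ^ l * v) = hom d (biX ^ k * biY ^ l) * hom e v" for v h
  proof -
    have "hom (d + e) (bisum d h * v) = (\<Sum>k\<le>d. \<Sum>l\<le>d - k. mconst (h k l) * hom (d + e) (biX ^ k * biY ^ l * v))"
      unfolding bisum_def sum_distrib_right hom_sum mult.assoc[of "biC _"] hom_scale ..
    also have "\<dots> = (\<Sum>k\<le>d. \<Sum>l\<le>d - k. mconst (h k l) * (hom d (biX ^ k * biY ^ l) * hom e v))"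
      by (intro sum.cong refl arg_cong2[of _ _ _ _ "(*)"] that) auto
    also have "\<dots> = hom d (bisum d h) * hom e v"
      unfolding bisum_def sum_distrib_right hom_sum hom_scale by (simp add: mult_ac)
    finally show ?thesis .
  qed
  have "hom (d + e) (bisum d h * bisum e h') = hom d (bisum d h) * hom e (bisum e h')" for h h'
    by (intro left right mono)
  then show ?thesis using bideg_le_eq_bisum assms by metis
qed

lemma hom_linear: "hom 1 (biC x * biX + biC y * biY + biC z * 1) = mconst x * A + mconst y * B + mconst z * C"
proof -
  have "hom 1 biX = A" "hom 1 biY = B" "hom 1 1 = C"
    using hom_monomial[of 1 0 1] hom_monomial[of 0 1 1] hom_monomial[of 0 0 1] by simp_all
  then show ?thesis by (simp only: hom_add hom_scale)
qed

lemma hom_surj: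
  assumes "q \<in> forms d"
  obtains p where "p \<in> bideg_le d" "q = hom d p"
proof -
  \<comment> \<open>This is coordinate i restricted to the chart C = 1. Its homogenisation is the
    variable itself, so substituting \<open>l i\<close> for the variables inverts
    \<open>hom\<close>.\<close>
  define l where "l i = biC (a $ i) * biX + biC (b $ i) * biY + biC (c $ i) * 1" for i
  have l: "l i \<in> bideg_le 1" "hom 1 (l i) = mvar i" for i
    unfolding l_def hom_linear mvar by (intro bideg_le_closed bideg_le_gens refl)+
  have hom01: "hom 0 1 = 1" using hom_monomial[of 0 0 0] by simp
  have pow: "l i ^ n \<in> bideg_le n \<and> hom n (l i ^ n) = mvar i ^ n" for i n
  proof (induction n)
    case (Suc n)
    then show ?case
      using bideg_le_mult[OF l(1)[of i], of "l i ^ n" n] hom_mult[OF l(1)[of i], of "l i ^ n" n] by (simp add: l(2)[unfolded One_nat_def])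
  qed (simp add: bideg_le_gens hom01)
  have prod: "(\<Prod>i\<in>I. l i ^ g i) \<in> bideg_le (\<Sum>i\<in>I. g i) \<and> hom (\<Sum>i\<in>I. g i) (\<Prod>i\<in>I. l i ^ g i) = (\<Prod>i\<in>I. mvar i ^ g i)"
    if "finite I" for I and g :: "3 \<Rightarrow> nat"
    using that
  proof (induction I)
    case (insert i I)
    then show ?case
      using bideg_le_mult[of "l i ^ g i" "g i" "\<Prod>i\<in>I. l i ^ g i" "\<Sum>i\<in>I. g i"]
        hom_mult[of "l i ^ g i" "g i" "\<Prod>i\<in>I. l i ^ g i" "\<Sum>i\<in>I. g i"] pow[of i "g i"]
      by simp
  qed (simp add: bideg_le_gens hom01)
  define P where "P = (\<Sum>m\<in>Poly_Mapping.keys q. biC (Poly_Mapping.lookup q m) * (\<Prod>i\<in>UNIV. l i ^ Poly_Mapping.lookup m i))"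
  have mono: "(\<Prod>i\<in>UNIV. l i ^ Poly_Mapping.lookup m i) \<in> bideg_le d"
    "hom d (\<Prod>i\<in>UNIV. l i ^ Poly_Mapping.lookup m i) = (\<Prod>i\<in>UNIV. mvar i ^ Poly_Mapping.lookup m i)"
    if "m \<in> Poly_Mapping.keys q" for m
  proof -
    have "(\<Sum>i\<in>UNIV. Poly_Mapping.lookup m i) = d"
      using that assms by (simp add: forms_def total_degree_def)
    then show "(\<Prod>i\<in>UNIV. l i ^ Poly_Mapping.lookup m i) \<in> bideg_le d"
      "hom d (\<Prod>i\<in>UNIV. l i ^ Poly_Mapping.lookup m i) = (\<Prod>i\<in>UNIV. mvar i ^ Poly_Mapping.lookup m i)"
      using prod[OF finite_class.finite_UNIV, of "Poly_Mapping.lookup m"] by simp_all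
  qed
  have sum: "sum g I \<in> bideg_le d" if "\<And>i. i \<in> I \<Longrightarrow> g i \<in> bideg_le d" for g and I :: "3 exponent set"
    using that by (induction I rule: infinite_finite_induct) (auto intro: bideg_le_closed)
  have "P \<in> bideg_le d"
    unfolding P_def by (intro sum bideg_le_closed(4) mono)
  have "hom d P = (\<Sum>m\<in>Poly_Mapping.keys q. mconst (Poly_Mapping.lookup q m) * (\<Prod>i\<in>UNIV. mvar i ^ Poly_Mapping.lookup m i))"
    unfolding P_def hom_sum hom_scale by (intro sum.cong refl arg_cong2[of _ _ _ _ "(*)"] mono)
  also have "\<dots> = q"
    unfolding single_eq_prod[symmetric] by (rule mpoly_sum_single[symmetric])
  finally show thesis using that \<open>P \<in> bideg_le d\<close> by simp
qed

lemma bieval_bisum: "bieval (bisum d h) x y = (\<Sum>i\<le>d. \<Sum>j\<le>d - i. h i j * (x ^ i * y ^ j))"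
proof -
  have pow: "bieval (p ^ n) x y = bieval p x y ^ n" for p n
    by (simp add: bieval_def poly_power)
  have "bieval (\<Sum>i\<in>I. g i) x y = (\<Sum>i\<in>I. bieval (g i) x y)" for g and I :: "nat set"
    by (simp add: bieval_def poly_sum)
  then show ?thesis by (simp add: bisum_def pow)
qed

lemma eval_hom:
  "mpoly_eval (hom d p) (x *\<^sub>R a + y *\<^sub>R b + z *\<^sub>R c) =
    (\<Sum>i\<le>d. \<Sum>j\<le>d - i. bicoeff p i j * (x ^ i * y ^ j * z ^ (d - i - j)))"
  by (simp add: homogenize_def eval)

lemma eval_hom_affine:
  assumes "p \<in> bideg_le d"
  shows "mpoly_eval (hom d p) (x *\<^sub>R a + y *\<^sub>R b + c) = bieval p x y"
proof -
  have "bieval p x y = bieval (bisum d (bicoeff p)) x y" using bideg_le_eq_bisum[OF assms] by simp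
  then show ?thesis using eval_hom[of d p x y 1] by (simp add: bieval_bisum)
qed

lemma eval_hom_infinity:
  "mpoly_eval (hom 3 p) (x *\<^sub>R a + y *\<^sub>R b) =
    bicoeff p 3 0 * x ^ 3 + bicoeff p 2 1 * x\<^sup>2 * y + bicoeff p 1 2 * x * y\<^sup>2 + bicoeff p 0 3 * y ^ 3"
  using eval_hom[of 3 p x y 0] by (simp add: eval_nat_numeral atMost_Suc algebra_simps)

lemma hom_eq_0D: "p \<in> bideg_le d \<Longrightarrow> hom d p = 0 \<Longrightarrow> p = 0"
  using eval_hom_affine[of p d] by (intro bieval_eq_0D) simp

end

text \<open>With \<open>cross3 a b\<close> as third vector, the dual basis consists of cross
  products divided by the triple product, which here is the squared length of
  \<open>c\<close>.\<close>

lemma exists_frame: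
  fixes a b :: "real ^ 3"
  assumes "cross3 a b \<noteq> 0"
  obtains c A B C where "frame a b c A B C"
proof -
  define c where "c = cross3 a b"
  define n where "n = c \<bullet> c"
  have n: "n \<noteq> 0" using assms by (simp add: n_def c_def)
  define lin :: "real ^ 3 \<Rightarrow> (3, real) mpoly" where "lin v = (\<Sum>i\<in>UNIV. mconst (v $ i) * mvar i)" for v
  define u v w where "u = (1 / n) *\<^sub>R cross3 b c" and "v = (1 / n) *\<^sub>R cross3 c a" and "w = (1 / n) *\<^sub>R c"
  have lin: "mpoly_eval (lin v) x = v \<bullet> x" "lin v \<in> forms 1" for v x
    unfolding lin_def by (auto simp: inner_vec_def intro!: forms_sum forms_closed(7) forms_closed(3)[unfolded One_nat_def])
  have det: "cross3 b c \<bullet> a = n" "cross3 c a \<bullet> b = n"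
    unfolding n_def by (simp_all add: c_def cross3_simps)
  have dual: "u \<bullet> a = 1" "u \<bullet> b = 0" "u \<bullet> c = 0" "v \<bullet> a = 0" "v \<bullet> b = 1" "v \<bullet> c = 0"
    "w \<bullet> a = 0" "w \<bullet> b = 0" "w \<bullet> c = 1"
    using n det unfolding u_def v_def w_def by (simp_all add: dot_cross_self) (simp_all add: c_def dot_cross_self n_def)
  define M :: "real ^ 3 ^ 3" where "M = (\<chi> i j. if i = 1 then u $ j else if i = 2 then v $ j else w $ j)"
  define N :: "real ^ 3 ^ 3" where "N = (\<chi> i j. if j = 1 then a $ i else if j = 2 then b $ i else c $ i)"
  \<comment> \<open>Duality is M ** N = 1. The reverse product, equal to 1 because the matrices are
    square, expresses each variable through the three dual forms.\<close>
  have "M ** N = mat 1"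
    using dual by (simp add: vec_eq_iff matrix_matrix_mult_def M_def N_def mat_def forall_3 inner_vec_def)
  then have "N ** M = mat 1" by (rule matrix_left_right_inverse[THEN iffD1])
  then have coord: "a $ i * u $ j + b $ i * v $ j + c $ i * w $ j = (if i = j then 1 else 0)" for i j
    by (simp add: vec_eq_iff matrix_matrix_mult_def M_def N_def mat_def sum_3)
  have "mvar i = mconst (a $ i) * lin u + mconst (b $ i) * lin v + mconst (c $ i) * lin w" for i
  proof -
    have "mconst (a $ i) * lin u + mconst (b $ i) * lin v + mconst (c $ i) * lin w =
        (\<Sum>j\<in>UNIV. mconst (a $ i * u $ j + b $ i * v $ j + c $ i * w $ j) * mvar j)"
      by (simp add: lin_def mconst_arith sum_distrib_left distrib_right sum.distrib mult.assoc)
    also have "\<dots> = (\<Sum>j\<in>UNIV. if i = j then mvar j else 0)"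
      unfolding coord by (intro sum.cong) auto
    finally show ?thesis by simp
  qed
  then have "frame a b c (lin u) (lin v) (lin w)"
    using lin dual by unfold_locales (auto simp: inner_add_right)
  then show thesis by (rule that)
qed

lemma form_eq_0:
  fixes q :: "(3, real) mpoly"
  assumes "q \<in> forms d" "\<And>x. mpoly_eval q x = 0"
  shows "q = 0"
proof -
  have "cross3 (axis 1 1) (axis 2 1) \<noteq> (0 :: real ^ 3)"
    by (simp add: cross_basis axis_eq_0_iff)
  then obtain c A B C where "frame (axis 1 1) (axis 2 1 :: real ^ 3) c A B C" using exists_frame by metis
  then interpret frame "axis 1 1" "axis 2 1" c A B C .
  obtain p where p: "p \<in> bideg_le d" "q = hom d p" using hom_surj assms(1) by blast
  have "p = 0" using assms(2) eval_hom_affine[OF p(1)] by (intro bieval_eq_0D) (simp add: p(2))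
  then show ?thesis by (simp add: p hom_0)
qed

section \<open>Radicals of dimension at least four\<close>

text \<open>Indexes the coordinates of the ten-dimensional space of ternary cubics, so that
  compactness and bilinear forms on Euclidean space become available for them.\<close>

typedef cubic_exponent = "{m :: 3 exponent. total_degree m = 3}"
  using total_degree_single[of _ 3] by blast

instance cubic_exponent :: finite
proof
  have "range Rep_cubic_exponent = {m. total_degree m = 3}"
    by (rule type_definition.Rep_range[OF type_definition_cubic_exponent])
  then have "finite (range Rep_cubic_exponent)"
    by (simp add: finite_total_degree)
  then show "finite (UNIV :: cubic_exponent set)"
    by (rule finite_imageD) (simp add: inj_on_def Rep_cubic_exponent_inject)
qed

definition cubic_form :: "real ^ cubic_exponent \<Rightarrow> (3, real) mpoly" where
  "cubic_form v = (\<Sum>k\<in>UNIV. Poly_Mapping.single (Rep_cubic_exponent k) (v $ k))"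

definition cubic_coeffs :: "(3, real) mpoly \<Rightarrow> real ^ cubic_exponent" where
  "cubic_coeffs p = (\<chi> k. Poly_Mapping.lookup p (Rep_cubic_exponent k))"

lemma lookup_cubic_form:
  "Poly_Mapping.lookup (cubic_form v) m = (if total_degree m = 3 then v $ Abs_cubic_exponent m else 0)"
proof (cases "total_degree m = 3")
  case True
  then have "(Rep_cubic_exponent k = m) = (k = Abs_cubic_exponent m)" for k
    by (auto simp: Abs_cubic_exponent_inverse Rep_cubic_exponent_inverse)
  then show ?thesis
    using True by (simp add: cubic_form_def lookup_sum lookup_single when_def)
next
  case False
  then have "Rep_cubic_exponent k \<noteq> m" for k using Rep_cubic_exponent[of k] by auto
  then show ?thesis
    using False by (simp add: cubic_form_def lookup_sum lookup_single when_def)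
qed

lemma cubic_form_forms: "cubic_form v \<in> forms 3"
  by (auto simp: forms_def in_keys_iff lookup_cubic_form split: if_splits)

lemma cubic_coeffs_form: "cubic_coeffs (cubic_form v) = v"
  using Rep_cubic_exponent by (simp add: cubic_coeffs_def vec_eq_iff lookup_cubic_form Rep_cubic_exponent_inverse)

lemma cubic_form_coeffs: "p \<in> forms 3 \<Longrightarrow> cubic_form (cubic_coeffs p) = p"
  by (rule poly_mapping_eqI)
    (auto simp: lookup_cubic_form cubic_coeffs_def Abs_cubic_exponent_inverse forms_def in_keys_iff)

lemma cubic_form_add: "cubic_form (u + v) = cubic_form u + cubic_form v"
  by (rule poly_mapping_eqI) (simp add: lookup_cubic_form lookup_add)

lemma cubic_form_scaleR: "cubic_form (r *\<^sub>R u) = mconst r * cubic_form u"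
  by (rule poly_mapping_eqI) (simp add: lookup_cubic_form lookup_mconst_mult)

lemma underdetermined_system:
  fixes \<phi> :: "3 \<Rightarrow> 4 \<Rightarrow> real"
  obtains c :: "real ^ 4" where "c \<noteq> 0" "\<And>k. (\<Sum>i\<in>UNIV. c $ i * \<phi> k i) = 0"
proof -
  define f :: "real ^ 4 \<Rightarrow> real ^ 3" where "f c = (\<chi> k. \<Sum>i\<in>UNIV. c $ i * \<phi> k i)" for c
  have lin: "linear f"
    by (rule linearI) (simp_all add: f_def vec_eq_iff distrib_right sum.distrib sum_distrib_left mult.assoc)
  have "\<not> inj f"
  proof
    assume "inj f"
    then have "dim (range f) = dim (UNIV :: (real ^ 4) set)" using lin by (intro dim_image_eq) auto
    moreover have "dim (range f) \<le> 3" using dim_subset_UNIV[of "range f"] by simp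
    ultimately show False by simp
  qed
  then obtain c where "c \<noteq> 0" "f c = 0" using linear_injective_0[OF lin] by blast
  then show thesis using that by (simp add: f_def vec_eq_iff)
qed

text \<open>An odd form changes sign between antipodal points of the circle, hence vanishes
  somewhere on a half circle.\<close>

lemma binary_cubic_zero:
  fixes e0 e1 e2 e3 :: real
  obtains p q where "p\<^sup>2 + q\<^sup>2 = 1" "e0 * p ^ 3 + e1 * p\<^sup>2 * q + e2 * p * q\<^sup>2 + e3 * q ^ 3 = 0"
proof -
  define g where "g \<theta> = e0 * cos \<theta> ^ 3 + e1 * (cos \<theta>)\<^sup>2 * sin \<theta> + e2 * cos \<theta> * (sin \<theta>)\<^sup>2 + e3 * sin \<theta> ^ 3" for \<theta>
  have cont: "continuous_on {0..pi} g" "continuous_on {0..pi} (\<lambda>t. - g t)"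
    unfolding g_def by (intro continuous_intros)+
  have "g pi = - g 0" by (simp add: g_def)
  have "\<exists>\<theta>. g \<theta> = 0"
  proof (cases "g 0 \<le> 0")
    case True
    then show ?thesis using IVT'[of g 0 0 pi] cont \<open>g pi = - g 0\<close> by auto
  next
    case False
    then show ?thesis using IVT'[of "\<lambda>t. - g t" 0 0 pi] cont \<open>g pi = - g 0\<close> by auto
  qed
  then obtain \<theta> where "g \<theta> = 0" by blast
  then show thesis using that[of "cos \<theta>" "sin \<theta>"] by (simp add: g_def)
qed

lemma cubic_form_scaleR_point:
  fixes p :: "(3, real) mpoly"
  shows "p \<in> forms 3 \<Longrightarrow> mpoly_eval p (t *\<^sub>R z) = t ^ 3 * mpoly_eval p z"
  by (rule mpoly_eval_scaleR)

lemma form3_at_0: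
  fixes p :: "(3, real) mpoly"
  shows "p \<in> forms 3 \<Longrightarrow> mpoly_eval p 0 = 0"
  using mpoly_eval_scaleR[of p 3 0 0] by simp

lemma line_coefficients:
  fixes p :: "(3, real) mpoly"
  assumes "p \<in> forms 3" "cross3 x y \<noteq> 0"
  obtains e1 e2 where
    "\<And>s t. mpoly_eval p (s *\<^sub>R x + t *\<^sub>R y) = mpoly_eval p x * s ^ 3 + e1 * s\<^sup>2 * t + e2 * s * t\<^sup>2 + mpoly_eval p y * t ^ 3"
proof -
  obtain c A B C where "frame x y c A B C" using exists_frame assms(2) by blast
  then interpret frame x y c A B C .
  obtain P where P: "p = hom 3 P" using hom_surj[OF assms(1)] by blast
  have "mpoly_eval p x = bicoeff P 3 0" "mpoly_eval p y = bicoeff P 0 3"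
    using eval_hom_infinity[of P 1 0] eval_hom_infinity[of P 0 1] by (simp_all add: P)
  then show thesis using that eval_hom_infinity[of P] by (simp add: P)
qed

lemma cubic_coefficients_unique:
  fixes a b c d a' b' c' d' :: real
  assumes "\<And>s t. a * s ^ 3 + b * s\<^sup>2 * t + c * s * t\<^sup>2 + d * t ^ 3 = a' * s ^ 3 + b' * s\<^sup>2 * t + c' * s * t\<^sup>2 + d' * t ^ 3"
  shows "a = a'" "b = b'" "c = c'" "d = d'"
proof -
  show "a = a'" "d = d'" using assms[of 1 0] assms[of 0 1] by simp_all
  then show "b = b'" "c = c'" using assms[of 1 1] assms[of 1 "- 1"] by simp_all
qed

definition sextic_radical :: "((3, real) mpoly \<Rightarrow> real) \<Rightarrow> (3, real) mpoly set" where
  "sextic_radical l = {w \<in> forms 3. \<forall>p\<in>forms 3. l (w * p) = 0}"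

locale sextic_functional =
  fixes l :: "(3, real) mpoly \<Rightarrow> real"
  assumes add: "l (p + q) = l p + l q" and scale: "l (mconst r * p) = r * l p"
begin

abbreviation "W \<equiv> sextic_radical l"

lemma zero: "l 0 = 0" using scale[of 0 0] by simp
lemma diff: "l (p - q) = l p - l q" using add[of "p - q" q] by simp

lemma W_forms: "w \<in> W \<Longrightarrow> w \<in> forms 3"
  by (simp add: sextic_radical_def)

lemma W_closed:
  "0 \<in> W" "v \<in> W \<Longrightarrow> w \<in> W \<Longrightarrow> v + w \<in> W" "v \<in> W \<Longrightarrow> w \<in> W \<Longrightarrow> v - w \<in> W"
  "v \<in> W \<Longrightarrow> mconst r * v \<in> W"
  by (auto simp: sextic_radical_def zero add diff scale distrib_right left_diff_distrib mult.assoc intro: forms_closed)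

lemma W_sum: "(\<And>i. i \<in> I \<Longrightarrow> g i \<in> W) \<Longrightarrow> (\<Sum>i\<in>I. g i) \<in> W"
  by (induction I rule: infinite_finite_induct) (auto intro: W_closed)

end

text \<open>Collects the assumptions under which the dimension bound would fail; they are shown to
  force \<open>l\<close> to vanish on all sextics.\<close>

locale large_radical = sextic_functional +
  fixes w :: "4 \<Rightarrow> (3, real) mpoly"
  assumes psd: "p \<in> forms 3 \<Longrightarrow> 0 \<le> l (p * p)"
    and w: "w i \<in> W" and independent: "(\<Sum>i\<in>UNIV. mconst (c $ i) * w i) = 0 \<Longrightarrow> c = 0"
    and no_zero: "z \<noteq> 0 \<Longrightarrow> \<exists>v\<in>W. mpoly_eval v z \<noteq> 0"
begin

lemma exists_vanishing:
  obtains u where "u \<in> W" "u \<noteq> 0" "mpoly_eval u a = 0" "mpoly_eval u b = 0" "mpoly_eval u c = 0"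
proof -
  define \<phi> :: "3 \<Rightarrow> 4 \<Rightarrow> real" where "\<phi> k i = mpoly_eval (w i) (if k = 1 then a else if k = 2 then b else c)" for k i
  obtain e :: "real ^ 4" where e: "e \<noteq> 0" "\<And>k. (\<Sum>i\<in>UNIV. e $ i * \<phi> k i) = 0"
    using underdetermined_system by blast
  define u where "u = (\<Sum>i\<in>UNIV. mconst (e $ i) * w i)"
  show thesis
  proof
    show "u \<in> W" unfolding u_def by (intro W_sum W_closed w)
    show "u \<noteq> 0" using e(1) independent by (auto simp: u_def)
    show "mpoly_eval u a = 0" "mpoly_eval u b = 0" "mpoly_eval u c = 0"
      using e(2)[of 1] e(2)[of 2] e(2)[of 3] by (simp_all add: u_def \<phi>_def)
  qed
qed

text \<open>The values of \<open>v1\<close>, \<open>v2\<close>, \<open>v3\<close> at three collinear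
  points form a triangular matrix with nonzero diagonal. So the restriction of \<open>W\<close> to
  the line through \<open>x\<close> and \<open>y\<close> has dimension at least three.\<close>

definition "triple x y z \<longleftrightarrow> (\<exists>s t. z = s *\<^sub>R x + t *\<^sub>R y) \<and>
  (\<exists>v1\<in>W. mpoly_eval v1 x \<noteq> 0) \<and> (\<exists>v2\<in>W. mpoly_eval v2 x = 0 \<and> mpoly_eval v2 y \<noteq> 0) \<and>
  (\<exists>v3\<in>W. mpoly_eval v3 x = 0 \<and> mpoly_eval v3 y = 0 \<and> mpoly_eval v3 z \<noteq> 0)"

text \<open>By dimension there are four members with triangular values at points \<open>a\<close>,
  \<open>b\<close>, \<open>c\<close>, \<open>p\<close>. If \<open>c\<close> is off the line through
  \<open>a\<close> and \<open>b\<close>, let \<open>d\<close> be the point where the line through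
  \<open>c\<close> and \<open>p\<close> meets it. Either \<open>u3\<close> or \<open>u4\<close> is
  nonzero at \<open>d\<close>, and \<open>a\<close>, \<open>b\<close>, \<open>d\<close> work, or
  both vanish there and \<open>d\<close>, \<open>c\<close>, \<open>p\<close> work, with the first
  member supplied by \<open>no_zero\<close>.\<close>

lemma exists_triple: "\<exists>x y z. triple x y z"
proof -
  have point: "\<exists>a. mpoly_eval u a \<noteq> 0" if "u \<in> W" "u \<noteq> 0" for u
    using form_eq_0[OF W_forms[OF that(1)]] that(2) by blast
  obtain u1 a where u1: "u1 \<in> W" "mpoly_eval u1 a \<noteq> 0" using exists_vanishing[of 0 0 0] point by metis
  obtain u2 b where u2: "u2 \<in> W" "mpoly_eval u2 a = 0" "mpoly_eval u2 b \<noteq> 0"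
    using exists_vanishing[of a a a] point by metis
  obtain u3 c where u3: "u3 \<in> W" "mpoly_eval u3 a = 0" "mpoly_eval u3 b = 0" "mpoly_eval u3 c \<noteq> 0"
    using exists_vanishing[of a b b] point by metis
  obtain u4 p where u4: "u4 \<in> W" "mpoly_eval u4 a = 0" "mpoly_eval u4 b = 0" "mpoly_eval u4 c = 0" "mpoly_eval u4 p \<noteq> 0"
    using exists_vanishing[of a b c] point by metis
  show ?thesis
  proof (cases "\<exists>s t. c = s *\<^sub>R a + t *\<^sub>R b")
    case True
    then have "triple a b c" unfolding triple_def using u1 u2 u3 by blast
    then show ?thesis by blast
  next
    case False
    have "a \<noteq> 0" using u1 form3_at_0[OF W_forms] by auto
    have b: "b \<notin> span {a}"
      using u2 cubic_form_scaleR_point[OF W_forms[OF u2(1)]] by (auto simp: span_singleton)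
    have c: "c \<notin> span {b, a}"
    proof
      assume "c \<in> span {b, a}"
      then obtain k h where "c - k *\<^sub>R b = h *\<^sub>R a"
        by (auto simp: span_breakdown_eq[of c b] span_singleton)
      then have "c = h *\<^sub>R a + k *\<^sub>R b" by (simp add: algebra_simps)
      with False show False by blast
    qed
    have ind: "independent {c, b, a}"
      using \<open>a \<noteq> 0\<close> b c by (simp add: independent_insert)
    have "c \<notin> {b, a}" "b \<noteq> a" using b c by (auto intro: span_base)
    then have "card {c, b, a} = 3" by simp
    then have "UNIV \<subseteq> span {c, b, a}"
      using ind by (intro card_ge_dim_independent) auto
    then have "p \<in> span {c, b, a}" by blast
    then obtain \<gamma> \<beta> \<alpha> where "p - \<gamma> *\<^sub>R c - \<beta> *\<^sub>R b = \<alpha> *\<^sub>R a"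
      unfolding span_breakdown_eq[of p c] span_breakdown_eq[of _ b] span_singleton by blast
    then have p: "p = (\<alpha> *\<^sub>R a + \<beta> *\<^sub>R b) + \<gamma> *\<^sub>R c" by (simp add: algebra_simps)
    define d where "d = \<alpha> *\<^sub>R a + \<beta> *\<^sub>R b"
    \<comment> \<open>Otherwise \<open>p\<close> would be a multiple of \<open>c\<close>, where
      \<open>u4\<close> vanishes.\<close>
    have "d \<noteq> 0"
      using u4 cubic_form_scaleR_point[OF W_forms[OF u4(1)]] by (auto simp: p d_def)
    show ?thesis
    proof (cases "mpoly_eval u3 d = 0 \<and> mpoly_eval u4 d = 0")
      case True
      obtain v where "v \<in> W" "mpoly_eval v d \<noteq> 0" using no_zero \<open>d \<noteq> 0\<close> by blast
      moreover have "p = 1 *\<^sub>R d + \<gamma> *\<^sub>R c" by (simp add: p d_def)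
      ultimately have "triple d c p" unfolding triple_def using u3 u4 True by blast
      then show ?thesis by blast
    next
      case False
      then have "triple a b d" unfolding triple_def using u1 u2 u3 u4 d_def by blast
      then show ?thesis by blast
    qed
  qed
qed

text \<open>Restricted to the line, \<open>W\<close> contains a hyperplane of the four-dimensional
  space of binary cubics. The cube (p s + q t)^3 lies in a given hyperplane when one binary cubic in
  p and q vanishes, and that has a real solution. Rotating the basis by (p, q) turns the cube into
  s^3.\<close>

lemma exists_cube_on_line:
  obtains a b v where "cross3 a b \<noteq> 0" "v \<in> W" "\<And>s t. mpoly_eval v (s *\<^sub>R a + t *\<^sub>R b) = s ^ 3"
proof -
  obtain x y z s0 t0 v1 v2 v3 where z: "z = s0 *\<^sub>R x + t0 *\<^sub>R y"
    and v: "v1 \<in> W" "v2 \<in> W" "v3 \<in> W" and v1: "mpoly_eval v1 x \<noteq> 0"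
    and v2: "mpoly_eval v2 x = 0" "mpoly_eval v2 y \<noteq> 0"
    and v3: "mpoly_eval v3 x = 0" "mpoly_eval v3 y = 0" "mpoly_eval v3 z \<noteq> 0"
    using exists_triple unfolding triple_def by blast
  have "x \<noteq> 0" "y \<noteq> 0" using v1 v2 form3_at_0[OF W_forms] v by auto
  have cross: "cross3 x y \<noteq> 0"
  proof
    assume "cross3 x y = 0"
    then obtain k where "y = k *\<^sub>R x" using \<open>x \<noteq> 0\<close> \<open>y \<noteq> 0\<close> by (auto simp: cross_eq_0 collinear_lemma)
    then show False using v2 cubic_form_scaleR_point[OF W_forms[OF v(2)]] by auto
  qed
  obtain A B where AB: "\<And>s t. mpoly_eval v3 (s *\<^sub>R x + t *\<^sub>R y) = A * s\<^sup>2 * t + B * s * t\<^sup>2"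
    using line_coefficients[OF W_forms[OF v(3)] cross] v3 by auto
  obtain A2 B2 where AB2: "\<And>s t. mpoly_eval v2 (s *\<^sub>R x + t *\<^sub>R y) = A2 * s\<^sup>2 * t + B2 * s * t\<^sup>2 + mpoly_eval v2 y * t ^ 3"
    using line_coefficients[OF W_forms[OF v(2)] cross] v2 by auto
  obtain A1 B1 where AB1: "\<And>s t. mpoly_eval v1 (s *\<^sub>R x + t *\<^sub>R y) = mpoly_eval v1 x * s ^ 3 + A1 * s\<^sup>2 * t + B1 * s * t\<^sup>2 + mpoly_eval v1 y * t ^ 3"
    using line_coefficients[OF W_forms[OF v(1)] cross] by metis
  define k where "k = mpoly_eval v2 y"
  define m where "m = mpoly_eval v1 x"
  define n where "n = mpoly_eval v1 y"
  have km: "k \<noteq> 0" "m \<noteq> 0" using v1 v2 by (simp_all add: k_def m_def)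
  \<comment> \<open>On the line, \<open>u2\<close> becomes t^3 and \<open>u1\<close> becomes s^3,
    each up to middle terms; \<open>v3\<close> consists of middle terms only.\<close>
  define u2 where "u2 = mconst (1 / k) * v2"
  define u1 where "u1 = mconst (1 / m) * (v1 - mconst n * u2)"
  have u: "u1 \<in> W" "u2 \<in> W" unfolding u1_def u2_def by (intro W_closed v)+
  define a2 b2 where "a2 = A2 / k" and "b2 = B2 / k"
  define a1 b1 where "a1 = (A1 - n * a2) / m" and "b1 = (B1 - n * b2) / m"
  have E2: "mpoly_eval u2 (s *\<^sub>R x + t *\<^sub>R y) = a2 * s\<^sup>2 * t + b2 * s * t\<^sup>2 + t ^ 3" for s t
    using km by (simp add: u2_def AB2 a2_def b2_def field_simps flip: k_def)
  have E1: "mpoly_eval u1 (s *\<^sub>R x + t *\<^sub>R y) = s ^ 3 + a1 * s\<^sup>2 * t + b1 * s * t\<^sup>2" for s t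
    using km by (simp add: u1_def AB1 E2 a1_def b1_def field_simps flip: m_def n_def)
  have "A \<noteq> 0 \<or> B \<noteq> 0" using v3(3) AB by (auto simp: z)
  \<comment> \<open>The equation \<open>root\<close> says that the middle coefficients of (p s + q
    t)^3 - p^3 u1 - q^3 u2 are proportional to (A, B); \<open>\<kappa>\<close> is the factor of
    proportionality.\<close>
  obtain p q where pq: "p\<^sup>2 + q\<^sup>2 = 1"
    and root: "(A * b1 - B * a1) * p ^ 3 + 3 * B * p\<^sup>2 * q + (- 3 * A) * p * q\<^sup>2 + (A * b2 - B * a2) * q ^ 3 = 0"
    using binary_cubic_zero by metis
  define \<kappa> where "\<kappa> = (if A \<noteq> 0 then (3 * p\<^sup>2 * q - p ^ 3 * a1 - q ^ 3 * a2) / A else (3 * p * q\<^sup>2 - p ^ 3 * b1 - q ^ 3 * b2) / B)"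
  have \<kappa>: "\<kappa> * A = 3 * p\<^sup>2 * q - p ^ 3 * a1 - q ^ 3 * a2" "\<kappa> * B = 3 * p * q\<^sup>2 - p ^ 3 * b1 - q ^ 3 * b2"
  proof -
    have *: "B * (3 * p\<^sup>2 * q - p ^ 3 * a1 - q ^ 3 * a2) = A * (3 * p * q\<^sup>2 - p ^ 3 * b1 - q ^ 3 * b2)"
      using root by (simp add: algebra_simps)
    have "\<kappa> * A = 3 * p\<^sup>2 * q - p ^ 3 * a1 - q ^ 3 * a2 \<and> \<kappa> * B = 3 * p * q\<^sup>2 - p ^ 3 * b1 - q ^ 3 * b2"
    proof (cases "A = 0")
      case True
      then have "B \<noteq> 0" "3 * p\<^sup>2 * q - p ^ 3 * a1 - q ^ 3 * a2 = 0" using * \<open>A \<noteq> 0 \<or> B \<noteq> 0\<close> by auto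
      with True show ?thesis by (simp add: \<kappa>_def)
    next
      case False
      have "B * ((3 * p\<^sup>2 * q - p ^ 3 * a1 - q ^ 3 * a2) / A) = 3 * p * q\<^sup>2 - p ^ 3 * b1 - q ^ 3 * b2"
        unfolding times_divide_eq_right * using False by simp
      with False show ?thesis by (simp add: \<kappa>_def mult.commute)
    qed
    then show "\<kappa> * A = 3 * p\<^sup>2 * q - p ^ 3 * a1 - q ^ 3 * a2" "\<kappa> * B = 3 * p * q\<^sup>2 - p ^ 3 * b1 - q ^ 3 * b2"
      by simp_all
  qed
  define v where "v = mconst (p ^ 3) * u1 + mconst (q ^ 3) * u2 + mconst \<kappa> * v3"
  have cube: "mpoly_eval v (s *\<^sub>R x + t *\<^sub>R y) = (p * s + q * t) ^ 3" for s t
  proof -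
    have "mpoly_eval v (s *\<^sub>R x + t *\<^sub>R y) = p ^ 3 * s ^ 3 + q ^ 3 * t ^ 3
      + (p ^ 3 * a1 + q ^ 3 * a2 + \<kappa> * A) * s\<^sup>2 * t + (p ^ 3 * b1 + q ^ 3 * b2 + \<kappa> * B) * s * t\<^sup>2"
      by (simp add: v_def E1 E2 AB algebra_simps)
    also have "\<dots> = (p * s + q * t) ^ 3" unfolding \<kappa> by algebra
    finally show ?thesis .
  qed
  show thesis
  proof
    have "cross3 (p *\<^sub>R x + q *\<^sub>R y) ((- q) *\<^sub>R x + p *\<^sub>R y) = (p\<^sup>2 + q\<^sup>2) *\<^sub>R cross3 x y"
      by (simp add: cross3_simps power2_eq_square)
    then show "cross3 (p *\<^sub>R x + q *\<^sub>R y) ((- q) *\<^sub>R x + p *\<^sub>R y) \<noteq> 0" using cross pq by simp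
    show "v \<in> W" unfolding v_def by (intro W_closed u \<open>v3 \<in> W\<close>)
    fix s t
    have "s *\<^sub>R (p *\<^sub>R x + q *\<^sub>R y) + t *\<^sub>R ((- q) *\<^sub>R x + p *\<^sub>R y) = (s * p - t * q) *\<^sub>R x + (s * q + t * p) *\<^sub>R y"
      by (simp add: algebra_simps)
    then have "mpoly_eval v (s *\<^sub>R (p *\<^sub>R x + q *\<^sub>R y) + t *\<^sub>R ((- q) *\<^sub>R x + p *\<^sub>R y)) = (p * (s * p - t * q) + q * (s * q + t * p)) ^ 3"
      by (simp only: cube)
    also have "p * (s * p - t * q) + q * (s * q + t * p) = (p\<^sup>2 + q\<^sup>2) * s" by algebra
    finally show "mpoly_eval v (s *\<^sub>R (p *\<^sub>R x + q *\<^sub>R y) + t *\<^sub>R ((- q) *\<^sub>R x + p *\<^sub>R y)) = s ^ 3"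
      using pq by simp
  qed
qed

text \<open>
  Take the line spanned by \<open>a\<close> and \<open>b\<close> as the line at infinity: the cube on it is coprime there
  to any member of \<open>W\<close> that does not vanish at \<open>b\<close>. A combination of the four given members then
  supplies the element that makes the extended functional flat.
\<close>

lemma functional_vanishes:
  assumes "g \<in> forms 6"
  shows "l g = 0"
proof (rule ccontr)
  assume "l g \<noteq> 0"
  obtain a b v where cross: "cross3 a b \<noteq> 0" and v: "v \<in> W" "\<And>s t. mpoly_eval v (s *\<^sub>R a + t *\<^sub>R b) = s ^ 3"
    using exists_cube_on_line by blast
  obtain c A B C where "frame a b c A B C" using exists_frame cross by blast
  then interpret frame a b c A B C .
  have "b \<noteq> 0" using cross by auto
  then obtain v' where v': "v' \<in> W" "mpoly_eval v' b \<noteq> 0" using no_zero by blast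
  obtain P where P: "P \<in> bideg_le 3" "v = hom 3 P" using hom_surj W_forms[OF v(1)] by blast
  obtain Q where Q: "Q \<in> bideg_le 3" "v' = hom 3 Q" using hom_surj W_forms[OF v'(1)] by blast
  have "bicoeff P 3 0 * s ^ 3 + bicoeff P 2 1 * s\<^sup>2 * t + bicoeff P 1 2 * s * t\<^sup>2 + bicoeff P 0 3 * t ^ 3
      = 1 * s ^ 3 + 0 * s\<^sup>2 * t + 0 * s * t\<^sup>2 + 0 * t ^ 3" for s t
    using v(2)[of s t] eval_hom_infinity[of P s t] by (simp add: P)
  note Pc = cubic_coefficients_unique[OF this]
  define k where "k = bicoeff Q 0 3"
  have k: "k \<noteq> 0" using v'(2) eval_hom_infinity[of Q 0 1] by (simp add: Q k_def)
  \<comment> \<open>Eliminates x^3 from \<open>Q\<close> by means of \<open>P\<close>, whose leading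
    form is x^3, and normalises the coefficient of y^3 to 1.\<close>
  define R where "R = biC (1 / k) * (Q - biC (bicoeff Q 3 0) * P)"
  have R: "R \<in> bideg_le 3" unfolding R_def by (intro bideg_le_closed P Q)
  have Rc: "bicoeff R 3 0 = 0" "bicoeff R 0 3 = 1"
    using k Pc unfolding R_def bicoeff_simps by (simp_all add: k_def)
  define \<alpha> \<beta> where "\<alpha> = bicoeff R 1 2" and "\<beta> = bicoeff R 2 1"
  define r1 where "r1 = P - biX ^ 3"
  define r2 where "r2 = R - (biY ^ 3 + biC \<alpha> * (biX ^ 1 * biY ^ 2) + biC \<beta> * (biX ^ 2 * biY ^ 1))"
  have mono: "biX ^ 3 * biY ^ 0 \<in> bideg_le (Suc 2)" "biX ^ 0 * biY ^ 3 \<in> bideg_le (Suc 2)"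
    "biX ^ 1 * biY ^ 2 \<in> bideg_le (Suc 2)" "biX ^ 2 * biY ^ 1 \<in> bideg_le (Suc 2)"
    by (intro bideg_le_monomial; simp)+
  have r1': "r1 = P - biX ^ 3 * biY ^ 0"
    and r2': "r2 = R - biX ^ 0 * biY ^ 3 - biC \<alpha> * (biX ^ 1 * biY ^ 2) - biC \<beta> * (biX ^ 2 * biY ^ 1)"
    by (simp_all add: r1_def r2_def)
  have Suc2: "P \<in> bideg_le (Suc 2)" "R \<in> bideg_le (Suc 2)" using P R by simp_all
  have low: "p \<in> bideg_le 2" if "p \<in> bideg_le (Suc 2)" "bicoeff p 3 0 = 0" "bicoeff p 2 1 = 0" "bicoeff p 1 2 = 0" "bicoeff p 0 3 = 0" for p
    unfolding bideg_le_def mem_Collect_eq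
  proof (intro allI impI)
    fix i j :: nat assume "2 < i + j"
    then have "Suc 2 < i + j \<or> i = 3 \<and> j = 0 \<or> i = 2 \<and> j = 1 \<or> i = 1 \<and> j = 2 \<or> i = 0 \<and> j = 3" by linarith
    then show "bicoeff p i j = 0" using that by (auto simp: bideg_le_def)
  qed
  have r1: "r1 \<in> bideg_le 2"
  proof (rule low)
    show "r1 \<in> bideg_le (Suc 2)" unfolding r1' by (intro bideg_le_closed mono Suc2)
  qed (unfold r1' bicoeff_simps bicoeff_monomial, use Pc in simp_all)
  have r2: "r2 \<in> bideg_le 2"
  proof (rule low)
    show "r2 \<in> bideg_le (Suc 2)" unfolding r2' by (intro bideg_le_closed mono Suc2)
  qed (unfold r2' bicoeff_simps bicoeff_monomial, use Rc in \<open>simp_all add: \<alpha>_def \<beta>_def\<close>)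
  define L where "L p = l (hom 6 p)" for p
  have L_mult: "L (p * q) = l (hom 3 p * hom 3 q)" if "p \<in> bideg_le 3" "q \<in> bideg_le 3" for p q
    using hom_mult[OF that] by (simp add: L_def)
  have homR: "hom 3 R = mconst (1 / k) * (v' - mconst (bicoeff Q 3 0) * v)"
  proof -
    have "hom 3 (p - q) = hom 3 p - hom 3 q" for p q using hom_add[of 3 "p - q" q] by simp
    then show ?thesis unfolding R_def by (simp only: hom_scale P(2) Q(2))
  qed
  have RW: "hom 3 R \<in> W" unfolding homR by (intro W_closed v v')
  have qs: "biX ^ 3 + r1 = P" "biY ^ 3 + biC \<alpha> * (biX ^ 1 * biY ^ 2) + biC \<beta> * (biX ^ 2 * biY ^ 1) + r2 = R"
    by (simp_all add: r1_def r2_def)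
  have W0: "L (p * q) = 0" if "p \<in> bideg_le 3" "q \<in> bideg_le 3" "hom 3 q \<in> W" for p q
    using that hom_forms L_mult[OF that(1,2)] by (simp add: sextic_radical_def mult.commute)
  interpret complete_intersection L \<alpha> \<beta> r1 r2 "biX ^ 3 + r1"
    "biY ^ 3 + biC \<alpha> * (biX ^ 1 * biY ^ 2) + biC \<beta> * (biX ^ 2 * biY ^ 1) + r2"
  proof (unfold_locales, goal_cases)
    case (5 p) then show ?case unfolding qs using P(1) v(1) by (intro W0) (simp_all flip: P(2))
  next
    case (6 p) then show ?case unfolding qs using R RW by (intro W0)
  next
    case (7 p) then show ?case using L_mult psd hom_forms by simp
  qed (simp_all add: L_def hom_add hom_scale add scale r1 r2)
  obtain G where G: "G \<in> bideg_le 6" "g = hom 6 G" using hom_surj assms by blast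
  have "L G \<noteq> 0" using \<open>l g \<noteq> 0\<close> by (simp add: L_def G)
  have "\<exists>p. p \<in> bideg_le 3 \<and> hom 3 p = w i" for i using hom_surj W_forms w by metis
  then obtain p where p: "\<And>i. p i \<in> bideg_le 3" "\<And>i. hom 3 (p i) = w i" by metis
  \<comment> \<open>Three linear conditions on four members of \<open>W\<close>: no x^3, no y^3, and
    a vanishing extended value on the product with x^2 y^2.\<close>
  define \<phi> :: "3 \<Rightarrow> 4 \<Rightarrow> real" where "\<phi> k i =
    (if k = 1 then bicoeff (p i) 3 0 else if k = 2 then bicoeff (p i) 0 3 else ext (p i * (biX ^ 2 * biY ^ 2)))" for k i
  obtain e :: "real ^ 4" where e: "e \<noteq> 0" "\<And>k. (\<Sum>i\<in>UNIV. e $ i * \<phi> k i) = 0"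
    using underdetermined_system by blast
  define u where "u = (\<Sum>i\<in>UNIV. biC (e $ i) * p i)"
  have homu: "hom 3 u = (\<Sum>i\<in>UNIV. mconst (e $ i) * w i)" by (simp add: u_def hom_sum hom_scale p)
  have u1: "u \<in> bideg_le 3"
  proof -
    have sum: "sum g I \<in> bideg_le 3" if "\<And>i. i \<in> I \<Longrightarrow> g i \<in> bideg_le 3" for g and I :: "4 set"
      using that by (induction I rule: infinite_finite_induct) (auto intro: bideg_le_closed)
    show ?thesis unfolding u_def by (intro sum bideg_le_closed(4) p)
  qed
  have u2: "u \<noteq> 0" using homu independent e(1) by (auto simp: hom_0)
  have u3: "bicoeff u 3 0 = 0" "bicoeff u 0 3 = 0"
    using e(2)[of 1] e(2)[of 2] by (simp_all add: u_def bicoeff_sum \<phi>_def)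
  have "ext (u * (biX ^ 2 * biY ^ 2)) = (\<Sum>i\<in>UNIV. e $ i * ext (p i * (biX ^ 2 * biY ^ 2)))"
    unfolding u_def sum_distrib_right ext.sum mult.assoc[of "biC _"] ext.scale ..
  then have u4: "ext (u * (biX ^ 2 * biY ^ 2)) = 0" using e(2)[of 3] by (simp add: \<phi>_def)
  have "hom 3 u \<in> W" unfolding homu by (intro W_sum W_closed w)
  then have u5: "\<And>p. p \<in> bideg_le 3 \<Longrightarrow> L (u * p) = 0" using W0[OF _ u1] by (simp add: mult.commute)
  \<comment> \<open>The dehomogenised cubics are chosen pointwise; injectivity of
    \<open>hom 3\<close> in degree at most 3 makes the choice linear.\<close>
  have "\<forall>v. \<exists>p. p \<in> bideg_le 3 \<and> hom 3 p = cubic_form v" using hom_surj cubic_form_forms by metis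
  then obtain \<kappa> where \<kappa>: "\<And>v. \<kappa> v \<in> bideg_le 3" "\<And>v. hom 3 (\<kappa> v) = cubic_form v" by metis
  have inj: "p = q" if "p \<in> bideg_le 3" "q \<in> bideg_le 3" "hom 3 p = hom 3 q" for p q
  proof -
    have "hom 3 (p - q) = 0" using that hom_add[of 3 "p - q" q] by simp
    then show ?thesis using hom_eq_0D[OF bideg_le_closed(3)[OF that(1,2)]] by simp
  qed
  have \<kappa>_add: "\<kappa> (x + y) = \<kappa> x + \<kappa> y" for x y
    by (rule inj) (simp_all add: \<kappa> hom_add cubic_form_add bideg_le_closed)
  have \<kappa>_scale: "\<kappa> (r *\<^sub>R x) = biC r * \<kappa> x" for r x
    by (rule inj) (simp_all add: \<kappa> hom_scale cubic_form_scaleR bideg_le_closed)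
  have \<kappa>_surj: "\<exists>v. p = \<kappa> v" if "p \<in> bideg_le 3" for p
    by (rule exI[of _ "cubic_coeffs (hom 3 p)"], rule inj) (simp_all add: that \<kappa> cubic_form_coeffs hom_forms)
  obtain x y where xy: "\<And>v. v \<in> bideg_le 3 \<Longrightarrow> (\<And>p. p \<in> bideg_le 3 \<Longrightarrow> L (v * p) = 0) \<Longrightarrow> bieval v x y = 0"
    using common_real_zero[OF \<kappa>_add \<kappa>_scale \<kappa>_surj u1 u2 u3 u5 u4 G(1) \<open>L G \<noteq> 0\<close>] by blast
  define z where "z = x *\<^sub>R a + y *\<^sub>R b + c"
  have "z \<noteq> 0"
  proof
    assume "z = 0"
    then have "mpoly_eval C z = 0" using eval(3)[of 0 0 0] by simp
    then show False using eval(3)[of x y 1] by (simp add: z_def)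
  qed
  then obtain v0 where v0: "v0 \<in> W" "mpoly_eval v0 z \<noteq> 0" using no_zero by blast
  obtain V where V: "V \<in> bideg_le 3" "v0 = hom 3 V" using hom_surj W_forms[OF v0(1)] by blast
  have "L (V * p) = 0" if "p \<in> bideg_le 3" for p
    using W0[OF that V(1)] v0(1) by (simp add: V(2) mult.commute)
  then have "bieval V x y = 0" using xy V(1) by blast
  then show False using v0(2) eval_hom_affine[OF V(1), of x y] by (simp add: V(2) z_def)
qed

end

section \<open>Sums of three squares and rational approximation\<close>

text \<open>
  Otherwise the pair of cubics, being odd, would be a map of the sphere to \<open>\<complex> - {0}\<close> that commutes with
  the antipode; a continuous logarithm on the upper hemisphere contradicts this on the equator.
\<close>

lemma cubics_common_real_zero:
  fixes g1 g2 :: "(3, real) mpoly"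
  assumes "g1 \<in> forms 3" "g2 \<in> forms 3"
  shows "\<exists>z. z \<noteq> 0 \<and> mpoly_eval g1 z = 0 \<and> mpoly_eval g2 z = 0"
proof (rule ccontr)
  assume no_zero: "\<not> ?thesis"
  \<comment> \<open>Lifts the closed unit disc to the upper hemisphere; the boundary circle becomes
    the equator.\<close>
  define P :: "complex \<Rightarrow> real ^ 3" where
    "P w = (\<chi> i. if i = 1 then Re w else if i = 2 then Im w else sqrt (1 - (norm w)\<^sup>2))" for w
  define F where "F w = Complex (mpoly_eval g1 (P w)) (mpoly_eval g2 (P w))" for w
  have "P w \<noteq> 0" for w
  proof
    assume "P w = 0"
    then have "Re w = 0" "Im w = 0" "sqrt (1 - (norm w)\<^sup>2) = 0"
      by (simp_all add: P_def vec_eq_iff forall_3)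
    then show False by (simp add: complex_eq_iff cmod_def)
  qed
  then have "F w \<noteq> 0" for w using no_zero by (auto simp: F_def complex_eq_iff)
  moreover have "continuous_on (cball 0 1) P"
  proof -
    have "continuous_on (cball 0 1) (\<lambda>w. if i = 1 then Re w else if i = 2 then Im w else sqrt (1 - (norm w)\<^sup>2))" for i :: 3
      by (cases "i = 1"; cases "i = 2") (auto intro!: continuous_intros)
    then show ?thesis unfolding P_def by (rule continuous_on_vec_lambda)
  qed
  then have "continuous_on (cball 0 1) F"
    unfolding F_def Complex_eq by (intro continuous_intros)
  ultimately obtain h where h: "continuous_on (cball 0 1) h" "\<And>w. w \<in> cball 0 1 \<Longrightarrow> F w = exp (h w)"
    using continuous_logarithm_on_cball[of 0 1 F] by blast
  have odd: "F (- w) = - F w" if "w \<in> sphere 0 1" for w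
  proof -
    have "P (- w) = (- 1) *\<^sub>R P w" using that by (simp add: P_def vec_eq_iff)
    then show ?thesis
      by (simp only: F_def mpoly_eval_scaleR[OF assms(1)] mpoly_eval_scaleR[OF assms(2)]) (simp add: complex_eq_iff)
  qed
  \<comment> \<open>A continuous square root of F(-w) / F(w) = -1 on the circle. It takes the values
    \<open>\<i>\<close> and \<open>- \<i>\<close> only, so it is constant by connectedness and e(1)
    e(-1) would be -1; but e(-w) e(w) = 1.\<close>
  define e where "e w = exp ((h (- w) - h w) / 2)" for w
  have e_sq: "(e w)\<^sup>2 = - 1" if "w \<in> sphere 0 1" for w
  proof -
    have "(e w)\<^sup>2 = exp (2 * ((h (- w) - h w) / 2))" by (simp only: e_def exp_double)
    also have "2 * ((h (- w) - h w) / 2) = h (- w) - h w" by simp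
    also have "exp (h (- w) - h w) = exp (h (- w)) / exp (h w)" by (rule exp_diff)
    also have "\<dots> = F (- w) / F w" using h(2)[of w] h(2)[of "- w"] that by simp
    also have "\<dots> = - 1" using odd[OF that] \<open>F w \<noteq> 0\<close> by simp
    finally show ?thesis .
  qed
  have "continuous_on (sphere 0 1) (\<lambda>w. h (- w))"
    by (rule continuous_on_compose2[OF h(1)]) (auto intro: continuous_intros)
  moreover have "continuous_on (sphere 0 1) h" by (rule continuous_on_subset[OF h(1)]) auto
  ultimately have "continuous_on (sphere 0 1) e" unfolding e_def by (intro continuous_intros) auto
  moreover have "finite (e ` sphere 0 1)"
  proof (rule finite_subset)
    show "e ` sphere 0 1 \<subseteq> {\<i>, - \<i>}"
      using e_sq power2_eq_iff[of _ \<i>] by fastforce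
  qed simp
  moreover have "connected (sphere (0::complex) 1)" by (rule connected_sphere) simp
  ultimately have "e constant_on sphere 0 1" using continuous_finite_range_constant by blast
  then have "e 1 = e (- 1)" unfolding constant_on_def by force
  moreover have "(h 1 - h (- 1)) / 2 + (h (- 1) - h 1) / 2 = 0" by (simp add: field_simps)
  then have "e (- 1) * e 1 = 1" unfolding e_def minus_minus exp_add[symmetric] by simp
  ultimately show False using e_sq[of 1] by (simp add: power2_eq_square)
qed

text \<open>
  Induction on \<open>S\<close>: a new coordinate either is a rational affine combination of the previous ones,
  which determines its approximation, or occurs in no rational relation with them.
\<close>

lemma rational_approximation:
  fixes x :: "'i \<Rightarrow> real"
  assumes "finite S" "0 < \<delta>"
  shows "\<exists>x'. (\<forall>i\<in>S. x' i \<in> \<rat> \<and> \<bar>x' i - x i\<bar> < \<delta>) \<and>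
    (\<forall>e e0. (\<forall>i\<in>S. e i \<in> \<rat>) \<and> e0 \<in> \<rat> \<and> (\<Sum>i\<in>S. e i * x i) = e0 \<longrightarrow> (\<Sum>i\<in>S. e i * x' i) = e0)"
  using assms
proof (induction S arbitrary: \<delta>)
  case (insert s S)
  show ?case
  proof (cases "\<exists>d d0. (\<forall>i\<in>S. d i \<in> \<rat>) \<and> d0 \<in> \<rat> \<and> x s = (\<Sum>i\<in>S. d i * x i) + d0")
    case True
    then obtain d d0 where d: "\<forall>i\<in>S. d i \<in> \<rat>" "d0 \<in> \<rat>" "x s = (\<Sum>i\<in>S. d i * x i) + d0" by blast
    \<comment> \<open>Errors below \<delta> / D in the old coordinates produce an error below
      \<delta> in the new one.\<close>
    define D where "D = 1 + (\<Sum>i\<in>S. \<bar>d i\<bar>)"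
    have D: "D \<ge> 1" by (simp add: D_def sum_nonneg)
    then obtain x' where x': "\<And>i. i \<in> S \<Longrightarrow> x' i \<in> \<rat> \<and> \<bar>x' i - x i\<bar> < \<delta> / D"
      and rel: "\<And>e e0. (\<forall>i\<in>S. e i \<in> \<rat>) \<Longrightarrow> e0 \<in> \<rat> \<Longrightarrow> (\<Sum>i\<in>S. e i * x i) = e0 \<Longrightarrow> (\<Sum>i\<in>S. e i * x' i) = e0"
      using insert.IH[of "\<delta> / D"] insert.prems by auto
    define y where "y = (\<Sum>i\<in>S. d i * x' i) + d0"
    define x'' where "x'' = x'(s := y)"
    have same: "x'' i = x' i" if "i \<in> S" for i using that insert.hyps by (auto simp: x''_def)
    have "y \<in> \<rat>" unfolding y_def using d x' by (intro Rats_add Rats_sum Rats_mult) auto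
    moreover have "\<bar>y - x s\<bar> < \<delta>"
    proof -
      have "\<bar>y - x s\<bar> = \<bar>\<Sum>i\<in>S. d i * (x' i - x i)\<bar>"
        by (simp add: y_def d(3) right_diff_distrib sum_subtractf)
      also have "\<dots> \<le> (\<Sum>i\<in>S. \<bar>d i\<bar> * (\<delta> / D))"
      proof (intro order.trans[OF sum_abs] sum_mono)
        fix i assume "i \<in> S"
        then have "\<bar>x' i - x i\<bar> \<le> \<delta> / D" using x' by fastforce
        then show "\<bar>d i * (x' i - x i)\<bar> \<le> \<bar>d i\<bar> * (\<delta> / D)"
          unfolding abs_mult by (rule mult_left_mono) simp
      qed
      also have "\<dots> = (D - 1) * (\<delta> / D)" by (simp only: sum_distrib_right[symmetric]) (simp add: D_def)
      also have "\<dots> < D * (\<delta> / D)" using D insert.prems by (intro mult_strict_right_mono) auto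
      also have "\<dots> = \<delta>" using D by simp
      finally show ?thesis .
    qed
    moreover have "\<bar>x' i - x i\<bar> < \<delta>" if "i \<in> S" for i
    proof -
      have "\<delta> / D \<le> \<delta>" using D insert.prems by (simp add: divide_le_eq)
      then show ?thesis using x'[OF that] by linarith
    qed
    ultimately have "\<forall>i\<in>insert s S. x'' i \<in> \<rat> \<and> \<bar>x'' i - x i\<bar> < \<delta>"
      using x' same by (auto simp: x''_def)
    moreover have "(\<Sum>i\<in>insert s S. e i * x'' i) = e0"
      if e: "\<forall>i\<in>insert s S. e i \<in> \<rat>" "e0 \<in> \<rat>" "(\<Sum>i\<in>insert s S. e i * x i) = e0" for e e0
    proof -
      have "(\<Sum>i\<in>S. (e i + e s * d i) * x i) = e0 - e s * d0"
        using e(3) insert.hyps d(3) by (simp add: distrib_right sum.distrib sum_distrib_left algebra_simps)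
      moreover have "\<forall>i\<in>S. e i + e s * d i \<in> \<rat>" "e0 - e s * d0 \<in> \<rat>" using e d by auto
      ultimately have "(\<Sum>i\<in>S. (e i + e s * d i) * x' i) = e0 - e s * d0" using rel[of "\<lambda>i. e i + e s * d i"] by blast
      moreover have "(\<Sum>i\<in>S. e i * x'' i) = (\<Sum>i\<in>S. e i * x' i)" using same by (intro sum.cong) auto
      ultimately show ?thesis
        using insert.hyps by (simp add: x''_def y_def distrib_right sum.distrib sum_distrib_left algebra_simps)
    qed
    ultimately show ?thesis by blast
  next
    case False
    obtain x' where x': "\<And>i. i \<in> S \<Longrightarrow> x' i \<in> \<rat> \<and> \<bar>x' i - x i\<bar> < \<delta>"
      and rel: "\<And>e e0. (\<forall>i\<in>S. e i \<in> \<rat>) \<Longrightarrow> e0 \<in> \<rat> \<Longrightarrow> (\<Sum>i\<in>S. e i * x i) = e0 \<Longrightarrow> (\<Sum>i\<in>S. e i * x' i) = e0"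
      using insert.IH[of "\<delta>"] insert.prems by blast
    obtain y where y: "y \<in> \<rat>" "x s < y" "y < x s + \<delta>"
      using Rats_dense_in_real[of "x s" "x s + \<delta>"] insert.prems by auto
    define x'' where "x'' = x'(s := y)"
    have same: "x'' i = x' i" if "i \<in> S" for i using that insert.hyps by (auto simp: x''_def)
    have "\<forall>i\<in>insert s S. x'' i \<in> \<rat> \<and> \<bar>x'' i - x i\<bar> < \<delta>"
      using x' y same by (auto simp: x''_def)
    moreover have "(\<Sum>i\<in>insert s S. e i * x'' i) = e0"
      if e: "\<forall>i\<in>insert s S. e i \<in> \<rat>" "e0 \<in> \<rat>" "(\<Sum>i\<in>insert s S. e i * x i) = e0" for e e0
    proof -
      have eq: "e s * x s + (\<Sum>i\<in>S. e i * x i) = e0" using e(3) insert.hyps by simp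
      have "e s = 0"
      proof (rule ccontr)
        assume "e s \<noteq> 0"
        then have "x s = (\<Sum>i\<in>S. (- e i / e s) * x i) + e0 / e s"
          using eq by (simp add: field_simps sum_negf flip: sum_divide_distrib)
        moreover have "\<forall>i\<in>S. - e i / e s \<in> \<rat>" "e0 / e s \<in> \<rat>" using e by auto
        ultimately have "\<exists>d d0. (\<forall>i\<in>S. d i \<in> \<rat>) \<and> d0 \<in> \<rat> \<and> x s = (\<Sum>i\<in>S. d i * x i) + d0"
          by (intro exI[of _ "\<lambda>i. - e i / e s"] exI[of _ "e0 / e s"] conjI)
        with False show False by (rule notE)
      qed
      moreover have "(\<Sum>i\<in>S. e i * x'' i) = (\<Sum>i\<in>S. e i * x' i)" using same by (intro sum.cong) auto
      ultimately show ?thesis using eq rel[of e e0] e insert.hyps by simp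
    qed
    ultimately show ?thesis by blast
  qed
qed auto

section \<open>Shortening sums of squares by linear relations\<close>

lemma absorb_square:
  fixes q1 q2 q3 :: "('x::finite, real) mpoly"
  assumes "s = mconst a1 * q1 + mconst a2 * q2 + mconst a3 * q3"
  obtains k where "q1\<^sup>2 + q2\<^sup>2 + q3\<^sup>2 + s\<^sup>2 =
    (q1 + mconst (k * a1) * s)\<^sup>2 + (q2 + mconst (k * a2) * s)\<^sup>2 + (q3 + mconst (k * a3) * s)\<^sup>2"
proof -
  define n where "n = a1 * a1 + a2 * a2 + a3 * a3"
  have n: "0 \<le> n" by (simp add: n_def)
  \<comment> \<open>The positive root of n k^2 + 2 k = 1, written without dividing by
    \<open>n\<close>, which may be 0. Equivalently, 1 + k a a^T is the square root of 1 + a a^T for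
    the vector a = (a1, a2, a3).\<close>
  define k where "k = 1 / (1 + sqrt (1 + n))"
  define r where "r = sqrt (1 + n)"
  have r: "r \<ge> 1" "r * r = 1 + n" using n by (simp_all add: r_def)
  have "k * (1 + r) = 1" using r(1) by (simp add: k_def flip: r_def)
  moreover have "n = r * r - 1" using r(2) by simp
  ultimately have "k + k + k * k * (a1 * a1 + a2 * a2 + a3 * a3) = 1" unfolding n_def by algebra
  then have "mconst (k + k + k * k * (a1 * a1 + a2 * a2 + a3 * a3)) = (1 :: ('x, real) mpoly)" by simp
  then have K: "mconst k + mconst k + mconst k * mconst k * (mconst a1 * mconst a1 + mconst a2 * mconst a2 + mconst a3 * mconst a3) = (1 :: ('x, real) mpoly)"
    unfolding mconst_arith .
  have "(q1 + mconst (k * a1) * s)\<^sup>2 + (q2 + mconst (k * a2) * s)\<^sup>2 + (q3 + mconst (k * a3) * s)\<^sup>2 =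
    q1\<^sup>2 + q2\<^sup>2 + q3\<^sup>2 + (mconst k + mconst k) * s * (mconst a1 * q1 + mconst a2 * q2 + mconst a3 * q3)
    + mconst k * mconst k * (mconst a1 * mconst a1 + mconst a2 * mconst a2 + mconst a3 * mconst a3) * s\<^sup>2"
    by (simp add: mconst_arith power2_eq_square algebra_simps)
  also have "\<dots> = q1\<^sup>2 + q2\<^sup>2 + q3\<^sup>2 + (mconst k + mconst k + mconst k * mconst k * (mconst a1 * mconst a1 + mconst a2 * mconst a2 + mconst a3 * mconst a3)) * s\<^sup>2"
    unfolding assms[symmetric] by (simp add: power2_eq_square algebra_simps)
  finally show thesis using that[of k] unfolding K by simp
qed

text \<open>A fourth square yields a dependent quadruple in \<open>U\<close>. Any member with
  nonzero coefficient is a combination of the other three and can be absorbed into their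
  squares.\<close>

lemma sum_list_squares_three:
  fixes U :: "('x::finite, real) mpoly set"
  assumes closed: "0 \<in> U" "\<And>p q. p \<in> U \<Longrightarrow> q \<in> U \<Longrightarrow> p + q \<in> U" "\<And>r p. p \<in> U \<Longrightarrow> mconst r * p \<in> U"
    and dependent: "\<And>w :: 4 \<Rightarrow> ('x, real) mpoly. (\<And>i. w i \<in> U) \<Longrightarrow> \<exists>c. c \<noteq> 0 \<and> (\<Sum>i\<in>UNIV. mconst (c $ i) * w i) = 0"
    and "set qs \<subseteq> U"
  shows "\<exists>q1\<in>U. \<exists>q2\<in>U. \<exists>q3\<in>U. (\<Sum>q\<leftarrow>qs. q\<^sup>2) = q1\<^sup>2 + q2\<^sup>2 + q3\<^sup>2"
  using assms(5)
proof (induction qs)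
  case Nil
  then show ?case using closed(1) by (intro bexI[of _ 0]) auto
next
  case (Cons p qs)
  then obtain q1 q2 q3 where q: "q1 \<in> U" "q2 \<in> U" "q3 \<in> U" "(\<Sum>q\<leftarrow>qs. q\<^sup>2) = q1\<^sup>2 + q2\<^sup>2 + q3\<^sup>2" by auto
  have p: "p \<in> U" using Cons.prems by simp
  define w :: "4 \<Rightarrow> ('x, real) mpoly" where "w i = (if i = 1 then q1 else if i = 2 then q2 else if i = 3 then q3 else p)" for i
  have "w i \<in> U" for i using q p by (simp add: w_def)
  then obtain c :: "real ^ 4" where c: "c \<noteq> 0" "(\<Sum>i\<in>UNIV. mconst (c $ i) * w i) = 0"
    using dependent[of w] by blast
  have rel: "mconst (c $ 1) * q1 + mconst (c $ 2) * q2 + mconst (c $ 3) * q3 + mconst (c $ 4) * p = 0"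
    using c(2) by (simp add: sum_4 w_def add.assoc)
  have step: ?case
    if "(\<Sum>q\<leftarrow>p # qs. q\<^sup>2) = v1\<^sup>2 + v2\<^sup>2 + v3\<^sup>2 + s\<^sup>2" "v1 \<in> U" "v2 \<in> U" "v3 \<in> U" "s \<in> U" "e \<noteq> 0"
      "mconst e * s + mconst e1 * v1 + mconst e2 * v2 + mconst e3 * v3 = 0" for v1 v2 v3 s e e1 e2 e3
  proof -
    have "mconst (- 1 / e) * mconst e = (- 1 :: ('x, real) mpoly)" using \<open>e \<noteq> 0\<close> by (simp add: mconst_arith flip: mconst_arith(2))
    moreover have "mconst (- 1 / e) * (mconst e * s + mconst e1 * v1 + mconst e2 * v2 + mconst e3 * v3) = 0"
      using that(7) by simp
    ultimately have "- s + mconst (- 1 / e) * mconst e1 * v1 + mconst (- 1 / e) * mconst e2 * v2 + mconst (- 1 / e) * mconst e3 * v3 = 0"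
      by (simp add: distrib_left flip: mult.assoc)
    then have "s = mconst (- 1 / e * e1) * v1 + mconst (- 1 / e * e2) * v2 + mconst (- 1 / e * e3) * v3"
      unfolding mconst_arith(2) by (simp add: algebra_simps)
    then obtain k where k: "v1\<^sup>2 + v2\<^sup>2 + v3\<^sup>2 + s\<^sup>2 = (v1 + mconst (k * (- 1 / e * e1)) * s)\<^sup>2
        + (v2 + mconst (k * (- 1 / e * e2)) * s)\<^sup>2 + (v3 + mconst (k * (- 1 / e * e3)) * s)\<^sup>2"
      by (rule absorb_square)
    have "v1 + mconst a * s \<in> U" "v2 + mconst a * s \<in> U" "v3 + mconst a * s \<in> U" for a
      by (intro closed that)+
    then show ?thesis unfolding that(1) k by blast
  qed
  consider "c $ 1 \<noteq> 0" | "c $ 2 \<noteq> 0" | "c $ 3 \<noteq> 0" | "c $ 4 \<noteq> 0"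
    using c(1) by (auto simp: vec_eq_iff forall_4)
  then show ?case
  proof cases
    case 1
    then show ?thesis using rel q p by (intro step[of q2 q3 p q1 "c $ 1" "c $ 2" "c $ 3" "c $ 4"]) (simp_all add: add_ac)
  next
    case 2
    then show ?thesis using rel q p by (intro step[of q1 q3 p q2 "c $ 2" "c $ 1" "c $ 3" "c $ 4"]) (simp_all add: add_ac)
  next
    case 3
    then show ?thesis using rel q p by (intro step[of q1 q2 p q3 "c $ 3" "c $ 1" "c $ 2" "c $ 4"]) (simp_all add: add_ac)
  next
    case 4
    then show ?thesis using rel q p by (intro step[of q1 q2 q3 p "c $ 4" "c $ 1" "c $ 2" "c $ 3"]) (simp_all add: add_ac)
  qed
qed

section \<open>Rational sums of squares\<close>

lemma rational_mpolys_closed: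
  fixes p q :: "('x, real) mpoly"
  shows "0 \<in> rational_mpolys"
    "p \<in> rational_mpolys \<Longrightarrow> q \<in> rational_mpolys \<Longrightarrow> p + q \<in> rational_mpolys"
    "p \<in> rational_mpolys \<Longrightarrow> q \<in> rational_mpolys \<Longrightarrow> p - q \<in> rational_mpolys"
    "r \<in> \<rat> \<Longrightarrow> p \<in> rational_mpolys \<Longrightarrow> mconst r * p \<in> rational_mpolys"
    "r \<in> \<rat> \<Longrightarrow> Poly_Mapping.single m r \<in> rational_mpolys"
  by (simp_all add: rational_mpolys_def lookup_add lookup_minus lookup_mconst_mult lookup_single when_def)

lemma rational_mpolys_sum:
  "(\<And>i. i \<in> I \<Longrightarrow> g i \<in> rational_mpolys) \<Longrightarrow> (\<Sum>i\<in>I. g i :: ('x, real) mpoly) \<in> rational_mpolys"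
  by (induction I rule: infinite_finite_induct) (auto intro: rational_mpolys_closed)

lemma rational_mpolys_mult:
  fixes p q :: "('x, real) mpoly"
  assumes "p \<in> rational_mpolys" "q \<in> rational_mpolys"
  shows "p * q \<in> rational_mpolys"
proof -
  have "p * q = (\<Sum>m\<in>Poly_Mapping.keys p. \<Sum>n\<in>Poly_Mapping.keys q.
      Poly_Mapping.single m (Poly_Mapping.lookup p m) * Poly_Mapping.single n (Poly_Mapping.lookup q n))"
    by (subst mpoly_sum_single[of p], subst mpoly_sum_single[of q]) (rule sum_product)
  also have "\<dots> \<in> rational_mpolys"
    unfolding mult_single by (intro rational_mpolys_sum rational_mpolys_closed(5))
      (use assms in \<open>simp add: rational_mpolys_def\<close>)
  finally show ?thesis .
qed

abbreviation (input) "rational_sos \<equiv> sums_of_squares rational_mpolys :: ('x::finite, real) mpoly set"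

lemma rational_sos_closed:
  fixes p q :: "('x::finite, real) mpoly"
  shows "0 \<in> rational_sos" "p \<in> rational_sos \<Longrightarrow> q \<in> rational_sos \<Longrightarrow> p + q \<in> rational_sos"
    "p \<in> rational_mpolys \<Longrightarrow> p\<^sup>2 \<in> rational_sos"
proof -
  show "0 \<in> rational_sos" unfolding sums_of_squares_def by (force intro: exI[of _ "[]"])
  show "p\<^sup>2 \<in> rational_sos" if "p \<in> rational_mpolys"
    unfolding sums_of_squares_def using that by (force intro: exI[of _ "[p]"])
  assume "p \<in> rational_sos" "q \<in> rational_sos"
  then obtain ps qs where "set ps \<subseteq> rational_mpolys" "p = (\<Sum>q\<leftarrow>ps. q\<^sup>2)"
    "set qs \<subseteq> rational_mpolys" "q = (\<Sum>q\<leftarrow>qs. q\<^sup>2)"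
    by (auto simp: sums_of_squares_def)
  then show "p + q \<in> rational_sos"
    unfolding sums_of_squares_def by (force intro: exI[of _ "ps @ qs"])
qed

lemma rational_sos_sum:
  "(\<And>i. i \<in> I \<Longrightarrow> g i \<in> rational_sos) \<Longrightarrow> (\<Sum>i\<in>I. g i) \<in> rational_sos"
  by (induction I rule: infinite_finite_induct) (auto intro: rational_sos_closed)

text \<open>With r = m / n one has r p^2 = m n (p / n)^2, a sum of m n equal rational
  squares.\<close>

lemma rational_sos_scaled_square:
  fixes p :: "('x::finite, real) mpoly"
  assumes "r \<in> \<rat>" "0 \<le> r" "p \<in> rational_mpolys"
  shows "mconst r * p\<^sup>2 \<in> rational_sos"
proof -
  obtain m n where mn: "n \<noteq> 0" "\<bar>r\<bar> = real m / real n" using Rats_abs_nat_div_natE[OF assms(1)] by metis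
  have "r = real (m * n) * ((1 / real n) * (1 / real n))" using mn assms(2) by (simp add: field_simps)
  then have "mconst r * p\<^sup>2 = mconst (real (m * n)) * (mconst (1 / real n) * p)\<^sup>2"
    by (simp only: mconst_arith power2_eq_square mult_ac)
  moreover have "mconst (real k) = (of_nat k :: ('x, real) mpoly)" for k
    by (induction k) (simp_all add: mconst_arith)
  ultimately have "mconst r * p\<^sup>2 = (\<Sum>i\<in>{..<m * n}. (mconst (1 / real n) * p)\<^sup>2)"
    by (simp only: sum_constant card_lessThan)
  also have "\<dots> \<in> rational_sos"
    by (intro rational_sos_sum rational_sos_closed(3) rational_mpolys_closed(4) assms(3)) simp
  finally show ?thesis .
qed

text \<open>A term h u v equals |h| / 2 times (u + v)^2 - u^2 - v^2 or (u - v)^2 - u^2 - v^2,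
  according to the sign of h. This takes no square roots, so it stays rational, and the diagonal
  \<epsilon> pays for the subtracted squares.\<close>

lemma rational_sos_diagonally_dominant:
  fixes w :: "'n::finite \<Rightarrow> ('x::finite, real) mpoly"
  assumes w: "\<And>i. w i \<in> rational_mpolys" and G: "\<And>i j. G i j \<in> \<rat>" and "\<epsilon> \<in> \<rat>"
    and near: "\<And>i j. \<bar>G i j - (if i = j then \<epsilon> else 0)\<bar> \<le> \<epsilon> / real CARD('n)"
  shows "(\<Sum>i\<in>UNIV. \<Sum>j\<in>UNIV. mconst (G i j) * (w i * w j)) \<in> rational_sos"
proof -
  define h where "h i j = G i j - (if i = j then \<epsilon> else 0)" for i j
  define \<sigma> :: "'n \<Rightarrow> 'n \<Rightarrow> real" where "\<sigma> i j = (if h i j \<ge> 0 then 1 else - 1)" for i j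
  \<comment> \<open>As \<open>G\<close> need not be symmetric, the square of \<open>w i\<close> is
    charged by row i and by column i, at most \<epsilon> / 2 each.\<close>
  define r where "r i = \<epsilon> - (\<Sum>j\<in>UNIV. \<bar>h i j\<bar> / 2) - (\<Sum>j\<in>UNIV. \<bar>h j i\<bar> / 2)" for i
  have h: "h i j \<in> \<rat>" for i j using G \<open>\<epsilon> \<in> \<rat>\<close> by (simp add: h_def)
  have sum_le: "(\<Sum>j\<in>UNIV. g j / 2) \<le> \<epsilon> / 2" if "\<And>j. g j \<le> \<epsilon> / real CARD('n)" for g :: "'n \<Rightarrow> real"
  proof -
    have "(\<Sum>j\<in>UNIV. g j / 2) \<le> (\<Sum>j\<in>(UNIV :: 'n set). \<epsilon> / real CARD('n) / 2)"
      using that by (intro sum_mono) (simp add: divide_right_mono)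
    then show ?thesis by simp
  qed
  have r: "0 \<le> r i" "r i \<in> \<rat>" for i
  proof -
    show "0 \<le> r i" using sum_le[of "\<lambda>j. \<bar>h i j\<bar>"] sum_le[of "\<lambda>j. \<bar>h j i\<bar>"] near by (simp add: r_def h_def)
    show "r i \<in> \<rat>" unfolding r_def using h \<open>\<epsilon> \<in> \<rat>\<close> by (auto intro!: Rats_diff Rats_sum Rats_divide)
  qed
  have polarize: "H * (u + s * v)\<^sup>2 - H * u\<^sup>2 - H * v\<^sup>2 = (H + H) * s * (u * v)"
    if "s * s = 1" for s H u v :: "('x, real) mpoly"
  proof -
    have "H * (u + s * v)\<^sup>2 = H * u\<^sup>2 + (H + H) * s * (u * v) + H * ((s * s) * v\<^sup>2)"
      by (simp add: power2_eq_square algebra_simps)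
    then show ?thesis by (simp add: that)
  qed
  have expand: "mconst (G i j) * (w i * w j) = mconst (\<bar>h i j\<bar> / 2) * (w i + mconst (\<sigma> i j) * w j)\<^sup>2
      - mconst (\<bar>h i j\<bar> / 2) * (w i)\<^sup>2 - mconst (\<bar>h i j\<bar> / 2) * (w j)\<^sup>2 + (if i = j then mconst \<epsilon> * (w i)\<^sup>2 else 0)" for i j
  proof -
    have "mconst (\<sigma> i j) * mconst (\<sigma> i j) = (1 :: ('x, real) mpoly)"
      by (simp add: \<sigma>_def mconst_arith(4))
    moreover have "mconst (\<bar>h i j\<bar> / 2) + mconst (\<bar>h i j\<bar> / 2) = (mconst \<bar>h i j\<bar> :: ('x, real) mpoly)"
      by (simp flip: mconst_arith)
    ultimately have "mconst (\<bar>h i j\<bar> / 2) * (w i + mconst (\<sigma> i j) * w j)\<^sup>2 - mconst (\<bar>h i j\<bar> / 2) * (w i)\<^sup>2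
        - mconst (\<bar>h i j\<bar> / 2) * (w j)\<^sup>2 = mconst \<bar>h i j\<bar> * mconst (\<sigma> i j) * (w i * w j)"
      using polarize by metis
    also have "mconst \<bar>h i j\<bar> * mconst (\<sigma> i j) = (mconst (h i j) :: ('x, real) mpoly)"
      by (simp add: \<sigma>_def flip: mconst_arith)
    finally have main: "mconst (\<bar>h i j\<bar> / 2) * (w i + mconst (\<sigma> i j) * w j)\<^sup>2 - mconst (\<bar>h i j\<bar> / 2) * (w i)\<^sup>2
        - mconst (\<bar>h i j\<bar> / 2) * (w j)\<^sup>2 = mconst (h i j) * (w i * w j)" .
    show ?thesis unfolding main
      by (cases "i = j") (simp_all add: h_def mconst_arith power2_eq_square left_diff_distrib)
  qed
  have "(\<Sum>i\<in>UNIV. \<Sum>j\<in>UNIV. mconst (G i j) * (w i * w j)) =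
      (\<Sum>i\<in>UNIV. \<Sum>j\<in>UNIV. mconst (\<bar>h i j\<bar> / 2) * (w i + mconst (\<sigma> i j) * w j)\<^sup>2)
      - (\<Sum>i\<in>UNIV. \<Sum>j\<in>UNIV. mconst (\<bar>h i j\<bar> / 2) * (w i)\<^sup>2) - (\<Sum>i\<in>UNIV. \<Sum>j\<in>UNIV. mconst (\<bar>h j i\<bar> / 2) * (w i)\<^sup>2)
      + (\<Sum>i\<in>UNIV. mconst \<epsilon> * (w i)\<^sup>2)"
  proof -
    have "(\<Sum>i\<in>UNIV. \<Sum>j\<in>UNIV. mconst (\<bar>h i j\<bar> / 2) * (w j)\<^sup>2) = (\<Sum>i\<in>UNIV. \<Sum>j\<in>UNIV. mconst (\<bar>h j i\<bar> / 2) * (w i)\<^sup>2)"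
      by (rule sum.swap)
    then show ?thesis unfolding expand sum.distrib sum_subtractf by simp
  qed
  also have "\<dots> = (\<Sum>i\<in>UNIV. \<Sum>j\<in>UNIV. mconst (\<bar>h i j\<bar> / 2) * (w i + mconst (\<sigma> i j) * w j)\<^sup>2) + (\<Sum>i\<in>UNIV. mconst (r i) * (w i)\<^sup>2)"
  proof -
    have msum: "mconst (\<Sum>j\<in>A. g j) = (\<Sum>j\<in>A. mconst (g j) :: ('x, real) mpoly)" for g :: "'n \<Rightarrow> real" and A
      by (induction A rule: infinite_finite_induct) (simp_all add: mconst_arith)
    have "mconst (r i) * (w i)\<^sup>2 = mconst \<epsilon> * (w i)\<^sup>2 - (\<Sum>j\<in>UNIV. mconst (\<bar>h i j\<bar> / 2) * (w i)\<^sup>2)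
        - (\<Sum>j\<in>UNIV. mconst (\<bar>h j i\<bar> / 2) * (w i)\<^sup>2)" for i
      unfolding r_def mconst_arith(3) msum left_diff_distrib sum_distrib_right ..
    then show ?thesis by (simp add: sum_subtractf)
  qed
  also have "\<dots> \<in> rational_sos"
  proof (intro rational_sos_closed(2) rational_sos_sum rational_sos_scaled_square r w)
    fix i j
    show "\<bar>h i j\<bar> / 2 \<in> \<rat>" "0 \<le> \<bar>h i j\<bar> / 2" using h by auto
    show "w i + mconst (\<sigma> i j) * w j \<in> rational_mpolys"
      using w by (intro rational_mpolys_closed) (auto simp: \<sigma>_def)
  qed
  finally show ?thesis .
qed

text \<open>Comparing coefficients turns \<open>gram\<close> into rational linear equations for the
  entries of \<open>G\<close>, which a nearby rational matrix still satisfies. Half of the deviation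
  allowed by diagonal dominance is reserved for this approximation.\<close>

lemma rational_sos_near_scalar_gram:
  fixes w :: "'n::finite \<Rightarrow> ('x::finite, real) mpoly"
  assumes w: "\<And>i. w i \<in> rational_mpolys" and g: "g \<in> rational_mpolys" and \<epsilon>: "\<epsilon> \<in> \<rat>" "0 < \<epsilon>"
    and gram: "g = (\<Sum>i\<in>UNIV. \<Sum>j\<in>UNIV. mconst (G i j) * (w i * w j))"
    and near: "\<And>i j. \<bar>G i j - (if i = j then \<epsilon> else 0)\<bar> \<le> \<epsilon> / (2 * real CARD('n))"
  shows "g \<in> rational_sos"
proof -
  define \<delta> where "\<delta> = \<epsilon> / (2 * real CARD('n))"
  have "0 < \<delta>" using \<epsilon> by (simp add: \<delta>_def)
  obtain x :: "'n \<times> 'n \<Rightarrow> real" where x: "\<forall>i\<in>UNIV. x i \<in> \<rat> \<and> \<bar>x i - case_prod G i\<bar> < \<delta>"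
    and rel: "\<forall>e e0. (\<forall>i\<in>UNIV. e i \<in> \<rat>) \<and> e0 \<in> \<rat> \<and> (\<Sum>i\<in>UNIV. e i * case_prod G i) = e0 \<longrightarrow> (\<Sum>i\<in>UNIV. e i * x i) = e0"
    using rational_approximation[OF finite \<open>0 < \<delta>\<close>, of UNIV "case_prod G"] by blast
  have "g = (\<Sum>i\<in>UNIV. \<Sum>j\<in>UNIV. mconst (x (i, j)) * (w i * w j))"
  proof (rule poly_mapping_eqI)
    fix m
    have ww: "Poly_Mapping.lookup (w i * w j) m \<in> \<rat>" for i j
      using rational_mpolys_mult[OF w w] by (simp add: rational_mpolys_def)
    have "(\<Sum>ij\<in>UNIV. (case ij of (i, j) \<Rightarrow> Poly_Mapping.lookup (w i * w j) m) * case_prod G ij) = Poly_Mapping.lookup g m"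
      by (simp add: gram lookup_sum lookup_mconst_mult sum.cartesian_product mult.commute split_def UNIV_Times_UNIV)
    then have "(\<Sum>ij\<in>UNIV. (case ij of (i, j) \<Rightarrow> Poly_Mapping.lookup (w i * w j) m) * x ij) = Poly_Mapping.lookup g m"
      using g ww by (intro rel[rule_format]) (auto simp: rational_mpolys_def)
    then show "Poly_Mapping.lookup g m = Poly_Mapping.lookup (\<Sum>i\<in>UNIV. \<Sum>j\<in>UNIV. mconst (x (i, j)) * (w i * w j)) m"
      by (simp add: lookup_sum lookup_mconst_mult sum.cartesian_product mult.commute split_def UNIV_Times_UNIV)
  qed
  also have "\<dots> \<in> rational_sos"
  proof (rule rational_sos_diagonally_dominant[OF w _ \<epsilon>(1)])
    fix i j
    show "x (i, j) \<in> \<rat>" using x by blast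
    have "\<bar>x (i, j) - (if i = j then \<epsilon> else 0)\<bar> \<le> \<bar>x (i, j) - G i j\<bar> + \<bar>G i j - (if i = j then \<epsilon> else 0)\<bar>" by linarith
    also have "\<dots> \<le> \<delta> + \<delta>" using x[rule_format, of "(i, j)"] near[of i j] unfolding \<delta>_def by (intro add_mono) auto
    also have "\<dots> = \<epsilon> / real CARD('n)" by (simp add: \<delta>_def)
    finally show "\<bar>x (i, j) - (if i = j then \<epsilon> else 0)\<bar> \<le> \<epsilon> / real CARD('n)" .
  qed
  finally show ?thesis .
qed

definition cubic_monomial :: "cubic_exponent \<Rightarrow> (3, real) mpoly" where
  "cubic_monomial k = Poly_Mapping.single (Rep_cubic_exponent k) 1"

lemma cubic_form_eq: "cubic_form v = (\<Sum>k\<in>UNIV. mconst (v $ k) * cubic_monomial k)"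
  by (simp add: cubic_form_def cubic_monomial_def mconst_def mult_single)

lemma cubic_monomial_props: "cubic_monomial k \<in> rational_mpolys" "cubic_monomial k \<in> forms 3"
  using Rep_cubic_exponent[of k] by (simp_all add: cubic_monomial_def rational_mpolys_closed(5) forms_def)

lemma cubic_form_rational: "(\<And>k. v $ k \<in> \<rat>) \<Longrightarrow> cubic_form v \<in> rational_mpolys"
  unfolding cubic_form_eq by (intro rational_mpolys_sum rational_mpolys_closed(4) cubic_monomial_props)

lemma cubic_form_mult:
  "cubic_form u * cubic_form v = (\<Sum>k\<in>UNIV. \<Sum>l\<in>UNIV. mconst (u $ k * v $ l) * (cubic_monomial k * cubic_monomial l))"
  unfolding cubic_form_eq sum_product by (simp add: mconst_arith mult_ac)

text \<open>Rounding the coefficients of each cubic changes the Gram matrix in the monomial basis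
  only slightly. The error is recorded as a matrix \<open>H\<close>, since diagonal dominance is a
  condition on the matrix and not on the form.\<close>

lemma sos_rational_approximation:
  assumes "set qs \<subseteq> forms 3" "0 < \<eta>"
  shows "\<exists>g\<in>rational_sos. \<exists>H. g \<in> rational_mpolys \<and> (\<Sum>q\<leftarrow>qs. q\<^sup>2) - g =
    (\<Sum>k\<in>UNIV. \<Sum>l\<in>UNIV. mconst (H k l) * (cubic_monomial k * cubic_monomial l)) \<and> (\<forall>k l. \<bar>H k l\<bar> \<le> \<eta>)"
  using assms
proof (induction qs arbitrary: \<eta>)
  case Nil
  then show ?case
    by (intro bexI[of _ 0] exI[of _ "\<lambda>_ _. 0"]) (auto intro: rational_sos_closed rational_mpolys_closed)
next
  case (Cons q qs)
  then have "set qs \<subseteq> forms 3" "0 < \<eta> / 2" by simp_all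
  from Cons.IH[OF this] obtain g H where g: "g \<in> rational_sos" "g \<in> rational_mpolys"
    and H: "(\<Sum>q\<leftarrow>qs. q\<^sup>2) - g = (\<Sum>k\<in>UNIV. \<Sum>l\<in>UNIV. mconst (H k l) * (cubic_monomial k * cubic_monomial l))"
      "\<And>k l. \<bar>H k l\<bar> \<le> \<eta> / 2" by blast
  define u where "u = cubic_coeffs q"
  have q: "q = cubic_form u" using Cons.prems by (simp add: u_def cubic_form_coeffs)
  define M where "M = norm u"
  \<comment> \<open>For \<delta> \<le> 1 the products of coefficients change by at most 2 M \<delta>
    + \<delta>^2 \<le> \<delta> (2 M + 1). The other half of \<eta> is spent on the tail of the
    list.\<close>
  define \<delta> where "\<delta> = min 1 (\<eta> / 2 / (2 * M + 1))"
  have M: "0 \<le> M" "\<bar>u $ k\<bar> \<le> M" for k by (simp_all add: M_def component_le_norm_cart)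
  have \<delta>: "0 < \<delta>" "\<delta> \<le> 1" "\<delta> * (2 * M + 1) \<le> \<eta> / 2"
  proof -
    show "0 < \<delta>" "\<delta> \<le> 1" using M Cons.prems by (auto simp: \<delta>_def)
    have "\<delta> \<le> \<eta> / 2 / (2 * M + 1)" by (simp add: \<delta>_def)
    then show "\<delta> * (2 * M + 1) \<le> \<eta> / 2" using M by (subst (asm) pos_le_divide_eq) auto
  qed
  have "\<exists>y. y \<in> \<rat> \<and> \<bar>u $ k - y\<bar> \<le> \<delta>" for k
    using Rats_dense_in_real[of "u $ k" "u $ k + \<delta>"] \<delta>(1) by force
  then obtain y where y: "\<And>k. y k \<in> \<rat> \<and> \<bar>u $ k - y k\<bar> \<le> \<delta>" by metis
  define v :: "real ^ cubic_exponent" where "v = (\<chi> k. y k)"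
  have v: "v $ k \<in> \<rat>" "\<bar>u $ k - v $ k\<bar> \<le> \<delta>" for k using y by (simp_all add: v_def)
  define E where "E k l = u $ k * u $ l - v $ k * v $ l" for k l
  have E: "\<bar>E k l\<bar> \<le> \<eta> / 2" for k l
  proof -
    have "E k l = u $ k * (u $ l - v $ l) + (u $ k - v $ k) * u $ l - (u $ k - v $ k) * (u $ l - v $ l)"
      by (simp add: E_def algebra_simps)
    also have "\<bar>\<dots>\<bar> \<le> \<bar>u $ k\<bar> * \<bar>u $ l - v $ l\<bar> + \<bar>u $ k - v $ k\<bar> * \<bar>u $ l\<bar> + \<bar>u $ k - v $ k\<bar> * \<bar>u $ l - v $ l\<bar>"
      by (simp only: abs_mult[symmetric])
    also have "\<dots> \<le> M * \<delta> + \<delta> * M + \<delta> * 1"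
      using M v \<delta> by (intro add_mono mult_mono) (auto intro: order.trans)
    also have "\<dots> \<le> \<eta> / 2" using \<delta>(3) by (simp add: algebra_simps)
    finally show ?thesis .
  qed
  have rat: "cubic_form v \<in> rational_mpolys" by (intro cubic_form_rational v)
  have "(\<Sum>q\<leftarrow>q # qs. q\<^sup>2) - (g + (cubic_form v)\<^sup>2) = ((\<Sum>q\<leftarrow>qs. q\<^sup>2) - g) + (cubic_form u * cubic_form u - cubic_form v * cubic_form v)"
    by (simp add: q power2_eq_square)
  also have "\<dots> = (\<Sum>k\<in>UNIV. \<Sum>l\<in>UNIV. mconst (H k l + E k l) * (cubic_monomial k * cubic_monomial l))"
    unfolding H(1) cubic_form_mult E_def mconst_arith distrib_right left_diff_distrib sum.distrib sum_subtractf ..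
  finally have eq: "(\<Sum>q\<leftarrow>q # qs. q\<^sup>2) - (g + (cubic_form v)\<^sup>2) =
    (\<Sum>k\<in>UNIV. \<Sum>l\<in>UNIV. mconst (H k l + E k l) * (cubic_monomial k * cubic_monomial l))" .
  have "\<bar>H k l + E k l\<bar> \<le> \<eta>" for k l using H(2)[of k l] E[of k l] by linarith
  moreover have "g + (cubic_form v)\<^sup>2 \<in> rational_sos" "g + (cubic_form v)\<^sup>2 \<in> rational_mpolys"
    using g rat rational_mpolys_mult[OF rat rat]
    by (auto intro: rational_sos_closed rational_mpolys_closed(2) simp flip: power2_eq_square)
  ultimately show ?case using eq by (intro bexI[of _ "g + (cubic_form v)\<^sup>2"] exI[of _ "\<lambda>k l. H k l + E k l"]) auto
qed

lemma sextic_coeffs_linear: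
  "sextic_coeffs (p + q) = sextic_coeffs p + sextic_coeffs q"
  "sextic_coeffs (p - q) = sextic_coeffs p - sextic_coeffs q"
  "sextic_coeffs (mconst r * p) = r *\<^sub>R sextic_coeffs p"
  by (simp_all add: sextic_coeffs_def vec_eq_iff lookup_add lookup_minus lookup_mconst_mult)

lemma sextic_coeffs_inj: "p \<in> forms 6 \<Longrightarrow> q \<in> forms 6 \<Longrightarrow> sextic_coeffs p = sextic_coeffs q \<Longrightarrow> p = q"
  using bij_betw_sextic_coeffs by (auto simp: bij_betw_def inj_on_def)

lemma square_forms: "q \<in> forms 3 \<Longrightarrow> q\<^sup>2 \<in> forms 6" for q :: "(3, real) mpoly"
  using forms_closed(8)[of q 3 2] by simp

lemma Sigma6_forms: "f \<in> Sigma6 \<Longrightarrow> f \<in> forms 6"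
proof -
  have "(\<Sum>q\<leftarrow>qs. q\<^sup>2) \<in> forms 6" if "set qs \<subseteq> forms 3" for qs :: "(3, real) mpoly list"
    using that by (induction qs) (auto intro: forms_closed square_forms)
  then show "f \<in> Sigma6 \<Longrightarrow> f \<in> forms 6" by (auto simp: Sigma6_def sums_of_squares_def)
qed

text \<open>Subtracting a small multiple of the sum of all squared monomials stays in the cone.
  Rounding a representation of the difference leaves f - g with Gram matrix \<open>H\<close> plus
  \<epsilon> times the identity, where \<open>H\<close> is as small as desired.\<close>

lemma interior_Sigma6_rational_sos:
  assumes f: "f \<in> forms 6" "f \<in> rational_mpolys" and int: "sextic_coeffs f \<in> interior (sextic_coeffs ` Sigma6)"
  shows "f \<in> rational_sos"
proof -
  define s where "s = (\<Sum>k\<in>UNIV. (cubic_monomial k)\<^sup>2)"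
  have s: "s \<in> forms 6" unfolding s_def by (intro forms_sum square_forms cubic_monomial_props)
  have "s \<in> rational_mpolys"
    unfolding s_def power2_eq_square by (intro rational_mpolys_sum rational_mpolys_mult cubic_monomial_props)
  obtain e where e: "0 < e" "ball (sextic_coeffs f) e \<subseteq> sextic_coeffs ` Sigma6"
    using int by (auto simp: mem_interior)
  have "0 < e / (norm (sextic_coeffs s) + 1)" using e by (simp add: add_nonneg_pos)
  then obtain \<epsilon> where \<epsilon>: "\<epsilon> \<in> \<rat>" "0 < \<epsilon>" "\<epsilon> < e / (norm (sextic_coeffs s) + 1)"
    using Rats_dense_in_real by blast
  have "\<epsilon> * (norm (sextic_coeffs s) + 1) < e" using \<epsilon>(3) by (subst (asm) pos_less_divide_eq) (auto simp: add_nonneg_pos)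
  then have "\<epsilon> * norm (sextic_coeffs s) < e" using \<epsilon>(2) by (simp add: algebra_simps)
  then have "sextic_coeffs (f - mconst \<epsilon> * s) \<in> ball (sextic_coeffs f) e"
    using \<epsilon>(2) by (simp add: sextic_coeffs_linear dist_norm)
  then obtain f' where f': "f' \<in> Sigma6" "sextic_coeffs (f - mconst \<epsilon> * s) = sextic_coeffs f'" using e(2) by blast
  have "f - mconst \<epsilon> * s = f'"
    by (rule sextic_coeffs_inj[OF forms_closed(5)[OF f(1) forms_closed(7)[OF s]] Sigma6_forms[OF f'(1)] f'(2)])
  obtain qs where qs: "set qs \<subseteq> forms 3" "f' = (\<Sum>q\<leftarrow>qs. q\<^sup>2)"
    using f'(1) by (auto simp: Sigma6_def sums_of_squares_def)
  define \<eta> where "\<eta> = \<epsilon> / (2 * real CARD(cubic_exponent))"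
  have "0 < \<eta>" using \<epsilon> by (simp add: \<eta>_def)
  then obtain g H where g: "g \<in> rational_sos" "g \<in> rational_mpolys"
    and H: "f' - g = (\<Sum>k\<in>UNIV. \<Sum>l\<in>UNIV. mconst (H k l) * (cubic_monomial k * cubic_monomial l))"
      "\<And>k l. \<bar>H k l\<bar> \<le> \<eta>"
    using sos_rational_approximation[OF qs(1)] unfolding qs(2) by blast
  have s_eq: "mconst \<epsilon> * s = (\<Sum>k\<in>UNIV. \<Sum>l\<in>UNIV. mconst (if k = l then \<epsilon> else 0) * (cubic_monomial k * cubic_monomial l))"
  proof -
    have "mconst (if k = l then \<epsilon> else 0) * t = (if k = l then mconst \<epsilon> * t else 0)" for k l :: cubic_exponent and t :: "(3, real) mpoly"
      by simp
    then show ?thesis by (simp add: s_def sum_distrib_left power2_eq_square)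
  qed
  have "f - g = (\<Sum>k\<in>UNIV. \<Sum>l\<in>UNIV. mconst (H k l + (if k = l then \<epsilon> else 0)) * (cubic_monomial k * cubic_monomial l))"
  proof -
    have "f - g = (f' - g) + mconst \<epsilon> * s" using \<open>f - mconst \<epsilon> * s = f'\<close> by (simp add: algebra_simps)
    then show ?thesis unfolding H(1) s_eq mconst_arith(1) distrib_right sum.distrib .
  qed
  moreover have "f - g \<in> rational_mpolys" using f g by (intro rational_mpolys_closed)
  ultimately have "f - g \<in> rational_sos"
    using H(2) \<epsilon> by (intro rational_sos_near_scalar_gram[of cubic_monomial "f - g" \<epsilon>]) (auto simp: cubic_monomial_props \<eta>_def)
  then have "g + (f - g) \<in> rational_sos" using g by (intro rational_sos_closed)
  then show ?thesis by simp
qed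

section \<open>Supporting functionals\<close>

text \<open>The zero functional qualifies; nontriviality is carried separately by a sextic
  \<open>g\<close> with \<open>l g \<noteq> 0\<close>.\<close>

definition supports :: "((3, real) mpoly \<Rightarrow> real) \<Rightarrow> (3, real) mpoly \<Rightarrow> bool" where
  "supports l f \<longleftrightarrow> sextic_functional l \<and> (\<forall>p\<in>forms 3. 0 \<le> l (p * p)) \<and> l f = 0"

text \<open>A null vector of a semidefinite form lies in its radical; \<open>cubic_form\<close>
  transports the form to Euclidean space, where \<open>semidefinite_null\<close> applies.\<close>

lemma radical_iff:
  assumes "sextic_functional l" "\<And>p. p \<in> forms 3 \<Longrightarrow> 0 \<le> l (p * p)" "q \<in> forms 3"
  shows "q \<in> sextic_radical l \<longleftrightarrow> l (q * q) = 0"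
proof
  interpret sextic_functional l by fact
  define B where "B u v = l (cubic_form u * cubic_form v)" for u v
  have "bilinear B"
    unfolding bilinear_def B_def
    by (intro conjI allI linearI)
      (simp_all add: cubic_form_add cubic_form_scaleR distrib_left distrib_right add mult.assoc mult.left_commute[of "cubic_form x" "mconst r" for x r] scale)
  assume "l (q * q) = 0"
  then have z: "B (cubic_coeffs q) (cubic_coeffs q) = 0" by (simp add: B_def cubic_form_coeffs assms(3))
  have sym: "B u v = B v u" and pos: "0 \<le> B u u" for u v
    using assms(2) cubic_form_forms by (simp_all add: B_def mult.commute)
  have null: "B (cubic_coeffs q) v = 0" for v
    by (rule semidefinite_null[OF \<open>bilinear B\<close> sym pos z])
  have "l (q * p) = 0" if "p \<in> forms 3" for p
    using null[of "cubic_coeffs p"] that assms(3) by (simp add: B_def cubic_form_coeffs)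
  then show "q \<in> sextic_radical l" using assms(3) by (simp add: sextic_radical_def)
qed (use assms(3) in \<open>simp add: sextic_radical_def\<close>)

text \<open>The nonnegative values l (q q) add up to 0, so each of them is 0.\<close>

lemma supports_radical:
  assumes "supports l (\<Sum>q\<leftarrow>qs. q\<^sup>2)" "set qs \<subseteq> forms 3"
  shows "set qs \<subseteq> sextic_radical l"
proof -
  interpret sextic_functional l using assms(1) by (simp add: supports_def)
  have psd: "0 \<le> l (p * p)" if "p \<in> forms 3" for p using assms(1) that by (simp add: supports_def)
  have l_sum: "l (\<Sum>q\<leftarrow>qs. q\<^sup>2) = (\<Sum>q\<leftarrow>qs. l (q * q))" for qs
    by (induction qs) (simp_all add: zero add power2_eq_square)
  have terms: "\<forall>q\<in>set qs. l (q * q) = 0" if "(\<Sum>q\<leftarrow>qs. l (q * q)) = 0" "set qs \<subseteq> forms 3" for qs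
    using that
  proof (induction qs)
    case (Cons q qs)
    have "0 \<le> l (q * q)" "0 \<le> (\<Sum>q\<leftarrow>qs. l (q * q))"
      using Cons.prems psd by (auto intro!: sum_list_nonneg psd)
    then show ?case using Cons by auto
  qed simp
  have "(\<Sum>q\<leftarrow>qs. l (q * q)) = 0" using assms(1) l_sum[of qs] by (simp add: supports_def)
  then have "\<forall>q\<in>set qs. l (q * q) = 0" using assms(2) by (rule terms)
  then show ?thesis using assms(2) radical_iff[OF sextic_functional_axioms psd] by blast
qed

text \<open>The cubics in a representation of \<open>f\<close> lie in the radical and have no common
  real zero by strict positivity. Four independent radical elements would therefore make
  \<open>l\<close> vanish on sextics, contrary to \<open>g\<close>.\<close>

lemma supports_dependent:
  fixes w :: "4 \<Rightarrow> (3, real) mpoly"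
  assumes f: "f \<in> Sigma6" "strictly_positive f" and l: "supports l f" "g \<in> forms 6" "l g \<noteq> 0"
    and w: "\<And>i. w i \<in> sextic_radical l"
  shows "\<exists>c :: real ^ 4. c \<noteq> 0 \<and> (\<Sum>i\<in>UNIV. mconst (c $ i) * w i) = 0"
proof (rule ccontr)
  assume "\<not> ?thesis"
  then have indep: "c = 0" if "(\<Sum>i\<in>UNIV. mconst (c $ i) * w i) = 0" for c :: "real ^ 4" using that by blast
  interpret sextic_functional l using l by (simp add: supports_def)
  obtain qs where qs: "set qs \<subseteq> forms 3" "f = (\<Sum>q\<leftarrow>qs. q\<^sup>2)"
    using f by (auto simp: Sigma6_def sums_of_squares_def)
  have W: "set qs \<subseteq> W" using supports_radical l qs by blast
  have "\<exists>v\<in>W. mpoly_eval v z \<noteq> 0" if "z \<noteq> 0" for z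
  proof (rule ccontr)
    assume "\<not> ?thesis"
    then have "\<forall>q\<in>set qs. mpoly_eval q z = 0" using W by blast
    then have "mpoly_eval f z = 0" unfolding qs(2) by (induction qs) auto
    then show False using f(2) that by (auto simp: strictly_positive_def)
  qed
  then interpret large_radical l w
    using l w indep by unfold_locales (auto simp: supports_def)
  show False using functional_vanishes l by blast
qed

lemma supports_three_squares:
  assumes f: "f \<in> Sigma6" "strictly_positive f" and l: "supports l f" "g \<in> forms 6" "l g \<noteq> 0"
  shows "\<exists>q :: 3 \<Rightarrow> (3, real) mpoly. range q \<subseteq> sextic_radical l \<and> f = (\<Sum>i\<in>UNIV. (q i)\<^sup>2)"
proof -
  interpret sextic_functional l using l by (simp add: supports_def)
  obtain qs where qs: "set qs \<subseteq> forms 3" "f = (\<Sum>q\<leftarrow>qs. q\<^sup>2)"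
    using f by (auto simp: Sigma6_def sums_of_squares_def)
  have W: "set qs \<subseteq> W" using supports_radical l qs by blast
  have "\<exists>q1\<in>W. \<exists>q2\<in>W. \<exists>q3\<in>W. (\<Sum>q\<leftarrow>qs. q\<^sup>2) = q1\<^sup>2 + q2\<^sup>2 + q3\<^sup>2"
  proof (rule sum_list_squares_three[OF W_closed(1,2,4) _ W])
    fix w :: "4 \<Rightarrow> (3, real) mpoly" assume "\<And>i. w i \<in> W"
    then show "\<exists>c. c \<noteq> 0 \<and> (\<Sum>i\<in>UNIV. mconst (c $ i) * w i) = 0"
      by (rule supports_dependent[OF f l])
  qed
  then obtain q1 q2 q3 where "q1 \<in> W" "q2 \<in> W" "q3 \<in> W" "f = q1\<^sup>2 + q2\<^sup>2 + q3\<^sup>2" unfolding qs(2) by blast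
  then show ?thesis
    by (intro exI[of _ "\<lambda>i. if i = 1 then q1 else if i = 2 then q2 else q3"]) (auto simp: sum_3)
qed

lemma exists_supporting_functional:
  assumes "f \<in> Sigma6" "sextic_coeffs f \<notin> interior (sextic_coeffs ` Sigma6)"
  obtains l g where "supports l f" "g \<in> forms 6" "l g \<noteq> 0"
proof -
  let ?S = "sextic_coeffs ` Sigma6"
  have add: "p + q \<in> Sigma6" if pq: "p \<in> Sigma6" "q \<in> Sigma6" for p q
  proof -
    obtain ps qs where "set ps \<subseteq> forms 3" "p = (\<Sum>q\<leftarrow>ps. q\<^sup>2)" "set qs \<subseteq> forms 3" "q = (\<Sum>q\<leftarrow>qs. q\<^sup>2)"
      using pq unfolding Sigma6_def sums_of_squares_def by blast
    then show ?thesis unfolding Sigma6_def sums_of_squares_def by (force intro: exI[of _ "ps @ qs"])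
  qed
  have sq: "mconst r * q\<^sup>2 \<in> Sigma6" if "q \<in> forms 3" "0 \<le> r" for q r
  proof -
    have "mconst r = (mconst (sqrt r) :: (3, real) mpoly)\<^sup>2" using that by (simp add: power2_eq_square flip: mconst_arith(2))
    then have "mconst r * q\<^sup>2 = (\<Sum>p\<leftarrow>[mconst (sqrt r) * q]. p\<^sup>2)" by (simp add: power_mult_distrib)
    then show ?thesis
      using forms_closed(7)[OF that(1), of "sqrt r"] unfolding Sigma6_def sums_of_squares_def
      by (intro CollectI exI[of _ "[mconst (sqrt r) * q]"]) simp
  qed
  have zero: "0 \<in> Sigma6" unfolding Sigma6_def sums_of_squares_def by (force intro: exI[of _ "[]"])
  have scale: "mconst r * p \<in> Sigma6" if "p \<in> Sigma6" "0 \<le> r" for p r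
  proof -
    have "mconst r * (\<Sum>q\<leftarrow>qs. q\<^sup>2) \<in> Sigma6" if "set qs \<subseteq> forms 3" for qs
      using that \<open>0 \<le> r\<close> by (induction qs) (auto simp: zero distrib_left intro: add sq)
    then show ?thesis using that by (auto simp: Sigma6_def sums_of_squares_def)
  qed
  have "convex ?S"
  proof (rule convexI)
    fix x y and u v :: real assume "x \<in> ?S" "y \<in> ?S" "0 \<le> u" "0 \<le> v"
    then obtain p q where "p \<in> Sigma6" "x = sextic_coeffs p" "q \<in> Sigma6" "y = sextic_coeffs q" by blast
    then have "u *\<^sub>R x + v *\<^sub>R y = sextic_coeffs (mconst u * p + mconst v * q)" "mconst u * p + mconst v * q \<in> Sigma6"
      using \<open>0 \<le> u\<close> \<open>0 \<le> v\<close> by (auto simp: sextic_coeffs_linear intro: add scale)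
    then show "u *\<^sub>R x + v *\<^sub>R y \<in> ?S" by blast
  qed
  have "\<exists>a. a \<noteq> 0 \<and> (\<forall>y\<in>?S. a \<bullet> sextic_coeffs f \<le> a \<bullet> y)"
  proof (cases "interior ?S = {}")
    case True
    \<comment> \<open>A convex set without interior lies in a hyperplane, whose normal supports it
      at every point.\<close>
    then obtain a b where "a \<noteq> 0" "?S \<subseteq> {x. a \<bullet> x = b}"
      using empty_interior_subset_hyperplane \<open>convex ?S\<close> by blast
    then have "a \<bullet> y = b" if "y \<in> ?S" for y using that by blast
    then have "\<forall>y\<in>?S. a \<bullet> sextic_coeffs f \<le> a \<bullet> y" using assms(1) by simp
    with \<open>a \<noteq> 0\<close> show ?thesis by blast
  next
    case False
    then have nm: "sextic_coeffs f \<notin> rel_interior ?S" using assms(2) by (simp add: rel_interior_nonempty_interior)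
    show ?thesis
    proof (rule supporting_hyperplane_rel_boundary[OF \<open>convex ?S\<close> imageI[OF assms(1)] nm])
      fix a assume "a \<noteq> 0" "\<And>y. y \<in> ?S \<Longrightarrow> a \<bullet> sextic_coeffs f \<le> a \<bullet> y"
      then show ?thesis by (intro exI[of _ a] conjI ballI)
    qed
  qed
  then obtain a where a': "a \<noteq> 0 \<and> (\<forall>y\<in>?S. a \<bullet> sextic_coeffs f \<le> a \<bullet> y)" ..
  have a: "a \<noteq> 0" "a \<bullet> sextic_coeffs f \<le> a \<bullet> sextic_coeffs p" if "p \<in> Sigma6" for p
    using a' that by simp_all
  define l where "l p = a \<bullet> sextic_coeffs p" for p
  have "l (p + q) = l p + l q" "l (mconst r * p) = r * l p" for p q r
    by (simp_all add: l_def sextic_coeffs_linear inner_add_right)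
  then have "sextic_functional l" by (rule sextic_functional.intro)
  have min: "l f \<le> l p" if "p \<in> Sigma6" for p using a(2) that by (simp add: l_def)
  \<comment> \<open>The cone contains 0 and 2 f, so the minimum attained at \<open>f\<close> can
    only be 0.\<close>
  have "l f \<le> 0" using min[OF \<open>0 \<in> Sigma6\<close>] sextic_functional.zero[OF \<open>sextic_functional l\<close>] by simp
  moreover have "l f \<le> 2 * l f" using min[of "mconst 2 * f"] scale[OF assms(1), of 2] sextic_functional.scale[OF \<open>sextic_functional l\<close>] by simp
  ultimately have "l f = 0" by simp
  have "0 \<le> l (p * p)" if "p \<in> forms 3" for p
    using min[OF sq[OF that, of 1]] \<open>l f = 0\<close> by (simp add: power2_eq_square)
  then have "supports l f" using \<open>sextic_functional l\<close> \<open>l f = 0\<close> by (simp add: supports_def)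
  moreover obtain g where "g \<in> forms 6" "sextic_coeffs g = a"
    using bij_betw_sextic_coeffs unfolding bij_betw_def by (metis UNIV_I imageE)
  then have "l g \<noteq> 0" using a' by (simp add: l_def)
  ultimately show thesis using that \<open>g \<in> forms 6\<close> by blast
qed

text \<open>A dependent triple could be shortened to two squares of cubics. Two real ternary cubics
  always share a real zero, and there the sum would vanish.\<close>

lemma strictly_positive_independent:
  fixes q :: "3 \<Rightarrow> (3, real) mpoly"
  assumes "\<And>i. q i \<in> forms 3" "strictly_positive (\<Sum>i\<in>UNIV. (q i)\<^sup>2)" "(\<Sum>i\<in>UNIV. mconst (c $ i) * q i) = 0"
  shows "c = 0"
proof -
  have two: False if eq: "(\<Sum>i\<in>UNIV. (q i)\<^sup>2) = u\<^sup>2 + v\<^sup>2 + s\<^sup>2" and forms: "u \<in> forms 3" "v \<in> forms 3" "s \<in> forms 3"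
    and rel: "mconst e * s + mconst e1 * u + mconst e2 * v = 0" "e \<noteq> 0" for u v s e e1 e2
  proof -
    have "mconst (- 1 / e) * mconst e = (- 1 :: (3, real) mpoly)" using \<open>e \<noteq> 0\<close> by (simp add: mconst_arith flip: mconst_arith(2))
    moreover have "mconst (- 1 / e) * (mconst e * s + mconst e1 * u + mconst e2 * v) = 0" using rel by simp
    ultimately have "- s + mconst (- 1 / e) * mconst e1 * u + mconst (- 1 / e) * mconst e2 * v = 0"
      by (simp add: distrib_left flip: mult.assoc)
    \<comment> \<open>The summand \<open>mconst 0 * 0\<close> fills the third slot, so that the
      absorption of a fourth square into three also serves for a third into two.\<close>
    then have s: "s = mconst (- 1 / e * e1) * u + mconst (- 1 / e * e2) * v + mconst 0 * 0"
      unfolding mconst_arith(2) by (simp add: algebra_simps)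
    obtain k where k: "u\<^sup>2 + v\<^sup>2 + 0\<^sup>2 + s\<^sup>2 = (u + mconst (k * (- 1 / e * e1)) * s)\<^sup>2
        + (v + mconst (k * (- 1 / e * e2)) * s)\<^sup>2 + (0 + mconst (k * 0) * s)\<^sup>2"
      by (rule absorb_square[OF s])
    have "u + mconst a * s \<in> forms 3" "v + mconst a * s \<in> forms 3" for a by (intro forms_closed forms)+
    then obtain z where z: "z \<noteq> 0" "mpoly_eval (u + mconst (k * (- 1 / e * e1)) * s) z = 0"
      "mpoly_eval (v + mconst (k * (- 1 / e * e2)) * s) z = 0"
      using cubics_common_real_zero by blast
    have "(\<Sum>i\<in>UNIV. (q i)\<^sup>2) = (u + mconst (k * (- 1 / e * e1)) * s)\<^sup>2 + (v + mconst (k * (- 1 / e * e2)) * s)\<^sup>2"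
      using k eq by simp
    then have "mpoly_eval (\<Sum>i\<in>UNIV. (q i)\<^sup>2) z = 0" using z(2,3) by (simp only: mpoly_eval_add mpoly_eval_power) simp
    then show False using assms(2) z(1) by (auto simp: strictly_positive_def)
  qed
  have rel: "mconst (c $ 1) * q 1 + mconst (c $ 2) * q 2 + mconst (c $ 3) * q 3 = 0"
    using assms(3) by (simp add: sum_3)
  have "c $ 1 = 0" using two[of "q 2" "q 3" "q 1" "c $ 1" "c $ 2" "c $ 3"] rel assms(1) by (auto simp: sum_3 add_ac)
  moreover have "c $ 2 = 0" using two[of "q 1" "q 3" "q 2" "c $ 2" "c $ 1" "c $ 3"] rel assms(1) by (auto simp: sum_3 add_ac)
  moreover have "c $ 3 = 0" using two[of "q 1" "q 2" "q 3" "c $ 3" "c $ 1" "c $ 2"] rel assms(1) by (auto simp: sum_3 add_ac)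
  ultimately show ?thesis by (simp add: vec_eq_iff forall_3)
qed

section \<open>The tangent hyperplane at a regular point\<close>

lemma mpoly_eval_pderiv:
  assumes "finite A" "Poly_Mapping.keys P \<subseteq> A"
  shows "mpoly_eval (mpoly_pderiv i P) x = (\<Sum>m\<in>A. Poly_Mapping.lookup P m *
    (of_nat (Poly_Mapping.lookup m i) * (\<Prod>j\<in>UNIV. x $ j ^ Poly_Mapping.lookup (m - Poly_Mapping.single i 1) j)))"
proof -
  have "mpoly_eval (mpoly_pderiv i P) x = (\<Sum>m\<in>Poly_Mapping.keys P. Poly_Mapping.lookup P m *
    (of_nat (Poly_Mapping.lookup m i) * (\<Prod>j\<in>UNIV. x $ j ^ Poly_Mapping.lookup (m - Poly_Mapping.single i 1) j)))"
    unfolding mpoly_pderiv_def mpoly_eval_sum mpoly_eval_single by (intro sum.cong) (simp_all add: mult_ac)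
  also have "\<dots> = (\<Sum>m\<in>A. Poly_Mapping.lookup P m *
    (of_nat (Poly_Mapping.lookup m i) * (\<Prod>j\<in>UNIV. x $ j ^ Poly_Mapping.lookup (m - Poly_Mapping.single i 1) j)))"
    using assms by (intro sum.mono_neutral_left) (auto simp: in_keys_iff)
  finally show ?thesis .
qed

text \<open>Links the formal gradient to calculus, so that product and chain rules follow from
  uniqueness of derivatives.\<close>

lemma has_derivative_mpoly_eval:
  fixes P :: "('x::finite, real) mpoly"
  shows "(mpoly_eval P has_derivative (\<lambda>h. \<Sum>i\<in>UNIV. mpoly_eval (mpoly_pderiv i P) x * h $ i)) (at x)"
proof -
  let ?\<kappa> = "\<lambda>m i. of_nat (Poly_Mapping.lookup m i) * (\<Prod>j\<in>UNIV. x $ j ^ Poly_Mapping.lookup (m - Poly_Mapping.single i 1) j)"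
  have mono: "((\<lambda>a. \<Prod>i\<in>UNIV. a $ i ^ Poly_Mapping.lookup m i) has_derivative (\<lambda>h. \<Sum>i\<in>UNIV. ?\<kappa> m i * h $ i)) (at x)"
    for m :: "'x exponent"
  proof -
    have "((\<lambda>a. \<Prod>i\<in>UNIV. a $ i ^ Poly_Mapping.lookup m i) has_derivative
      (\<lambda>h. \<Sum>i\<in>UNIV. (of_nat (Poly_Mapping.lookup m i) * h $ i * x $ i ^ (Poly_Mapping.lookup m i - 1)) *
        (\<Prod>j\<in>UNIV - {i}. x $ j ^ Poly_Mapping.lookup m j))) (at x)"
      by (intro has_derivative_prod has_derivative_power bounded_linear_imp_has_derivative bounded_linear_vec_nth)
    moreover have "(of_nat (Poly_Mapping.lookup m i) * h $ i * x $ i ^ (Poly_Mapping.lookup m i - 1)) *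
        (\<Prod>j\<in>UNIV - {i}. x $ j ^ Poly_Mapping.lookup m j) = ?\<kappa> m i * h $ i" for i h
    proof -
      have "(\<Prod>j\<in>UNIV. x $ j ^ Poly_Mapping.lookup (m - Poly_Mapping.single i 1) j) =
          x $ i ^ (Poly_Mapping.lookup m i - 1) * (\<Prod>j\<in>UNIV - {i}. x $ j ^ Poly_Mapping.lookup (m - Poly_Mapping.single i 1) j)"
        by (subst prod.remove[of _ i]) (simp_all add: lookup_minus)
      also have "(\<Prod>j\<in>UNIV - {i}. x $ j ^ Poly_Mapping.lookup (m - Poly_Mapping.single i 1) j) =
          (\<Prod>j\<in>UNIV - {i}. x $ j ^ Poly_Mapping.lookup m j)"
        by (intro prod.cong) (auto simp: lookup_minus lookup_single when_def)
      finally show ?thesis by (simp add: mult_ac)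
    qed
    ultimately show ?thesis by (simp only:)
  qed
  have "((\<lambda>a. \<Sum>m\<in>Poly_Mapping.keys P. Poly_Mapping.lookup P m * (\<Prod>i\<in>UNIV. a $ i ^ Poly_Mapping.lookup m i)) has_derivative
      (\<lambda>h. \<Sum>m\<in>Poly_Mapping.keys P. Poly_Mapping.lookup P m * (\<Sum>i\<in>UNIV. ?\<kappa> m i * h $ i))) (at x)"
    by (intro has_derivative_sum has_derivative_mult_right mono)
  moreover have "(\<Sum>m\<in>Poly_Mapping.keys P. Poly_Mapping.lookup P m * (\<Sum>i\<in>UNIV. ?\<kappa> m i * h $ i)) =
      (\<Sum>i\<in>UNIV. mpoly_eval (mpoly_pderiv i P) x * h $ i)" for h
    unfolding mpoly_eval_pderiv[OF finite_keys order.refl] sum_distrib_left sum_distrib_right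
    by (subst sum.swap) (simp add: mult_ac)
  ultimately show ?thesis by (simp add: mpoly_eval_def[abs_def])
qed

text \<open>The term of the product rule containing P(x) drops out. Thus all multiples of
  \<open>F\<close> have proportional gradients at a point of \<open>V\<close>.\<close>

lemma mpoly_pderiv_mult_at_zero:
  fixes P Q :: "('x::finite, real) mpoly"
  assumes "mpoly_eval P x = 0"
  shows "mpoly_eval (mpoly_pderiv i (P * Q)) x = mpoly_eval Q x * mpoly_eval (mpoly_pderiv i P) x"
proof -
  have "((\<lambda>a. mpoly_eval P a * mpoly_eval Q a) has_derivative
    (\<lambda>h. mpoly_eval P x * (\<Sum>i\<in>UNIV. mpoly_eval (mpoly_pderiv i Q) x * h $ i) + (\<Sum>i\<in>UNIV. mpoly_eval (mpoly_pderiv i P) x * h $ i) * mpoly_eval Q x)) (at x)"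
    by (intro has_derivative_mult has_derivative_mpoly_eval)
  then have "(mpoly_eval (P * Q) has_derivative (\<lambda>h. (\<Sum>i\<in>UNIV. mpoly_eval (mpoly_pderiv i P) x * h $ i) * mpoly_eval Q x)) (at x)"
    using assms by (simp add: mpoly_eval_mult[abs_def])
  from has_derivative_unique[OF has_derivative_mpoly_eval this]
  have "(\<Sum>j\<in>UNIV. mpoly_eval (mpoly_pderiv j (P * Q)) x * axis i 1 $ j) = (\<Sum>j\<in>UNIV. mpoly_eval (mpoly_pderiv j P) x * axis i 1 $ j) * mpoly_eval Q x"
    by meson
  moreover have "(\<Sum>j\<in>UNIV. g j * axis i 1 $ j) = g i" for g :: "'x \<Rightarrow> real"
    by (simp add: axis_def if_distrib cong: if_cong)
  ultimately show ?thesis by simp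
qed

definition three_squares :: "(3, real) mpoly set" where
  "three_squares = {q1\<^sup>2 + q2\<^sup>2 + q3\<^sup>2 | q1 q2 q3. q1 \<in> forms 3 \<and> q2 \<in> forms 3 \<and> q3 \<in> forms 3}"

lemma three_squaresI:
  "q1 \<in> forms 3 \<Longrightarrow> q2 \<in> forms 3 \<Longrightarrow> q3 \<in> forms 3 \<Longrightarrow> q1\<^sup>2 + q2\<^sup>2 + q3\<^sup>2 \<in> three_squares"
  unfolding three_squares_def by blast

text \<open>The curve (q1 + t p)^2 + q2^2 + q3^2 stays in the zero set of \<open>F\<close> and has
  velocity 2 q1 p at t = 0. Varying the first square is enough, as the squares can be
  permuted.\<close>

lemma gradient_tangent:
  assumes F: "F \<in> vanishing_ideal three_squares" and q: "q1 \<in> forms 3" "q2 \<in> forms 3" "q3 \<in> forms 3" "p \<in> forms 3"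
  shows "(\<Sum>i\<in>UNIV. mpoly_eval (mpoly_pderiv i F) (sextic_coeffs (q1\<^sup>2 + q2\<^sup>2 + q3\<^sup>2)) * sextic_coeffs (q1 * p) $ i) = 0"
proof -
  define x where "x = sextic_coeffs (q1\<^sup>2 + q2\<^sup>2 + q3\<^sup>2)"
  define y where "y = 2 *\<^sub>R sextic_coeffs (q1 * p)"
  define z where "z = sextic_coeffs (p\<^sup>2)"
  define \<gamma> where "\<gamma> t = x + t *\<^sub>R y + t\<^sup>2 *\<^sub>R z" for t
  have "mpoly_eval F (\<gamma> t) = 0" for t
  proof -
    have "mconst (1 + 1) = (mconst 1 + mconst 1 :: (3, real) mpoly)" by (rule mconst_arith)
    then have eq: "(q1 + mconst t * p)\<^sup>2 + q2\<^sup>2 + q3\<^sup>2 = (q1\<^sup>2 + q2\<^sup>2 + q3\<^sup>2) + mconst (2 * t) * (q1 * p) + mconst (t\<^sup>2) * p\<^sup>2"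
      by (simp add: power2_eq_square mult_2 mconst_arith algebra_simps)
    have "\<gamma> t = sextic_coeffs ((q1 + mconst t * p)\<^sup>2 + q2\<^sup>2 + q3\<^sup>2)"
      unfolding eq by (simp add: \<gamma>_def x_def y_def z_def sextic_coeffs_linear mult.commute[of t 2])
    moreover have "q1 + mconst t * p \<in> forms 3" by (intro forms_closed q)
    then have "(q1 + mconst t * p)\<^sup>2 + q2\<^sup>2 + q3\<^sup>2 \<in> three_squares" unfolding three_squares_def using q by blast
    ultimately show ?thesis using F by (simp add: vanishing_ideal_def)
  qed
  then have "((\<lambda>t. mpoly_eval F (\<gamma> t)) has_derivative (\<lambda>h. 0)) (at 0)" by simp
  moreover have "(\<gamma> has_derivative (\<lambda>h. h *\<^sub>R y)) (at 0)"
    unfolding \<gamma>_def by (auto intro!: derivative_eq_intros)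
  then have "((\<lambda>t. mpoly_eval F (\<gamma> t)) has_derivative (\<lambda>h. \<Sum>i\<in>UNIV. mpoly_eval (mpoly_pderiv i F) (\<gamma> 0) * (h *\<^sub>R y) $ i)) (at 0)"
    by (rule has_derivative_compose[OF _ has_derivative_mpoly_eval])
  ultimately have "(\<lambda>h. 0) = (\<lambda>h. \<Sum>i\<in>UNIV. mpoly_eval (mpoly_pderiv i F) (\<gamma> 0) * (h *\<^sub>R y) $ i)"
    by (rule has_derivative_unique)
  from fun_cong[OF this, of 1] have "2 * (\<Sum>i\<in>UNIV. mpoly_eval (mpoly_pderiv i F) x * sextic_coeffs (q1 * p) $ i) = 0"
    by (simp add: \<gamma>_def y_def sum_distrib_left mult_ac)
  then show ?thesis by (simp add: x_def)
qed

definition independent_triple :: "(3 \<Rightarrow> (3, real) mpoly) \<Rightarrow> bool" where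
  "independent_triple q \<longleftrightarrow> (\<forall>c :: real ^ 3. (\<Sum>i\<in>UNIV. mconst (c $ i) * q i) = 0 \<longrightarrow> c = 0)"

text \<open>The triple together with \<open>w\<close> satisfies a linear relation by the dimension
  bound; independence of the triple makes the coefficient of \<open>w\<close> nonzero.\<close>

lemma radical_span:
  assumes f: "f \<in> Sigma6" "strictly_positive f" and l: "supports l f" "g \<in> forms 6" "l g \<noteq> 0"
    and q: "\<And>i. q i \<in> sextic_radical l" "independent_triple q" and w: "w \<in> sextic_radical l"
  shows "\<exists>a :: real ^ 3. w = (\<Sum>i\<in>UNIV. mconst (a $ i) * q i)"
proof -
  define v :: "4 \<Rightarrow> (3, real) mpoly" where "v j = (if j = 1 then q 1 else if j = 2 then q 2 else if j = 3 then q 3 else w)" for j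
  have "v j \<in> sextic_radical l" for j using q w by (simp add: v_def)
  then obtain c :: "real ^ 4" where c: "c \<noteq> 0" "(\<Sum>i\<in>UNIV. mconst (c $ i) * v i) = 0"
    using supports_dependent[OF f l, of v] by blast
  have rel: "mconst (c $ 1) * q 1 + mconst (c $ 2) * q 2 + mconst (c $ 3) * q 3 + mconst (c $ 4) * w = 0"
    using c(2) by (simp add: sum_4 v_def add.assoc)
  have "c $ 4 \<noteq> 0"
  proof
    assume c4: "c $ 4 = 0"
    define d :: "real ^ 3" where "d = vector [c $ 1, c $ 2, c $ 3]"
    have "(\<Sum>i\<in>UNIV. mconst (d $ i) * q i) = 0" using rel c4 by (simp add: sum_3 d_def)
    then have "d = 0" using q(2) by (simp add: independent_triple_def)
    then have "c $ 1 = 0" "c $ 2 = 0" "c $ 3 = 0" by (simp_all add: d_def vec_eq_iff forall_3)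
    with c4 c(1) show False by (simp add: vec_eq_iff forall_4)
  qed
  define a :: "real ^ 3" where "a = vector [- c $ 1 / c $ 4, - c $ 2 / c $ 4, - c $ 3 / c $ 4]"
  define e where "e = - 1 / c $ 4"
  have "mconst e * mconst (c $ 4) = (- 1 :: (3, real) mpoly)"
    using \<open>c $ 4 \<noteq> 0\<close> by (simp add: e_def mconst_arith flip: mconst_arith(2))
  moreover have "mconst e * (mconst (c $ 1) * q 1 + mconst (c $ 2) * q 2 + mconst (c $ 3) * q 3 + mconst (c $ 4) * w) = 0"
    using rel by simp
  ultimately have "mconst e * mconst (c $ 1) * q 1 + mconst e * mconst (c $ 2) * q 2 + mconst e * mconst (c $ 3) * q 3 - w = 0"
    by (simp add: distrib_left flip: mult.assoc)
  then have "w = mconst (e * c $ 1) * q 1 + mconst (e * c $ 2) * q 2 + mconst (e * c $ 3) * q 3"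
    unfolding mconst_arith(2) by (simp add: algebra_simps)
  then have "w = (\<Sum>i\<in>UNIV. mconst (a $ i) * q i)" by (simp add: sum_3 a_def e_def)
  then show ?thesis by blast
qed

text \<open>
  The radical of \<open>l\<close> is spanned by the \<open>q i\<close>. If \<open>m\<close> were not a multiple of \<open>l\<close>, subtracting from it
  the smallest Rayleigh quotient times \<open>l\<close> would give a supporting functional whose radical has
  dimension at least four.
\<close>

lemma supporting_functional_unique:
  assumes f: "f \<in> Sigma6" "strictly_positive f" and l: "supports l f" "g \<in> forms 6" "l g \<noteq> 0"
    and q: "\<And>i. q i \<in> sextic_radical l" "independent_triple q" "f = (\<Sum>i\<in>UNIV. (q i)\<^sup>2)"
    and m: "sextic_functional m" "\<And>i p. p \<in> forms 3 \<Longrightarrow> m (q i * p) = 0"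
  shows "\<exists>r. \<forall>p\<in>forms 6. m p = r * l p"
proof -
  interpret l: sextic_functional l using l by (simp add: supports_def)
  interpret m: sextic_functional m by fact
  have psd: "0 \<le> l (p * p)" if "p \<in> forms 3" for p using l(1) that by (simp add: supports_def)
  have span: "\<exists>a :: real ^ 3. w = (\<Sum>i\<in>UNIV. mconst (a $ i) * q i)" if "w \<in> sextic_radical l" for w
    using radical_span[OF f l q(1,2) that] .
  have m_sum: "m (\<Sum>i\<in>I. h i) = (\<Sum>i\<in>I. m (h i))" for h and I :: "3 set"
    by (induction I rule: infinite_finite_induct) (simp_all add: m.zero m.add)
  define B where "B u v = l (cubic_form u * cubic_form v)" for u v
  define B' where "B' u v = m (cubic_form u * cubic_form v)" for u v
  have bil: "bilinear B" "bilinear B'"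
    unfolding bilinear_def B_def B'_def
    by (intro conjI allI linearI; simp add: cubic_form_add cubic_form_scaleR distrib_left distrib_right
        l.add m.add mult.assoc
        mult.left_commute[of "cubic_form x" "mconst r" for x r] l.scale m.scale)+
  have sym: "B u v = B v u" "B' u v = B' v u" for u v by (simp_all add: B_def B'_def mult.commute)
  have pos: "0 \<le> B u u" for u using psd cubic_form_forms by (simp add: B_def)
  have radical: "B u u = 0 \<longleftrightarrow> cubic_form u \<in> sextic_radical l" for u
    using radical_iff[OF l.sextic_functional_axioms psd cubic_form_forms] by (simp add: B_def)
  \<comment> \<open>The kernel condition of \<open>rayleigh_minimiser\<close>: the radical of
    \<open>l\<close> is spanned by the \<open>q i\<close>, and \<open>m\<close> vanishes on their
    products with cubics.\<close>
  have ker: "B' u v = 0" if "B u u = 0" for u v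
  proof -
    obtain a :: "real ^ 3" where "cubic_form u = (\<Sum>i\<in>UNIV. mconst (a $ i) * q i)" using span radical \<open>B u u = 0\<close> by blast
    then have "B' u v = (\<Sum>i\<in>UNIV. a $ i * m (q i * cubic_form v))"
      by (simp add: B'_def sum_distrib_right m_sum mult.assoc m.scale)
    then show ?thesis using m(2) cubic_form_forms by simp
  qed
  have "\<exists>w. B w w \<noteq> 0"
  proof (rule ccontr)
    assume "\<not> ?thesis"
    then have all: "p \<in> sextic_radical l" if "p \<in> forms 3" for p
      using radical[of "cubic_coeffs p"] cubic_form_coeffs[OF that] by simp
    \<comment> \<open>If all cubics lay in the radical, these four independent monomials would
      violate the bound on its dimension.\<close>
    define w :: "4 \<Rightarrow> (3, real) mpoly" where
      "w j = (if j = 1 then mvar 1 ^ 3 else if j = 2 then mvar 2 ^ 3 else if j = 3 then mvar 3 ^ 3 else mvar 1 ^ 2 * mvar 2 ^ 1)" for j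
    have "mvar i ^ 3 \<in> forms 3" "mvar 1 ^ 2 * mvar 2 ^ 1 \<in> forms 3" for i :: 3
      using forms_closed(8)[OF forms_closed(3), of i 3]
        forms_closed(6)[OF forms_closed(8)[OF forms_closed(3), of 1 2] forms_closed(8)[OF forms_closed(3), of 2 1]]
      by simp_all
    then have "w j \<in> sextic_radical l" for j by (auto simp: w_def intro: all)
    then obtain c :: "real ^ 4" where c: "c \<noteq> 0" "(\<Sum>i\<in>UNIV. mconst (c $ i) * w i) = 0"
      using supports_dependent[OF f l, of w] by blast
    have "mpoly_eval (\<Sum>i\<in>UNIV. mconst (c $ i) * w i) x = 0" for x by (simp add: c(2))
    then have "c $ 1 * (x $ 1) ^ 3 + c $ 2 * (x $ 2) ^ 3 + c $ 3 * (x $ 3) ^ 3 + c $ 4 * ((x $ 1)\<^sup>2 * x $ 2) = 0" for x :: "real ^ 3"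
      by (simp add: sum_4 w_def add.assoc)
    from this[of "vector [1, 0, 0]"] this[of "vector [0, 1, 0]"] this[of "vector [0, 0, 1]"] this[of "vector [1, 1, 0]"]
    have "c = 0" by (simp add: vec_eq_iff forall_4)
    with c(1) show False by simp
  qed
  then obtain w where "B w w \<noteq> 0" by blast
  then obtain r v where rv: "0 < B v v" "\<And>u. r * B u u \<le> B' u u" "\<And>u. B' v u = r * B v u"
    by (rule rayleigh_minimiser[OF bil(1) sym(1) pos _ bil(2) sym(2) ker]) (assumption, rule that)
  define n where "n p = m p - r * l p" for p
  have "n (p + p') = n p + n p'" "n (mconst s * p) = s * n p" for p p' s
    by (simp_all add: n_def l.add m.add l.scale m.scale distrib_left right_diff_distrib mult.left_commute)
  then have n: "sextic_functional n" by (rule sextic_functional.intro)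
  have n_psd: "0 \<le> n (p * p)" if "p \<in> forms 3" for p
    using rv(2)[of "cubic_coeffs p"] cubic_form_coeffs[OF that] by (simp add: n_def B_def B'_def)
  have q_forms: "q i \<in> forms 3" for i using q(1) by (rule l.W_forms)
  have "m f = 0" unfolding q(3) m_sum power2_eq_square by (intro sum.neutral ballI m(2) q_forms)
  then have n_supports: "supports n f" using n n_psd l(1) by (simp add: supports_def n_def)
  have "n p = 0" if p: "p \<in> forms 6" for p
  proof (rule ccontr)
    assume "n p \<noteq> 0"
    have "q i \<in> sextic_radical n" for i
      using q(1)[of i] m(2) by (simp add: sextic_radical_def n_def)
    moreover have "cubic_form v \<in> sextic_radical n"
    proof -
      have "n (cubic_form v * cubic_form v) = 0" using rv(3)[of v] by (simp add: n_def B_def B'_def)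
      then show ?thesis using radical_iff[OF n n_psd cubic_form_forms] by blast
    qed
    \<comment> \<open>The dimension bound for \<open>n\<close> puts \<open>cubic_form v\<close> into
      the span of the \<open>q i\<close>, hence into the radical of \<open>l\<close>, against B v v
      > 0.\<close>
    ultimately obtain a :: "real ^ 3" where "cubic_form v = (\<Sum>i\<in>UNIV. mconst (a $ i) * q i)"
      using radical_span[OF f n_supports p \<open>n p \<noteq> 0\<close> _ q(2)] by blast
    then have "cubic_form v \<in> sextic_radical l" using q(1) by (auto intro: l.W_sum l.W_closed)
    then show False using rv(1) radical[of v] by simp
  qed
  then show ?thesis by (auto simp: n_def)
qed

section \<open>Rational points and rational elements of the ideal\<close>

lemma eval_rational:
  assumes "P \<in> rational_mpolys" "\<And>i. x $ i \<in> \<rat>"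
  shows "mpoly_eval P x \<in> \<rat>"
proof -
  have "(\<Prod>i\<in>I. x $ i ^ n i) \<in> \<rat>" for I n
    using assms(2) by (induction I rule: infinite_finite_induct) auto
  then show ?thesis
    unfolding mpoly_eval_def using assms(1) by (intro Rats_sum Rats_mult) (auto simp: rational_mpolys_def)
qed

lemma pderiv_rational: "P \<in> rational_mpolys \<Longrightarrow> mpoly_pderiv i P \<in> rational_mpolys"
  unfolding mpoly_pderiv_def
  by (intro rational_mpolys_sum rational_mpolys_closed(5)) (auto simp: rational_mpolys_def)

lemma rational_sequence: "\<exists>u :: nat \<Rightarrow> real ^ 'n. (\<forall>n k. u n $ k \<in> \<rat>) \<and> u \<longlonglongrightarrow> x"
proof -
  have ex: "\<exists>y. y \<in> \<rat> \<and> x $ k < y \<and> y < x $ k + 1 / real (Suc n)" for n k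
    using Rats_dense_in_real[of "x $ k" "x $ k + 1 / real (Suc n)"] by auto
  define y where "y n k = (SOME y. y \<in> \<rat> \<and> x $ k < y \<and> y < x $ k + 1 / real (Suc n))" for n k
  have y: "y n k \<in> \<rat> \<and> x $ k < y n k \<and> y n k < x $ k + 1 / real (Suc n)" for n k
    unfolding y_def by (rule someI_ex[OF ex])
  have "(\<lambda>n. y n k) \<longlonglongrightarrow> x $ k" for k
  proof (rule tendsto_sandwich)
    show "\<forall>\<^sub>F n in sequentially. x $ k \<le> y n k" "\<forall>\<^sub>F n in sequentially. y n k \<le> x $ k + 1 / real (Suc n)"
      using y by (auto intro!: always_eventually less_imp_le)
    show "(\<lambda>n. x $ k + 1 / real (Suc n)) \<longlonglongrightarrow> x $ k"
      using tendsto_add[OF tendsto_const LIMSEQ_inverse_real_of_nat, of "x $ k"] by (simp add: inverse_eq_divide)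
  qed simp
  then have "(\<lambda>n. \<chi> k. y n k) \<longlonglongrightarrow> x" by (intro vec_tendstoI) simp
  then show ?thesis using y by (intro exI[of _ "\<lambda>n. \<chi> k. y n k"]) auto
qed

text \<open>Triples of rational cubics are dense among all triples of cubics, and the value of
  \<open>P\<close> depends continuously on the triple.\<close>

lemma vanishing_three_squares_rational:
  assumes zero: "\<And>q1 q2 q3. q1 \<in> forms 3 \<inter> rational_mpolys \<Longrightarrow> q2 \<in> forms 3 \<inter> rational_mpolys \<Longrightarrow>
      q3 \<in> forms 3 \<inter> rational_mpolys \<Longrightarrow> mpoly_eval P (sextic_coeffs (q1\<^sup>2 + q2\<^sup>2 + q3\<^sup>2)) = 0"
  shows "P \<in> vanishing_ideal three_squares"
proof -
  have sq: "sextic_coeffs ((cubic_form u)\<^sup>2) = (\<Sum>k\<in>UNIV. \<Sum>l\<in>UNIV. (u $ k * u $ l) *\<^sub>R sextic_coeffs (cubic_monomial k * cubic_monomial l))" for u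
  proof -
    have sum: "sextic_coeffs (\<Sum>k\<in>I. h k) = (\<Sum>k\<in>I. sextic_coeffs (h k))" for h and I :: "cubic_exponent set"
      by (induction I rule: infinite_finite_induct) (simp_all add: sextic_coeffs_linear, simp_all add: sextic_coeffs_def vec_eq_iff)
    show ?thesis unfolding power2_eq_square cubic_form_mult sum sextic_coeffs_linear ..
  qed
  have "mpoly_eval P (sextic_coeffs ((cubic_form u1)\<^sup>2 + (cubic_form u2)\<^sup>2 + (cubic_form u3)\<^sup>2)) = 0" for u1 u2 u3
  proof -
    obtain a1 a2 a3 where a: "\<And>n k. a1 n $ k \<in> \<rat>" "\<And>n k. a2 n $ k \<in> \<rat>" "\<And>n k. a3 n $ k \<in> \<rat>"
      and lim: "a1 \<longlonglongrightarrow> u1" "a2 \<longlonglongrightarrow> u2" "a3 \<longlonglongrightarrow> u3"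
      using rational_sequence[of u1] rational_sequence[of u2] rational_sequence[of u3] by blast
    have "isCont (mpoly_eval P) x" for x
      using continuous_on_mpoly_eval[OF continuous_on_id, of UNIV P] by (simp add: continuous_on_eq_continuous_at)
    moreover have "(\<lambda>n. sextic_coeffs ((cubic_form (a1 n))\<^sup>2 + (cubic_form (a2 n))\<^sup>2 + (cubic_form (a3 n))\<^sup>2))
        \<longlonglongrightarrow> sextic_coeffs ((cubic_form u1)\<^sup>2 + (cubic_form u2)\<^sup>2 + (cubic_form u3)\<^sup>2)"
      unfolding sextic_coeffs_linear sq by (intro tendsto_intros lim)
    ultimately have "(\<lambda>n. mpoly_eval P (sextic_coeffs ((cubic_form (a1 n))\<^sup>2 + (cubic_form (a2 n))\<^sup>2 + (cubic_form (a3 n))\<^sup>2)))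
        \<longlonglongrightarrow> mpoly_eval P (sextic_coeffs ((cubic_form u1)\<^sup>2 + (cubic_form u2)\<^sup>2 + (cubic_form u3)\<^sup>2))"
      by (rule isCont_tendsto_compose)
    moreover have "mpoly_eval P (sextic_coeffs ((cubic_form (a1 n))\<^sup>2 + (cubic_form (a2 n))\<^sup>2 + (cubic_form (a3 n))\<^sup>2)) = 0" for n
      using a by (intro zero) (simp_all add: cubic_form_forms cubic_form_rational)
    ultimately show ?thesis by (simp add: LIMSEQ_const_iff)
  qed
  then have "mpoly_eval P (sextic_coeffs (q1\<^sup>2 + q2\<^sup>2 + q3\<^sup>2)) = 0" if "q1 \<in> forms 3" "q2 \<in> forms 3" "q3 \<in> forms 3" for q1 q2 q3
    using that cubic_form_coeffs by metis
  then show ?thesis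
    by (auto simp: vanishing_ideal_def three_squares_def)
qed

lemma three_squares_subset: "three_squares \<subseteq> hypersurface_V"
proof -
  have "q1\<^sup>2 + q2\<^sup>2 + q3\<^sup>2 \<in> forms 6" if "q1 \<in> forms 3" "q2 \<in> forms 3" "q3 \<in> forms 3" for q1 q2 q3 :: "(3, real) mpoly"
    using that by (intro forms_closed square_forms)
  then have "three_squares \<subseteq> forms 6" by (auto simp: three_squares_def)
  then show ?thesis
    unfolding hypersurface_V_def three_squares_def[symmetric]
    by (auto simp: zariski_closure_def zero_set_def vanishing_ideal_def)
qed

lemma vanishing_ideal_V: "vanishing_ideal hypersurface_V = vanishing_ideal three_squares"
proof
  show "vanishing_ideal hypersurface_V \<subseteq> vanishing_ideal three_squares"
    using three_squares_subset by (auto simp: vanishing_ideal_def)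
  have "I \<subseteq> vanishing_ideal (zero_set I)" for I
    by (auto simp: zero_set_def vanishing_ideal_def)
  then show "vanishing_ideal three_squares \<subseteq> vanishing_ideal hypersurface_V"
    unfolding hypersurface_V_def three_squares_def[symmetric] zariski_closure_def .
qed

text \<open>
  Over the dense set of rational sums of three squares, vanishing is a system of rational linear
  equations in the coefficients, so \<open>F\<close> can be approximated by rational elements of its own ideal.
\<close>

lemma rational_gradient_direction:
  assumes F: "vanishing_ideal hypersurface_V = {P. F dvd P}"
    and x: "\<And>i. x $ i \<in> \<rat>" "mpoly_eval F x = 0"
    and i: "mpoly_eval (mpoly_pderiv i F) x \<noteq> 0"
  shows "\<exists>c. c \<noteq> 0 \<and> (\<forall>j. c * mpoly_eval (mpoly_pderiv j F) x \<in> \<rat>)"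
proof -
  define S where "S = Poly_Mapping.keys F"
  define \<kappa> where "\<kappa> m = of_nat (Poly_Mapping.lookup m i) * (\<Prod>j\<in>UNIV. x $ j ^ Poly_Mapping.lookup (m - Poly_Mapping.single i 1) j)" for m
  define K where "K = 1 + (\<Sum>m\<in>S. \<bar>\<kappa> m\<bar>)"
  have K: "K \<ge> 1" by (simp add: K_def sum_nonneg)
  \<comment> \<open>Changing each coefficient of \<open>F\<close> by less than \<delta> cannot
    annihilate the partial derivative with index \<open>i\<close> at \<open>x\<close>.\<close>
  define \<delta> where "\<delta> = \<bar>mpoly_eval (mpoly_pderiv i F) x\<bar> / K"
  have "0 < \<delta>" using i K by (simp add: \<delta>_def)
  obtain y where y: "\<forall>m\<in>S. y m \<in> \<rat> \<and> \<bar>y m - Poly_Mapping.lookup F m\<bar> < \<delta>"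
    and rel: "\<forall>e e0. (\<forall>m\<in>S. e m \<in> \<rat>) \<and> e0 \<in> \<rat> \<and> (\<Sum>m\<in>S. e m * Poly_Mapping.lookup F m) = e0 \<longrightarrow> (\<Sum>m\<in>S. e m * y m) = e0"
    using rational_approximation[OF _ \<open>0 < \<delta>\<close>, of S "Poly_Mapping.lookup F"] by (auto simp: S_def)
  define G where "G = (\<Sum>m\<in>S. Poly_Mapping.single m (y m))"
  have lookG: "Poly_Mapping.lookup G m = (if m \<in> S then y m else 0)" for m
    by (simp add: G_def lookup_sum lookup_single when_def S_def)
  have S: "finite S" "Poly_Mapping.keys F \<subseteq> S" "Poly_Mapping.keys G \<subseteq> S"
    by (auto simp: S_def[symmetric] in_keys_iff lookG split: if_splits) (simp add: S_def)
  have G_rat: "G \<in> rational_mpolys"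
    unfolding G_def using y by (intro rational_mpolys_sum rational_mpolys_closed(5)) auto
  have F0: "F \<in> vanishing_ideal three_squares" using F by (simp add: vanishing_ideal_V)
  have "G \<in> vanishing_ideal three_squares"
  proof (rule vanishing_three_squares_rational)
    fix q1 q2 q3 :: "(3, real) mpoly"
    assume q: "q1 \<in> forms 3 \<inter> rational_mpolys" "q2 \<in> forms 3 \<inter> rational_mpolys" "q3 \<in> forms 3 \<inter> rational_mpolys"
    define z where "z = sextic_coeffs (q1\<^sup>2 + q2\<^sup>2 + q3\<^sup>2)"
    have "q1\<^sup>2 + q2\<^sup>2 + q3\<^sup>2 \<in> rational_mpolys"
      unfolding power2_eq_square using q by (intro rational_mpolys_closed rational_mpolys_mult) auto
    then have z: "z $ j \<in> \<rat>" for j by (simp add: z_def sextic_coeffs_def rational_mpolys_def)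
    have "(\<Prod>j\<in>J. z $ j ^ n j) \<in> \<rat>" for J n
      using z by (induction J rule: infinite_finite_induct) auto
    moreover have "mpoly_eval F z = 0" using F0 q by (auto simp: vanishing_ideal_def three_squares_def z_def)
    then have "(\<Sum>m\<in>S. (\<Prod>j\<in>UNIV. z $ j ^ Poly_Mapping.lookup m j) * Poly_Mapping.lookup F m) = 0"
      by (simp add: mpoly_eval_superset[OF S(1,2)] mult.commute)
    ultimately have "(\<Sum>m\<in>S. (\<Prod>j\<in>UNIV. z $ j ^ Poly_Mapping.lookup m j) * y m) = 0"
      by (intro rel[rule_format]) auto
    then show "mpoly_eval G (sextic_coeffs (q1\<^sup>2 + q2\<^sup>2 + q3\<^sup>2)) = 0"
      unfolding z_def[symmetric] by (simp add: mpoly_eval_superset[OF S(1,3)] lookG mult.commute)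
  qed
  then have "F dvd G" using F by (auto simp: vanishing_ideal_V)
  then obtain H where H: "G = F * H" by (rule dvdE)
  have grad: "mpoly_eval (mpoly_pderiv j G) x = mpoly_eval H x * mpoly_eval (mpoly_pderiv j F) x" for j
    unfolding H using x(2) by (rule mpoly_pderiv_mult_at_zero)
  have "mpoly_eval (mpoly_pderiv i G) x - mpoly_eval (mpoly_pderiv i F) x = (\<Sum>m\<in>S. (y m - Poly_Mapping.lookup F m) * \<kappa> m)"
    unfolding mpoly_eval_pderiv[OF S(1,2)] mpoly_eval_pderiv[OF S(1,3)] \<kappa>_def
    by (simp add: lookG left_diff_distrib sum_subtractf)
  also have "\<bar>\<dots>\<bar> \<le> (\<Sum>m\<in>S. \<delta> * \<bar>\<kappa> m\<bar>)"
  proof (intro order.trans[OF sum_abs] sum_mono)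
    fix m assume "m \<in> S"
    then have "\<bar>y m - Poly_Mapping.lookup F m\<bar> \<le> \<delta>" using y by fastforce
    then show "\<bar>(y m - Poly_Mapping.lookup F m) * \<kappa> m\<bar> \<le> \<delta> * \<bar>\<kappa> m\<bar>"
      unfolding abs_mult by (rule mult_right_mono) simp
  qed
  also have "\<dots> = \<delta> * (K - 1)" by (simp add: K_def sum_distrib_left)
  also have "\<dots> < \<delta> * K" using \<open>0 < \<delta>\<close> by simp
  also have "\<dots> = \<bar>mpoly_eval (mpoly_pderiv i F) x\<bar>" using K by (simp add: \<delta>_def)
  finally have "mpoly_eval (mpoly_pderiv i G) x \<noteq> 0" by auto
  \<comment> \<open>The gradient of \<open>G\<close> at \<open>x\<close> is rational and is H(x)
    times that of \<open>F\<close>; the required scalar is H(x).\<close>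
  then have "mpoly_eval H x \<noteq> 0" using grad by auto
  moreover have "mpoly_eval H x * mpoly_eval (mpoly_pderiv j F) x \<in> \<rat>" for j
    using eval_rational[OF pderiv_rational[OF G_rat] x(1)] grad by metis
  ultimately show ?thesis by blast
qed

text \<open>
  At a regular point the gradient of \<open>F\<close> is a multiple of \<open>l\<close>, so the radical of \<open>l\<close> is defined
  over the rationals. Rational approximations of the \<open>q i\<close> inside it represent \<open>f\<close> by a Gram matrix
  close to the identity.
\<close>

lemma regular_point_rational_sos:
  assumes F: "vanishing_ideal hypersurface_V = {P. F dvd P}"
    and f: "f \<in> Sigma6" "strictly_positive f" "f \<in> rational_mpolys"
    and l: "supports l f" "g \<in> forms 6" "l g \<noteq> 0"
    and i: "mpoly_eval (mpoly_pderiv i F) (sextic_coeffs f) \<noteq> 0"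
  shows "f \<in> rational_sos"
proof -
  interpret l: sextic_functional l using l by (simp add: supports_def)
  define x where "x = sextic_coeffs f"
  have x: "x $ j \<in> \<rat>" for j using f(3) by (simp add: x_def sextic_coeffs_def rational_mpolys_def)
  obtain q :: "3 \<Rightarrow> (3, real) mpoly" where q_range: "range q \<subseteq> sextic_radical l" and q2: "f = (\<Sum>i\<in>UNIV. (q i)\<^sup>2)"
    using supports_three_squares[OF f(1,2) l] by (elim exE conjE)
  have q: "q i \<in> sextic_radical l" "f = (\<Sum>i\<in>UNIV. (q i)\<^sup>2)" for i using q_range q2 by auto
  have q_forms: "q i \<in> forms 3" for i using q(1) by (rule l.W_forms)
  have indep: "independent_triple q"
    unfolding independent_triple_def
  proof (intro allI impI)
    fix c :: "real ^ 3" assume "(\<Sum>i\<in>UNIV. mconst (c $ i) * q i) = 0"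
    then show "c = 0"
      using f(2) unfolding q2 by (intro strictly_positive_independent[of q c] q_forms)
  qed
  have F0: "F \<in> vanishing_ideal three_squares" using F by (simp add: vanishing_ideal_V)
  \<comment> \<open>Each \<open>q i\<close> takes the first place once, the one varied in
    \<open>gradient_tangent\<close>.\<close>
  have perm: "f = (q 1)\<^sup>2 + (q 2)\<^sup>2 + (q 3)\<^sup>2" "f = (q 2)\<^sup>2 + (q 1)\<^sup>2 + (q 3)\<^sup>2" "f = (q 3)\<^sup>2 + (q 1)\<^sup>2 + (q 2)\<^sup>2"
    using q(2) by (simp_all add: sum_3 add_ac)
  have "(q 1)\<^sup>2 + (q 2)\<^sup>2 + (q 3)\<^sup>2 \<in> three_squares"
    by (intro three_squaresI q_forms)
  then have "f \<in> three_squares" using perm(1) by simp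
  then have Fx: "mpoly_eval F x = 0" using F0 by (simp add: vanishing_ideal_def x_def)
  define m where "m p = (\<Sum>j\<in>UNIV. mpoly_eval (mpoly_pderiv j F) x * sextic_coeffs p $ j)" for p
  have "m (p + p') = m p + m p'" "m (mconst r * p) = r * m p" for p p' r
    by (simp_all add: m_def sextic_coeffs_linear distrib_left sum.distrib sum_distrib_left mult.left_commute)
  then have m: "sextic_functional m" by (rule sextic_functional.intro)
  have tangent: "m (q j * p) = 0" if p: "p \<in> forms 3" for j p
  proof -
    have "j = 1 \<or> j = 2 \<or> j = 3" by (rule exhaust_3)
    moreover have "m (q 1 * p) = 0" "m (q 2 * p) = 0" "m (q 3 * p) = 0"
      using gradient_tangent[OF F0 q_forms[of 1] q_forms[of 2] q_forms[of 3] p]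
        gradient_tangent[OF F0 q_forms[of 2] q_forms[of 1] q_forms[of 3] p]
        gradient_tangent[OF F0 q_forms[of 3] q_forms[of 1] q_forms[of 2] p]
      by (simp_all only: m_def x_def perm(1)[symmetric] perm(2)[symmetric] perm(3)[symmetric])
    ultimately show ?thesis by auto
  qed
  have "\<exists>r. \<forall>p\<in>forms 6. m p = r * l p"
    by (rule supporting_functional_unique[OF f(1,2) l q(1) indep q(2) m tangent])
  then obtain r where "\<forall>p\<in>forms 6. m p = r * l p" ..
  then have r: "m p = r * l p" if "p \<in> forms 6" for p using that by blast
  obtain e where "e \<in> forms 6" "sextic_coeffs e = axis i 1"
    using bij_betw_sextic_coeffs unfolding bij_betw_def by (metis UNIV_I imageE)
  then have "r * l e = mpoly_eval (mpoly_pderiv i F) x"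
    using r[of e] by (simp add: m_def axis_def if_distrib cong: if_cong)
  then have "r \<noteq> 0" using i by (auto simp: x_def)
  have "\<exists>c. c \<noteq> 0 \<and> (\<forall>j. c * mpoly_eval (mpoly_pderiv j F) x \<in> \<rat>)"
    by (rule rational_gradient_direction[OF F x Fx i[folded x_def]])
  then obtain c where c: "c \<noteq> 0" "\<forall>j. c * mpoly_eval (mpoly_pderiv j F) x \<in> \<rat>" by (elim exE conjE)
  \<comment> \<open>Scaled by \<open>c * r\<close>, the functional is rational on rational sextics,
    so its radical is cut out by rational linear equations.\<close>
  have l_rat: "c * r * l p \<in> \<rat>" if "p \<in> forms 6" "p \<in> rational_mpolys" for p
  proof -
    have "c * r * l p = c * m p" using r[OF that(1)] by simp
    also have "\<dots> = (\<Sum>j\<in>UNIV. (c * mpoly_eval (mpoly_pderiv j F) x) * sextic_coeffs p $ j)"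
      by (simp add: m_def sum_distrib_left mult.assoc)
    also have "\<dots> \<in> \<rat>"
      using that(2) by (intro Rats_sum Rats_mult[OF c(2)[rule_format]]) (simp add: sextic_coeffs_def rational_mpolys_def)
    finally show ?thesis .
  qed
  define u where "u i = cubic_coeffs (q i)" for i
  have qu: "q i = cubic_form (u i)" for i using q_forms by (simp add: u_def cubic_form_coeffs)
  have l_form: "l (cubic_form v * p) = (\<Sum>k\<in>UNIV. v $ k * l (cubic_monomial k * p))" for v p
  proof -
    have "l (\<Sum>k\<in>I. h k) = (\<Sum>k\<in>I. l (h k))" for h and I :: "cubic_exponent set"
      by (induction I rule: infinite_finite_induct) (simp_all add: l.zero l.add)
    then show ?thesis by (simp add: cubic_form_eq sum_distrib_right mult.assoc l.scale)
  qed
  define comb where "comb y a = (\<Sum>i\<in>UNIV. a $ i *\<^sub>R y i)" for y :: "3 \<Rightarrow> real ^ cubic_exponent" and a :: "real ^ 3"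
  have form_comb: "cubic_form (comb y a) = (\<Sum>i\<in>UNIV. mconst (a $ i) * cubic_form (y i))" for y a
    by (simp add: comb_def sum_3 cubic_form_add cubic_form_scaleR)
  have lin: "linear (comb y)" for y
    by (rule linearI) (simp_all add: comb_def scaleR_add_left sum.distrib scaleR_sum_right)
  have cubic_form_0: "cubic_form 0 = 0" using cubic_form_scaleR[of 0 0] by simp
  have "inj (comb u)"
    unfolding linear_injective_0[OF lin]
  proof (intro allI impI)
    fix a assume "comb u a = 0"
    then have "(\<Sum>i\<in>UNIV. mconst (a $ i) * q i) = 0" using form_comb[of u a] by (simp add: qu cubic_form_0)
    then show "a = 0" using indep by (simp add: independent_triple_def)
  qed
  then obtain B where B: "0 < B" "\<And>a. B * norm a \<le> norm (comb u a)"
    using linear_inj_bounded_below_pos[OF lin] by blast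
  define N where "N = real CARD(cubic_exponent)"
  have N: "0 < N" by (simp add: N_def)
  \<comment> \<open>Coordinate errors below \<delta> give norm errors of at most B / 60. The factor
    60 leads to |a i $ j| \<le> 1 / 30 further down, small enough for the Gram matrix.\<close>
  define \<delta> where "\<delta> = B / (60 * N)"
  have \<delta>: "0 < \<delta>" using B N by (simp add: \<delta>_def)
  have ex: "\<exists>v :: real ^ cubic_exponent. (\<forall>k. v $ k \<in> \<rat> \<and> \<bar>v $ k - u i $ k\<bar> < \<delta>) \<and> cubic_form v \<in> sextic_radical l" for i
  proof -
    obtain y where y: "\<forall>k\<in>UNIV. y k \<in> \<rat> \<and> \<bar>y k - u i $ k\<bar> < \<delta>"
      and rel: "\<forall>e e0. (\<forall>k\<in>UNIV. e k \<in> \<rat>) \<and> e0 \<in> \<rat> \<and> (\<Sum>k\<in>UNIV. e k * u i $ k) = e0 \<longrightarrow> (\<Sum>k\<in>UNIV. e k * y k) = e0"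
      using rational_approximation[OF finite_class.finite_UNIV \<delta>, of "\<lambda>k. u i $ k"] by blast
    define v :: "real ^ cubic_exponent" where "v = (\<chi> k. y k)"
    \<comment> \<open>For each \<open>k'\<close> this is one rational linear equation satisfied by
      the coefficients of \<open>q i\<close>, which the approximation inherits.\<close>
    have mono: "l (cubic_form v * cubic_monomial k') = 0" for k'
    proof -
      have "l (q i * cubic_monomial k') = 0" using q(1)[of i] cubic_monomial_props by (simp add: sextic_radical_def)
      then have "(\<Sum>k\<in>UNIV. (c * r * l (cubic_monomial k * cubic_monomial k')) * u i $ k) = 0"
        unfolding qu l_form by (simp add: mult.assoc mult.commute[of "l _"] flip: sum_distrib_left)
      moreover have "c * r * l (cubic_monomial k * cubic_monomial k') \<in> \<rat>" for k
        using forms_closed(6)[OF cubic_monomial_props(2)[of k] cubic_monomial_props(2)[of k']]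
        by (intro l_rat rational_mpolys_mult cubic_monomial_props) simp
      ultimately have "(\<Sum>k\<in>UNIV. (c * r * l (cubic_monomial k * cubic_monomial k')) * y k) = 0"
        by (intro rel[rule_format]) auto
      then have "c * r * l (cubic_form v * cubic_monomial k') = 0"
        unfolding l_form by (simp add: v_def sum_distrib_left mult.assoc mult.commute[of "y _"])
      then show ?thesis using c(1) \<open>r \<noteq> 0\<close> by simp
    qed
    have "l (cubic_form v * p) = 0" if "p \<in> forms 3" for p
    proof -
      have "l (cubic_form v * p) = l (cubic_form (cubic_coeffs p) * cubic_form v)"
        using that by (simp add: cubic_form_coeffs mult.commute)
      also have "\<dots> = 0"
        unfolding l_form[of "cubic_coeffs p"] mult.commute[of "cubic_monomial _"] mono by simp
      finally show ?thesis .
    qed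
    then have "cubic_form v \<in> sextic_radical l" by (simp add: sextic_radical_def cubic_form_forms)
    then show ?thesis using y by (intro exI[of _ v]) (simp add: v_def)
  qed
  define v where "v i = (SOME v. (\<forall>k. v $ k \<in> \<rat> \<and> \<bar>v $ k - u i $ k\<bar> < \<delta>) \<and> cubic_form v \<in> sextic_radical l)" for i
  have "(\<forall>k. v i $ k \<in> \<rat> \<and> \<bar>v i $ k - u i $ k\<bar> < \<delta>) \<and> cubic_form (v i) \<in> sextic_radical l" for i
    unfolding v_def by (rule someI_ex[OF ex])
  then have v: "v i $ k \<in> \<rat>" "\<bar>v i $ k - u i $ k\<bar> < \<delta>" "cubic_form (v i) \<in> sextic_radical l" for i k
    by simp_all
  have close: "norm (v i - u i) \<le> B / 60" for i
  proof -
    have "norm (v i - u i) \<le> (\<Sum>k\<in>UNIV. \<bar>(v i - u i) $ k\<bar>)" by (rule norm_le_l1_cart)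
    also have "\<dots> \<le> (\<Sum>k\<in>(UNIV :: cubic_exponent set). \<delta>)" using v(2) by (intro sum_mono) (simp add: less_imp_le)
    also have "\<dots> = B / 60" using N by (simp add: \<delta>_def flip: N_def)
    finally show ?thesis .
  qed
  \<comment> \<open>Perturbing the three vectors moves a combination by at most 3 (B / 60) norm a =
    (B / 20) norm a, so more than half of the lower bound survives and the \<open>v i\<close> stay
    independent.\<close>
  have below: "B / 2 * norm a \<le> norm (comb v a)" for a
  proof -
    have "norm (comb v a - comb u a) = norm (\<Sum>i\<in>UNIV. a $ i *\<^sub>R (v i - u i))"
      by (simp add: comb_def scaleR_diff_right sum_subtractf)
    also have "\<dots> \<le> (\<Sum>i\<in>(UNIV :: 3 set). norm a * (B / 60))"
    proof (intro order.trans[OF norm_sum] sum_mono)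
      fix i
      show "norm (a $ i *\<^sub>R (v i - u i)) \<le> norm a * (B / 60)"
        unfolding norm_scaleR by (intro mult_mono close component_le_norm_cart) auto
    qed
    also have "\<dots> = B * norm a / 20" by simp
    finally have "norm (comb v a - comb u a) \<le> B * norm a / 20" .
    moreover have "norm (comb u a) \<le> norm (comb v a) + norm (comb v a - comb u a)"
      using norm_triangle_ineq4[of "comb v a" "comb v a - comb u a"] by simp
    moreover have "0 \<le> B * norm a" using B(1) by simp
    ultimately show ?thesis using B(2)[of a] by linarith
  qed
  have v_indep: "independent_triple (\<lambda>i. cubic_form (v i))"
    unfolding independent_triple_def
  proof (intro allI impI)
    fix a :: "real ^ 3" assume "(\<Sum>i\<in>UNIV. mconst (a $ i) * cubic_form (v i)) = 0"
    then have "cubic_form (comb v a) = cubic_form 0" by (simp add: form_comb cubic_form_0)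
    then have "cubic_coeffs (cubic_form (comb v a)) = cubic_coeffs (cubic_form 0)" by (rule arg_cong)
    then have "comb v a = 0" by (simp only: cubic_coeffs_form)
    then have "B / 2 * norm a \<le> 0" using below[of a] by simp
    then show "a = 0" using B(1) by (simp add: mult_le_0_iff)
  qed
  have "\<exists>a :: real ^ 3. q i - cubic_form (v i) = (\<Sum>j\<in>UNIV. mconst (a $ j) * cubic_form (v j))" for i
    by (intro radical_span[OF f(1,2) l v(3) v_indep] l.W_closed q(1) v(3))
  then have "\<forall>i. \<exists>a :: real ^ 3. q i - cubic_form (v i) = (\<Sum>j\<in>UNIV. mconst (a $ j) * cubic_form (v j))" ..
  from choice[OF this] obtain a :: "3 \<Rightarrow> real ^ 3"
    where "\<forall>i. q i - cubic_form (v i) = (\<Sum>j\<in>UNIV. mconst (a i $ j) * cubic_form (v j))" ..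
  then have a: "q i - cubic_form (v i) = (\<Sum>j\<in>UNIV. mconst (a i $ j) * cubic_form (v j))" for i ..
  \<comment> \<open>Here \<open>comb v (a i) = u i - v i\<close> has norm at most B / 60, while
    \<open>below\<close> bounds it from below by (B / 2) norm (a i).\<close>
  have a_small: "\<bar>a i $ j\<bar> \<le> 1 / 30" for i j
  proof -
    have "cubic_form (v i + comb v (a i)) = cubic_form (u i)"
      using a[of i] by (simp add: cubic_form_add form_comb qu algebra_simps)
    then have "cubic_coeffs (cubic_form (v i + comb v (a i))) = cubic_coeffs (cubic_form (u i))" by (rule arg_cong)
    then have "v i + comb v (a i) = u i" by (simp only: cubic_coeffs_form)
    then have "comb v (a i) = u i - v i" by (simp add: algebra_simps)
    then have "B / 2 * norm (a i) \<le> B / 60" using below[of "a i"] close[of i] by (simp add: norm_minus_commute)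
    then have "norm (a i) \<le> 1 / 30" using B(1) by (simp add: field_simps)
    then show ?thesis using component_le_norm_cart[of "a i" j] by linarith
  qed
  define M where "M i j = (if i = j then 1 else 0) + a i $ j" for i j
  define w where "w j = cubic_form (v j)" for j
  have q_M: "q i = (\<Sum>j\<in>UNIV. mconst (M i j) * w j)" for i
  proof -
    have "(\<Sum>j\<in>UNIV. mconst (if i = j then 1 else 0) * w j) = (\<Sum>j\<in>UNIV. if i = j then w j else 0)"
      by (intro sum.cong) auto
    then have "(\<Sum>j\<in>UNIV. mconst (M i j) * w j) = w i + (q i - w i)"
      using a[of i] by (simp add: M_def mconst_arith(1) distrib_right sum.distrib w_def)
    then show ?thesis by simp
  qed
  \<comment> \<open>The matrix M^T M with M = 1 + a. Its entries differ from those of the identity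
    by at most 2 / 30 + 3 / 900, which is below the allowed 1 / 6.\<close>
  define G where "G j k = (\<Sum>i\<in>UNIV. M i j * M i k)" for j k
  show ?thesis
  proof (rule rational_sos_near_scalar_gram[of w f 1 G])
    show "w j \<in> rational_mpolys" for j unfolding w_def by (intro cubic_form_rational v)
    have msum: "mconst (\<Sum>i\<in>I. h i) = (\<Sum>i\<in>I. mconst (h i) :: (3, real) mpoly)" for h and I :: "3 set"
      by (induction I rule: infinite_finite_induct) (simp_all add: mconst_arith)
    have "(q i)\<^sup>2 = (\<Sum>j\<in>UNIV. \<Sum>k\<in>UNIV. mconst (M i j * M i k) * (w j * w k))" for i
      unfolding power2_eq_square q_M[of i] sum_product by (simp add: mconst_arith mult_ac)
    then have "f = (\<Sum>i\<in>UNIV. \<Sum>j\<in>UNIV. \<Sum>k\<in>UNIV. mconst (M i j * M i k) * (w j * w k))"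
      unfolding q(2) by simp
    also have "\<dots> = (\<Sum>j\<in>UNIV. \<Sum>i\<in>UNIV. \<Sum>k\<in>UNIV. mconst (M i j * M i k) * (w j * w k))" by (rule sum.swap)
    also have "\<dots> = (\<Sum>j\<in>UNIV. \<Sum>k\<in>UNIV. \<Sum>i\<in>UNIV. mconst (M i j * M i k) * (w j * w k))"
      by (intro sum.cong refl sum.swap)
    also have "\<dots> = (\<Sum>j\<in>UNIV. \<Sum>k\<in>UNIV. mconst (G j k) * (w j * w k))"
      by (simp only: G_def msum sum_distrib_right)
    finally show "f = (\<Sum>j\<in>UNIV. \<Sum>k\<in>UNIV. mconst (G j k) * (w j * w k))" .
    fix j k :: 3
    have "G j k = (\<Sum>i\<in>UNIV. (if i = j then (if i = k then 1 else 0) else 0) + (if i = j then a i $ k else 0)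
        + (if i = k then a i $ j else 0) + a i $ j * a i $ k)"
      unfolding G_def M_def by (intro sum.cong) (auto simp: algebra_simps)
    also have "\<dots> = (if j = k then 1 else 0) + a j $ k + a k $ j + (\<Sum>i\<in>UNIV. a i $ j * a i $ k)"
      by (simp add: sum.distrib)
    finally have "\<bar>G j k - (if j = k then 1 else 0)\<bar> \<le> \<bar>a j $ k\<bar> + \<bar>a k $ j\<bar> + \<bar>\<Sum>i\<in>UNIV. a i $ j * a i $ k\<bar>" by simp
    also have "\<bar>\<Sum>i\<in>UNIV. a i $ j * a i $ k\<bar> \<le> (\<Sum>i\<in>(UNIV :: 3 set). 1 / 30 * (1 / 30))"
    proof (intro order.trans[OF sum_abs] sum_mono)
      fix i
      show "\<bar>a i $ j * a i $ k\<bar> \<le> 1 / 30 * (1 / 30)"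
        unfolding abs_mult by (intro mult_mono a_small) auto
    qed
    also have "\<bar>a j $ k\<bar> + \<bar>a k $ j\<bar> + (\<Sum>i\<in>(UNIV :: 3 set). 1 / 30 * (1 / 30)) \<le> 1 / (2 * real CARD(3))"
      using a_small[of j k] a_small[of k j] by simp
    finally show "\<bar>G j k - (if j = k then 1 else 0)\<bar> \<le> 1 / (2 * real CARD(3))" by simp
  qed (use f(3) in auto)
qed

theorem theorem3p11:
  fixes f :: "(3, real) mpoly"
    and F :: "(sextic_exponent, real) mpoly"
  assumes "defining_equation F hypersurface_V"
    and "f \<in> Sigma6"
    and "strictly_positive f"
    and "f \<in> rational_mpolys"
    and "f \<notin> sums_of_squares rational_mpolys"
  shows "f \<in> sextic_boundary Sigma6 \<and> f \<in> singular_points F hypersurface_V"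
proof
  have f: "f \<in> forms 6" using assms(2) by (rule Sigma6_forms)
  have F: "vanishing_ideal hypersurface_V = {P. F dvd P}" using assms(1) by (simp add: defining_equation_def)
  have not_interior: "sextic_coeffs f \<notin> interior (sextic_coeffs ` Sigma6)"
    using interior_Sigma6_rational_sos[OF f assms(4)] assms(5) by blast
  moreover have "sextic_coeffs f \<in> closure (sextic_coeffs ` Sigma6)"
    by (rule subsetD[OF closure_subset imageI[OF assms(2)]])
  ultimately show "f \<in> sextic_boundary Sigma6" using f by (simp add: sextic_boundary_def frontier_def)
  obtain l g where l: "supports l f" "g \<in> forms 6" "l g \<noteq> 0"
    by (rule exists_supporting_functional[OF assms(2) not_interior])
  then interpret l: sextic_functional l by (simp add: supports_def)
  obtain q :: "3 \<Rightarrow> (3, real) mpoly" where q_range: "range q \<subseteq> sextic_radical l" and q2: "f = (\<Sum>i\<in>UNIV. (q i)\<^sup>2)"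
    using supports_three_squares[OF assms(2,3) l] by (elim exE conjE)
  have q: "q i \<in> sextic_radical l" "f = (\<Sum>i\<in>UNIV. (q i)\<^sup>2)" for i using q_range q2 by auto
  have "(q 1)\<^sup>2 + (q 2)\<^sup>2 + (q 3)\<^sup>2 \<in> three_squares"
    by (intro three_squaresI l.W_forms q)
  then have "f \<in> three_squares" using q2 by (simp add: sum_3)
  then have "f \<in> hypersurface_V" by (rule subsetD[OF three_squares_subset])
  moreover have "mpoly_eval (mpoly_pderiv i F) (sextic_coeffs f) = 0" for i
  proof (rule ccontr)
    assume "mpoly_eval (mpoly_pderiv i F) (sextic_coeffs f) \<noteq> 0"
    from regular_point_rational_sos[OF F assms(2-4) l this] assms(5) show False by contradiction
  qed
  ultimately show "f \<in> singular_points F hypersurface_V" by (simp add: singular_points_def)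
qed

end
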